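(* For $q\in\mathbb{R}^+$, the scalar product $$\begin{aligned}\langle\psi_1|\psi_2\rangle_q=\frac{q-q^{-1}}{2\ln q}\int dz\,d\bar z\,\Biggl(&\overline{\psi_1(z,\bar z,q^{-1})}\,\frac{1}{(1+z\bar z)(1+q^{-2}z\bar z)}\,q^{-z\partial_z-\bar z\partial_{\bar z}-1}\psi_2(z,\bar z,q)\\&+\overline{\psi_1(z,\bar z,q)}\,\frac{1}{(1+z\bar z)(1+q^{2}z\bar z)}\,q^{z\partial_z+\bar z\partial_{\bar z}+1}\psi_2(z,\bar z,q^{-1})\Biggr),\end{aligned}$$ or $$\begin{aligned}\langle\psi_1|\psi_2\rangle_q=\frac{q-q^{-1}}{8\ln q}\int_0^\pi d\theta\,\sin\theta\int_0^{2\pi}d\phi\,\Biggl(&\overline{\psi_1(\theta,\phi,q^{-1})}\,\frac{1}{\sin^2(\theta/2)+q^{-2}\cos^2(\theta/2)}\,q^{\sin\theta\,\partial_\theta-1}\psi_2(\theta,\phi,q)\\&+\overline{\psi_1(\theta,\phi,q)}\,\frac{1}{\sin^2(\theta/2)+q^{2}\cos^2(\theta/2)}\,q^{-\sin\theta\,\partial_\theta+1}\psi_2(\theta,\phi,q^{-1})\Biggr),\end{aligned}$$ unitarizes the su$_q$(2) realization $H_3,H_+,H_-$ given in the context (i.e. with respect to it $H_3^\dagger=H_3$ and $H_\pm^\dagger=H_\mp$), where $N$ may take any integer or half-integer value. The functions $\Psi^J_{MNq}(z,\bar z)$, or $\Psi^J_{MNq}(\theta,\phi)$, defined in the context, where $J=|N|,|N|+1,\dots$,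 $M=-J,-J+1,\dots,J$, and $\gamma(J,N,q)=1$, form an orthonormal set with respect to such a scalar product.
   Context: Notation: $[x]_q=\frac{q^x-q^{-x}}{q-q^{-1}}$; $[x]_q!=[x]_q[x-1]_q\cdots[1]_q$ for positive integers $x$, $[0]_q!=1$, and $1/[x]_q!=0$ for negative integers $x$. At $q=1$ all expressions are read as their limits $q\to1$. Coordinates: $z=x+iy=\rho e^{i\phi}$, $\bar z=\rho e^{-i\phi}$, $\rho=\cot(\theta/2)$, $0\le\theta\le\pi$, $0\le\phi<2\pi$, $\eta=z\bar z=\rho^2$; $dz\,d\bar z$ denotes $dx\,dy=\rho\,d\rho\,d\phi$ and the integral extends over the whole complex plane. The operators $q^{a(z\partial_z+\bar z\partial_{\bar z})}=q^{a\rho\partial_\rho}=q^{-a\sin\theta\,\partial_\theta}$ act by $\rho\mapsto q^a\rho$ with $\phi$ fixed. Functions $\psi$ depend also on $q$: $\psi(\cdot,q^{-1})$ is obtained from $\psi(\cdot,q)$ by changing $q$ into $q^{-1}$. In particular, $(H\psi)(\cdot,q^{-1})$ is obtained by changing $q$ into $q^{-1}$ in both the operator $H$ and the function $\psi$. Realization of su$_q$(2), with $T=z\partial_z$, $\bar T=\bar z\partial_{\bar z}$: $$H_3=-z\partial_z+\bar z\partial_{\bar z}-N,$$ $$H_+=-z^{-1}[T]_q\,q^{\bar T-N/2}-q^{T+N/2}\,\bar z\,[\bar T-N]_q,\qquad H_-=z\,[T+N]_q\,q^{\bar T-N/2}+q^{T+N/2}\,\bar z^{-1}[\bar T]_q .$$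 These satisfy $[H_3,H_\pm]=\pm H_\pm$, $[H_+,H_-]=[2H_3]_q$. Basis functions ($J,M,N$ simultaneously integers or half-integers): $$\Psi^J_{MNq}(z,\bar z)=N^J_{MNq}\,Q_{Jq}(\eta)\,q^{-NM/2}\,R^J_{MNq}(\eta)\,\bar z^{M+N},$$ $$N^J_{MNq}=C_{JNq}\left(\frac{[J+M]_q!}{[J-M]_q!\,[2J]_q!}\right)^{1/2},\qquad C_{JNq}=\frac{1}{\sqrt{2\pi}}\left(\frac{[J+N]_q!\,[2J+1]_q!}{[J-N]_q!}\right)^{1/2}\gamma(J,N,q),$$ $$R^J_{MNq}(\eta)=[J-N]_q!\,[J-M]_q!\sum_k\frac{(-\eta)^k}{[k]_q!\,[J-M-k]_q!\,[J-N-k]_q!\,[M+N+k]_q!}$$ (sum over integers $k$ for which all factorial arguments are nonnegative), and $$Q_{Jq}(\eta)=\prod_{k=0}^\infty\frac{1+q^{2k}\eta}{1+q^{-2J+2k}\eta}\ (0<q<1),\qquad Q_{Jq}(\eta)=\prod_{k=0}^\infty\frac{1+q^{-2J-2k-2}\eta}{1+q^{-2k-2}\eta}\ (q>1),$$ which for integer $J$ both reduce to $\prod_{k=0}^{J-1}(1+\eta q^{-2J+2k})^{-1}$, and which go over into $(1+\eta)^{-J}$ as $q\to1$. $\Psi^J_{MNq}(\theta,\phi)$ is the same function expressed in the coordinates $\theta,\phi$.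
   Formalization: The relations H_3†=H_3, H_±†=H_∓ are asserted for functions that are C^1 away from the poles, analytically continuable in e^{iφ}, bounded on each phase circle, with z∂_zψ and z̄∂_z̄ψ bounded; without such a domain they fail (q=1, N=0, ψ_1=1, ψ_2=1/z̄). *)

theory Defs
  imports "HOL-Analysis.Analysis"
begin

definition qnum :: "real \<Rightarrow> real \<Rightarrow> real" where
  "qnum q x = (if q = 1 then x else (q powr x - q powr (- x)) / (q - inverse q))"

text \<open>Only used at integral \<open>x \<ge> 0\<close>; the argument is real because it is built from
  possibly half-integral \<open>J, M, N\<close>.\<close>

definition qfact :: "real \<Rightarrow> real \<Rightarrow> real" where
  "qfact q x = (\<Prod>k = 1..nat \<lfloor>x\<rfloor>. qnum q (real k))"

text \<open>\<open>z \<partial>\<^sub>z\<close> and \<open>cnj z \<partial>\<^bsub>cnj z\<^esub>\<close> with the usual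
  \<open>\<partial>\<^sub>z = (\<partial>\<^sub>x - i \<partial>\<^sub>y)/2\<close> and \<open>\<partial>\<^bsub>cnj z\<^esub> = (\<partial>\<^sub>x + i \<partial>\<^sub>y)/2\<close>.\<close>

definition T_op :: "(complex \<Rightarrow> complex) \<Rightarrow> complex \<Rightarrow> complex" where
  "T_op f z = z * ((frechet_derivative f (at z) 1 - \<i> * frechet_derivative f (at z) \<i>) / 2)"

definition Tbar_op :: "(complex \<Rightarrow> complex) \<Rightarrow> complex \<Rightarrow> complex" where
  "Tbar_op f z = cnj z * ((frechet_derivative f (at z) 1 + \<i> * frechet_derivative f (at z) \<i>) / 2)"

text \<open>In polar coordinates \<open>z = \<rho> u\<close>, \<open>u = exp (i \<phi>)\<close>, one has
  \<open>z \<partial>\<^sub>z = (\<rho> \<partial>\<^sub>\<rho> + u \<partial>\<^sub>u) / 2\<close> and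
  \<open>cnj z \<partial>\<^bsub>cnj z\<^esub> = (\<rho> \<partial>\<^sub>\<rho> - u \<partial>\<^sub>u) / 2\<close>.  Hence \<open>q\<close> to the power
  \<open>a z \<partial>\<^sub>z + b cnj z \<partial>\<^bsub>cnj z\<^esub>\<close> multiplies \<open>\<rho>\<close> by \<open>q powr ((a + b) / 2)\<close> and
  \<open>u\<close> by \<open>q powr ((a - b) / 2)\<close> (formally, \<open>z\<close> goes to \<open>q\<^sup>a z\<close> and \<open>cnj z\<close>, as an
  independent variable, to \<open>q\<^sup>b cnj z\<close>).  For \<open>a \<noteq> b\<close> the new \<open>u\<close> is off the unit circle,
  so for each \<open>\<rho>\<close> the function has to be continued analytically in \<open>u\<close> from the unit circle to
  the punctured plane; the continuation is unique.  It maps \<open>u ^ m\<close> to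
  \<open>q powr (m (a - b) / 2) * u ^ m\<close>.\<close>

definition phase_extension :: "(complex \<Rightarrow> complex) \<Rightarrow> real \<Rightarrow> (complex \<Rightarrow> complex) \<Rightarrow> bool" where
  "phase_extension f \<rho> g \<longleftrightarrow>
     g holomorphic_on (- {0}) \<and> (\<forall>u. norm u = 1 \<longrightarrow> g u = f (of_real \<rho> * u))"

definition phase_ext :: "(complex \<Rightarrow> complex) \<Rightarrow> real \<Rightarrow> complex \<Rightarrow> complex" where
  "phase_ext f \<rho> = (SOME g. phase_extension f \<rho> g)"

definition qpow :: "real \<Rightarrow> real \<Rightarrow> real \<Rightarrow> (complex \<Rightarrow> complex) \<Rightarrow> complex \<Rightarrow> complex" where
  "qpow q a b f z =
     (if q = 1 then f z
      else phase_ext f (q powr ((a + b) / 2) * norm z) (of_real (q powr ((a - b) / 2)) * sgn z))"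

text \<open>\<open>[z \<partial>\<^sub>z + c]\<^sub>q\<close> and \<open>[cnj z \<partial>\<^bsub>cnj z\<^esub> + c]\<^sub>q\<close>, with their limits at \<open>q = 1\<close>.\<close>

definition qnum_T :: "real \<Rightarrow> real \<Rightarrow> (complex \<Rightarrow> complex) \<Rightarrow> complex \<Rightarrow> complex" where
  "qnum_T q c f z =
     (if q = 1 then T_op f z + of_real c * f z
      else (of_real (q powr c) * qpow q 1 0 f z - of_real (q powr (- c)) * qpow q (- 1) 0 f z)
             / of_real (q - inverse q))"

definition qnum_Tbar :: "real \<Rightarrow> real \<Rightarrow> (complex \<Rightarrow> complex) \<Rightarrow> complex \<Rightarrow> complex" where
  "qnum_Tbar q c f z =
     (if q = 1 then Tbar_op f z + of_real c * f z
      else (of_real (q powr c) * qpow q 0 1 f z - of_real (q powr (- c)) * qpow q 0 (- 1) f z)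
             / of_real (q - inverse q))"

text \<open>Wave functions are families indexed by \<open>q\<close>, and the operators map families to
  families.  So the value of \<open>H \<psi>\<close> at \<open>inverse q\<close> has \<open>q\<close> inverted both in the operator and in
  the function.\<close>

type_synonym wavefun = "real \<Rightarrow> complex \<Rightarrow> complex"

definition H3 :: "real \<Rightarrow> wavefun \<Rightarrow> wavefun" where
  "H3 N \<psi> q z = - T_op (\<psi> q) z + Tbar_op (\<psi> q) z - of_real N * \<psi> q z"

definition Hplus :: "real \<Rightarrow> wavefun \<Rightarrow> wavefun" where
  "Hplus N \<psi> q z =
     - inverse z * qnum_T q 0 (\<lambda>w. of_real (q powr (- N / 2)) * qpow q 0 1 (\<psi> q) w) z
     - of_real (q powr (N / 2)) * qpow q 1 0 (\<lambda>w. cnj w * qnum_Tbar q (- N) (\<psi> q) w) z"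

definition Hminus :: "real \<Rightarrow> wavefun \<Rightarrow> wavefun" where
  "Hminus N \<psi> q z =
     z * qnum_T q N (\<lambda>w. of_real (q powr (- N / 2)) * qpow q 0 1 (\<psi> q) w) z
     + of_real (q powr (N / 2)) * qpow q 1 0 (\<lambda>w. inverse (cnj w) * qnum_Tbar q 0 (\<psi> q) w) z"

text \<open>The functions on which the adjointness relations are asserted: continuously
  differentiable away from \<open>z = 0\<close> and \<open>z = \<infinity>\<close> (the two poles of the sphere), with an analytic
  continuation in the phase, and bounded together with \<open>T f\<close>, \<open>Tbar f\<close>.  Analytic
  continuation is what gives a meaning to \<open>q\<close> to the power \<open>z \<partial>\<^sub>z\<close>; the bounds make the integrals
  converge and the boundary terms at the poles vanish.  Neither smoothness at the poles nor a
  finite Fourier expansion in \<open>\<phi>\<close> is required.\<close>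

definition admissible :: "(complex \<Rightarrow> complex) \<Rightarrow> bool" where
  "admissible f \<longleftrightarrow>
     (\<forall>z. z \<noteq> 0 \<longrightarrow> f differentiable (at z)) \<and>
     continuous_on (- {0}) (T_op f) \<and> continuous_on (- {0}) (Tbar_op f) \<and>
     (\<forall>\<rho>>0. \<exists>g. phase_extension f \<rho> g) \<and>
     (\<forall>r>0. \<exists>B. \<forall>\<rho>>0. \<forall>u. norm u = r \<longrightarrow> norm (phase_ext f \<rho> u) \<le> B) \<and>
     (\<exists>B. \<forall>z. z \<noteq> 0 \<longrightarrow> norm (T_op f z) \<le> B \<and> norm (Tbar_op f z) \<le> B)"

text \<open>The limit of \<open>(q - 1/q) / (2 ln q)\<close> as \<open>q\<close> tends to \<open>1\<close> is \<open>1\<close>.\<close>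

definition log_factor :: "real \<Rightarrow> real" where
  "log_factor q = (if q = 1 then 1 else (q - inverse q) / (2 * ln q))"

definition plane_integrand :: "real \<Rightarrow> wavefun \<Rightarrow> wavefun \<Rightarrow> complex \<Rightarrow> complex" where
  "plane_integrand q \<psi>1 \<psi>2 z =
     cnj (\<psi>1 (inverse q) z)
       * of_real (1 / ((1 + (norm z)\<^sup>2) * (1 + q powr (- 2) * (norm z)\<^sup>2)))
       * (of_real (inverse q) * \<psi>2 q (of_real (inverse q) * z))
     + cnj (\<psi>1 q z)
       * of_real (1 / ((1 + (norm z)\<^sup>2) * (1 + q\<^sup>2 * (norm z)\<^sup>2)))
       * (of_real q * \<psi>2 (inverse q) (of_real q * z))"

definition plane_converges :: "real \<Rightarrow> wavefun \<Rightarrow> wavefun \<Rightarrow> bool" where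
  "plane_converges q \<psi>1 \<psi>2 \<longleftrightarrow> integrable lborel (plane_integrand q \<psi>1 \<psi>2)"

definition scalar_plane :: "real \<Rightarrow> wavefun \<Rightarrow> wavefun \<Rightarrow> complex" where
  "scalar_plane q \<psi>1 \<psi>2 = of_real (log_factor q) * (LINT z|lborel. plane_integrand q \<psi>1 \<psi>2 z)"

definition on_sphere :: "wavefun \<Rightarrow> real \<Rightarrow> real \<Rightarrow> real \<Rightarrow> complex" where
  "on_sphere \<psi> q \<theta> \<phi> = \<psi> q (of_real (cot (\<theta> / 2)) * cis \<phi>)"

text \<open>The polar angle whose \<open>cot (\<theta> / 2)\<close> is \<open>s\<close> times the given one, i.e. the flow of
  \<open>- sin \<theta> \<partial>\<^sub>\<theta>\<close> for the time \<open>ln s\<close>.\<close>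

definition polar_dilate :: "real \<Rightarrow> real \<Rightarrow> real" where
  "polar_dilate s \<theta> = 2 * arctan (tan (\<theta> / 2) / s)"

definition sphere_integrand :: "real \<Rightarrow> wavefun \<Rightarrow> wavefun \<Rightarrow> real \<Rightarrow> real \<Rightarrow> complex" where
  "sphere_integrand q \<psi>1 \<psi>2 \<theta> \<phi> =
     cnj (on_sphere \<psi>1 (inverse q) \<theta> \<phi>)
       * of_real (1 / ((sin (\<theta> / 2))\<^sup>2 + q powr (- 2) * (cos (\<theta> / 2))\<^sup>2))
       * (of_real (inverse q) * on_sphere \<psi>2 q (polar_dilate (inverse q) \<theta>) \<phi>)
     + cnj (on_sphere \<psi>1 q \<theta> \<phi>)
       * of_real (1 / ((sin (\<theta> / 2))\<^sup>2 + q\<^sup>2 * (cos (\<theta> / 2))\<^sup>2))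
       * (of_real q * on_sphere \<psi>2 (inverse q) (polar_dilate q \<theta>) \<phi>)"

definition sphere_converges :: "real \<Rightarrow> wavefun \<Rightarrow> wavefun \<Rightarrow> bool" where
  "sphere_converges q \<psi>1 \<psi>2 \<longleftrightarrow>
     set_integrable lborel ({0..pi} \<times> {0..2 * pi})
       (\<lambda>(\<theta>, \<phi>). of_real (sin \<theta>) * sphere_integrand q \<psi>1 \<psi>2 \<theta> \<phi>)"

definition scalar_sphere :: "real \<Rightarrow> wavefun \<Rightarrow> wavefun \<Rightarrow> complex" where
  "scalar_sphere q \<psi>1 \<psi>2 = of_real (log_factor q / 4) *
     (LINT \<theta>:{0..pi}|lborel. of_real (sin \<theta>) *
       (LINT \<phi>:{0..2 * pi}|lborel. sphere_integrand q \<psi>1 \<psi>2 \<theta> \<phi>))"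

text \<open>\<open>B\<close> is the adjoint of \<open>A\<close> for the form \<open>S\<close>, whose defining integral converges when \<open>C\<close>
  holds.\<close>

definition adjoint_wrt ::
  "(real \<Rightarrow> wavefun \<Rightarrow> wavefun \<Rightarrow> complex) \<Rightarrow> (real \<Rightarrow> wavefun \<Rightarrow> wavefun \<Rightarrow> bool) \<Rightarrow> real \<Rightarrow>
   (wavefun \<Rightarrow> wavefun) \<Rightarrow> (wavefun \<Rightarrow> wavefun) \<Rightarrow> bool" where
  "adjoint_wrt S C q A B \<longleftrightarrow>
     (\<forall>\<psi>1 \<psi>2. (\<forall>p>0. admissible (\<psi>1 p)) \<and> (\<forall>p>0. admissible (\<psi>2 p)) \<longrightarrow>
        C q \<psi>1 \<psi>2 \<and> C q \<psi>1 (A \<psi>2) \<and> C q (B \<psi>1) \<psi>2 \<and> S q \<psi>1 (A \<psi>2) = S q (B \<psi>1) \<psi>2)"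

definition unitarizes ::
  "(real \<Rightarrow> wavefun \<Rightarrow> wavefun \<Rightarrow> complex) \<Rightarrow> (real \<Rightarrow> wavefun \<Rightarrow> wavefun \<Rightarrow> bool) \<Rightarrow> real \<Rightarrow> real \<Rightarrow> bool"
  where
  "unitarizes S C q N \<longleftrightarrow>
     adjoint_wrt S C q (H3 N) (H3 N) \<and>
     adjoint_wrt S C q (Hplus N) (Hminus N) \<and>
     adjoint_wrt S C q (Hminus N) (Hplus N)"

definition Q_fun :: "real \<Rightarrow> real \<Rightarrow> real \<Rightarrow> real" where
  "Q_fun J q \<eta> =
     (if q = 1 then (1 + \<eta>) powr (- J)
      else if q < 1 then
        (\<Prod>k. (1 + q powr (2 * real k) * \<eta>) / (1 + q powr (- 2 * J + 2 * real k) * \<eta>))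
      else
        (\<Prod>k. (1 + q powr (- 2 * J - 2 * real k - 2) * \<eta>) / (1 + q powr (- 2 * real k - 2) * \<eta>)))"

definition R_fun :: "real \<Rightarrow> real \<Rightarrow> real \<Rightarrow> real \<Rightarrow> real \<Rightarrow> real" where
  "R_fun J M N q \<eta> = qfact q (J - N) * qfact q (J - M) *
     (\<Sum>k | real k \<le> J - M \<and> real k \<le> J - N \<and> 0 \<le> M + N + real k.
        (- \<eta>) ^ k / (qfact q (real k) * qfact q (J - M - real k) * qfact q (J - N - real k)
                      * qfact q (M + N + real k)))"

definition C_coeff :: "(real \<Rightarrow> real \<Rightarrow> real \<Rightarrow> real) \<Rightarrow> real \<Rightarrow> real \<Rightarrow> real \<Rightarrow> real" where
  "C_coeff \<gamma> J N q =
     1 / sqrt (2 * pi) * sqrt (qfact q (J + N) * qfact q (2 * J + 1) / qfact q (J - N)) * \<gamma> J N q"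

definition N_coeff :: "(real \<Rightarrow> real \<Rightarrow> real \<Rightarrow> real) \<Rightarrow> real \<Rightarrow> real \<Rightarrow> real \<Rightarrow> real \<Rightarrow> real" where
  "N_coeff \<gamma> J M N q = C_coeff \<gamma> J N q * sqrt (qfact q (J + M) / (qfact q (J - M) * qfact q (2 * J)))"

text \<open>\<open>M + N\<close> is an integer (possibly negative) for all indices that occur.\<close>

definition Psi :: "(real \<Rightarrow> real \<Rightarrow> real \<Rightarrow> real) \<Rightarrow> real \<Rightarrow> real \<Rightarrow> real \<Rightarrow> wavefun" where
  "Psi \<gamma> J M N q z =
     of_real (N_coeff \<gamma> J M N q * Q_fun J q ((norm z)\<^sup>2) * q powr (- N * M / 2)
                * R_fun J M N q ((norm z)\<^sup>2)) * cnj z powi \<lfloor>M + N\<rfloor>"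

text \<open>\<open>J = |N|, |N| + 1, \<dots>\<close> and \<open>M = -J, -J + 1, \<dots>, J\<close>.\<close>

definition basis_index :: "real \<Rightarrow> (real \<times> real) set" where
  "basis_index N = {(J, M). J - \<bar>N\<bar> \<in> \<nat> \<and> J + M \<in> \<nat> \<and> M \<le> J}"

definition orthonormal_family ::
  "(real \<Rightarrow> wavefun \<Rightarrow> wavefun \<Rightarrow> complex) \<Rightarrow> (real \<Rightarrow> wavefun \<Rightarrow> wavefun \<Rightarrow> bool) \<Rightarrow> real \<Rightarrow>
   'i set \<Rightarrow> ('i \<Rightarrow> wavefun) \<Rightarrow> bool" where
  "orthonormal_family S C q I e \<longleftrightarrow>
     (\<forall>i\<in>I. \<forall>j\<in>I. C q (e i) (e j) \<and> S q (e i) (e j) = (if i = j then 1 else 0))"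

end

theory Submission
  imports Defs "HOL-Complex_Analysis.Complex_Analysis"
begin

text \<open>Formally \<open>q\<close> to the power \<open>z \<partial>\<^sub>z\<close> and its conjugate dilate the radius and rotate the phase by an
  imaginary angle.  In the scalar product a dilation is moved to the other factor by a change of
  variable, which interchanges the two weights, and a complex rotation by shifting the contour of the
  phase integral; at \<open>q = 1\<close> both become integration by parts.

  For orthonormality the phase integral separates different \<open>M\<close>.  For equal \<open>M\<close> the infinite products
  and the weight telescope to a finite product, so that a \<open>q\<close>-beta integral reduces the scalar product
  to finite sums.  The sum over the coefficients of \<open>R\<close> with the larger \<open>J\<close> is a \<open>q\<close>-difference whose order
  exceeds the degree of its argument; when both \<open>J\<close> agree only the leading coefficient survives, and
  the \<open>q\<close>-Vandermonde identity sums the rest.\<close>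

subsection \<open>Polar coordinates\<close>

text \<open>The pairing of \<open>q\<close> with \<open>inverse q\<close> carries both claims. In
  one summand the left factor is taken at \<open>inverse p\<close> and the right one at
  \<open>p\<close> after the dilation by \<open>inverse p\<close>. The dilation inside
  \<open>Hplus\<close> at \<open>p\<close> cancels that one, the dilation inside
  \<open>Hminus\<close> at \<open>inverse p\<close> reproduces it, so one substitution matches them;
  and of the two \<open>Q\<close> one is given by its formula below 1 and the other by its formula
  above 1, with the same infinite tails. Two obstacles come first. \<open>admissible\<close>
  controls the continuation one radius and one circle at a time, whereas plane integrals need
  continuity in radius and phase jointly; compactness of the family of continuations supplies it.
  And \<open>Hplus\<close>, \<open>Hminus\<close> may turn bounded functions into functions growing
  like 1/|z| at one pole and |z| at the other, so convergence is measured against the kernel 1/(|z|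
  (1 + a |z|^2)), which the polar Jacobian turns into a Cauchy density. \<open>J\<close> may be
  half-integral, so no single \<open>Q\<close> is a finite product; only \<open>J + J' + 2\<close>
  is always natural, and it is the number of factors left.\<close>

lemma measurable_vec_nth_borel [measurable]: "(\<lambda>v::real^'n. v $ i) \<in> borel_measurable borel"
  by (intro borel_measurable_continuous_onI continuous_intros)

lemma Basis_real2: "(Basis :: (real^2) set) = {axis 1 1, axis 2 1}"
  by (auto simp: Basis_vec_def UNIV_2)

lemma emeasure_box_real2:
  assumes "a \<le> c" "b \<le> d"
  shows "emeasure lborel (box (vector [a, b]) (vector [c, d] :: real^2)) = ennreal ((c - a) * (d - b))"
proof -
  have "emeasure lborel (box (vector [a, b]) (vector [c, d] :: real^2)) =
    (\<Prod>e\<in>Basis. (vector [c, d] - vector [a, b] :: real^2) \<bullet> e)"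
    by (rule emeasure_lborel_box) (use assms in \<open>auto simp: Basis_real2 inner_axis\<close>)
  also have "\<dots> = ennreal ((c - a) * (d - b))"
    by (simp add: Basis_real2 axis_eq_axis inner_axis)
  finally show ?thesis .
qed

text \<open>The change of variables for injective differentiable maps is applied in
  \<open>real^2\<close>. This lemma and the next transport Lebesgue measure from there to the
  complex plane and to pairs of parameters.\<close>

lemma lborel_complex_eq_real2: "(lborel :: complex measure) = distr (lborel :: (real^2) measure) borel (\<lambda>v. Complex (v$1) (v$2))"
proof (rule lborel_eqI)
  have m [measurable]: "(\<lambda>v::real^2. Complex (v$1) (v$2)) \<in> borel_measurable borel"
    unfolding Complex_eq by measurable
  fix l u :: complex assume *: "\<And>b. b \<in> Basis \<Longrightarrow> l \<bullet> b \<le> u \<bullet> b"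
  have le: "Re l \<le> Re u" "Im l \<le> Im u" using *[of 1] *[of \<i>] by (auto simp: Basis_complex_def)
  have "(\<lambda>v::real^2. Complex (v$1) (v$2)) -` box l u \<inter> space lborel = box (vector [Re l, Im l]) (vector [Re u, Im u])"
    by (auto simp: mem_box_cart forall_2 mem_box Basis_complex_def)
  then show "emeasure (distr (lborel :: (real^2) measure) borel (\<lambda>v. Complex (v$1) (v$2))) (box l u) = (\<Prod>b\<in>Basis. (u - l) \<bullet> b)"
    using le by (simp add: emeasure_distr emeasure_box_real2 Basis_complex_def)
qed simp

lemma lborel_prod_eq_real2: "(lborel :: (real \<times> real) measure) = distr (lborel :: (real^2) measure) borel (\<lambda>v. (v$1, v$2))"
proof (rule lborel_eqI)
  have m [measurable]: "(\<lambda>v::real^2. (v$1, v$2)) \<in> borel_measurable borel"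
    by (intro borel_measurable_continuous_onI continuous_intros)
  fix l u :: "real \<times> real" assume *: "\<And>b. b \<in> Basis \<Longrightarrow> l \<bullet> b \<le> u \<bullet> b"
  have le: "fst l \<le> fst u" "snd l \<le> snd u" using *[of "(1,0)"] *[of "(0,1)"] by (auto simp: Basis_prod_def inner_prod_def)
  have "(\<lambda>v::real^2. (v$1, v$2)) -` box l u \<inter> space lborel = box (vector [fst l, snd l]) (vector [fst u, snd u])"
    by (auto simp: mem_box_cart forall_2 mem_box Basis_prod_def inner_prod_def)
  then show "emeasure (distr (lborel :: (real^2) measure) borel (\<lambda>v. (v$1, v$2))) (box l u) = (\<Prod>b\<in>Basis. (u - l) \<bullet> b)"
    using le by (simp add: emeasure_distr emeasure_box_real2 Basis_prod_def inner_prod_def)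
qed simp

lemma polar_surj:
  assumes "z \<noteq> 0"
  obtains \<phi> where "0 \<le> \<phi>" "\<phi> < 2 * pi" "z = of_real (norm z) * cis \<phi>"
  using Arg2pi_eq[of z] Arg2pi_ge_0[of z] Arg2pi_lt_2pi[of z] by (metis cis_conv_exp)

lemma polar_unique:
  assumes "of_real r * cis \<phi> = of_real r' * cis \<phi>'" "r > 0" "r' > 0"
    "0 \<le> \<phi>" "\<phi> < 2 * pi" "0 \<le> \<phi>'" "\<phi>' < 2 * pi"
  shows "r = r' \<and> \<phi> = \<phi>'"
proof
  have "norm (of_real r * cis \<phi>) = norm (of_real r' * cis \<phi>')" using assms by simp
  then show "r = r'" using assms(2,3) by (simp add: norm_mult)
  show "\<phi> = \<phi>'"
    using Arg2pi_unique[of r \<phi>] Arg2pi_unique[of r' \<phi>'] assms by (metis cis_conv_exp)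
qed

text \<open>Polar coordinates whose radius is re-parametrised by \<open>r\<close>: the identity for \<open>\<rho>\<close>,
  \<open>cot (\<theta> / 2)\<close> for the sphere, and \<open>sqrt\<close> for the variable \<open>\<eta> = \<rho>\<^sup>2\<close>.\<close>

locale radial_chart =
  fixes I :: "real set" and r r' :: "real \<Rightarrow> real"
  assumes open_I: "open I"
    and contr': "continuous_on I r'"
    and derr: "\<And>s. s \<in> I \<Longrightarrow> (r has_real_derivative r' s) (at s)"
    and injr: "inj_on r I" and imr: "r ` I = {0<..}"
begin

definition chart :: "real \<times> real \<Rightarrow> complex" where
  "chart x = (if fst x \<in> I then of_real (r (fst x)) * cis (snd x) else 0)"

text \<open>The indicator also restricts the angle to a half-open period, so that the density lives
  where the chart is injective. The absolute value covers decreasing radial functions such as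
  \<open>cot_half\<close>.\<close>

definition jac :: "real \<times> real \<Rightarrow> real" where
  "jac x = indicator (I \<times> {0..<2*pi}) x * \<bar>r (fst x) * r' (fst x)\<bar>"

lemma r_pos: "s \<in> I \<Longrightarrow> r s > 0" using imr by auto

lemma contr: "continuous_on I r"
  using derr DERIV_continuous_on by (metis DERIV_subset subset_UNIV)

lemma I_borel [measurable]: "I \<in> sets borel" using open_I by (rule borel_open)

lemma r_ind_measurable [measurable]: "(\<lambda>s. indicator I s * r s) \<in> borel_measurable borel"
  "(\<lambda>s. indicator I s * r' s) \<in> borel_measurable borel"
  using borel_measurable_continuous_on_indicator[OF I_borel contr]
    borel_measurable_continuous_on_indicator[OF I_borel contr'] by simp_all

lemma chart_measurable [measurable]: "chart \<in> borel_measurable borel"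
proof -
  have "chart = (\<lambda>x. of_real (indicator I (fst x) * r (fst x)) * cis (snd x))"
    by (auto simp: chart_def fun_eq_iff)
  moreover have "(\<lambda>x::real\<times>real. cis (snd x)) \<in> borel_measurable borel"
    by (intro borel_measurable_continuous_onI continuous_intros)
  moreover have "(\<lambda>x::real\<times>real. complex_of_real (indicator I (fst x) * r (fst x))) \<in> borel_measurable borel"
    by (rule measurable_compose[of _ borel borel],
        rule measurable_compose[OF _ r_ind_measurable(1)])
       (auto simp: borel_prod[symmetric] intro!: borel_measurable_continuous_onI continuous_intros)
  ultimately show ?thesis
    by (simp only: borel_measurable_times)
qed

lemma jac_measurable [measurable]: "jac \<in> borel_measurable borel"
proof -
  have "jac = (\<lambda>x. indicator {0..<2*pi} (snd x) * \<bar>(indicator I (fst x) * r (fst x)) * (indicator I (fst x) * r' (fst x))\<bar>)"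
    by (auto simp: jac_def fun_eq_iff indicator_def)
  moreover have "(\<lambda>x::real\<times>real. indicator I (fst x) * r (fst x)) \<in> borel_measurable borel"
    by (rule measurable_compose[OF _ r_ind_measurable(1)]) (simp add: borel_prod[symmetric])
  moreover have "(\<lambda>x::real\<times>real. indicator I (fst x) * r' (fst x)) \<in> borel_measurable borel"
    by (rule measurable_compose[OF _ r_ind_measurable(2)]) (simp add: borel_prod[symmetric])
  moreover have "(\<lambda>x::real\<times>real. indicator {0..<2*pi} (snd x) :: real) \<in> borel_measurable borel"
    by (rule measurable_compose[of snd borel borel]) (auto simp: borel_prod[symmetric])
  ultimately show ?thesis by simp
qed

text \<open>Lebesgue measure is determined by boxes. A box without the origin is the injective image
  of the parameter set \<open>S\<close>, so its measure is the integral of the Jacobian over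
  \<open>S\<close>; the origin is a null set.\<close>

theorem lborel_eq_chart: "(lborel :: complex measure) = distr (density lborel (\<lambda>x. ennreal (jac x))) borel chart"
proof (rule lborel_eqI)
  fix l u :: complex assume *: "\<And>b. b \<in> Basis \<Longrightarrow> l \<bullet> b \<le> u \<bullet> b"
  define S where "S = {v::real^2. v$1 \<in> I \<and> v$2 \<in> {0..<2*pi} \<and> of_real (r (v$1)) * cis (v$2) \<in> box l u}"
  define g where "g v = (vector [r (v$1) * cos (v$2), r (v$1) * sin (v$2)] :: real^2)" for v :: "real^2"
  define g' where "g' v h = (vector [r' (v$1) * h$1 * cos (v$2) - r (v$1) * (h$2 * sin (v$2)),
       r' (v$1) * h$1 * sin (v$2) + r (v$1) * (h$2 * cos (v$2))] :: real^2)" for v h :: "real^2"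
  define c where "c v = Complex (v$1) (v$2)" for v :: "real^2"
  have cm [measurable]: "c \<in> borel_measurable borel" unfolding c_def Complex_eq by measurable
  have cg: "c (g v) = of_real (r (v$1)) * cis (v$2)" for v
    by (simp add: c_def g_def complex_eq_iff)
  have vm [measurable]: "(\<lambda>v::real^2. (v$1, v$2)) \<in> borel_measurable borel"
    by (intro borel_measurable_continuous_onI continuous_intros)
  have S_eq: "S = {v. v$1 \<in> I} \<inter> {v. v$2 \<in> {0..<2*pi}} \<inter> (\<lambda>v. chart (v$1, v$2)) -` box l u"
    by (auto simp: S_def chart_def)
  have [measurable]: "(\<lambda>v::real^2. chart (v$1, v$2)) \<in> borel_measurable borel"
    by (rule measurable_compose[OF vm chart_measurable])
  have S_borel [measurable]: "S \<in> sets borel"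
    unfolding S_eq by (intro sets.Int measurable_sets_borel[of _ borel]) (measurable)
  have S_leb: "S \<in> sets lebesgue" using S_borel by simp
  have der: "(g has_derivative g' v) (at v within S)" if "v \<in> S" for v
  proof -
    have v: "v $ 1 \<in> I" using that by (simp add: S_def)
    have n: "((\<lambda>v::real^2. v$i) has_derivative (\<lambda>h. h$i)) (at v within S)" for i
      by (rule bounded_linear_imp_has_derivative) (rule bounded_linear_vec_nth) 
    have rr: "((\<lambda>v::real^2. r (v$1)) has_derivative (\<lambda>h. r' (v$1) * h$1)) (at v within S)"
      using has_derivative_compose[OF n[of 1] derr[OF v, unfolded has_field_derivative_def]] by simp
    show ?thesis unfolding has_derivative_componentwise_within[of g]
    proof
      fix i :: "real^2" assume "i \<in> Basis"
      then consider "i = axis 1 1" | "i = axis 2 1" by (auto simp: Basis_real2)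
      then show "((\<lambda>x. g x \<bullet> i) has_derivative (\<lambda>x. g' v x \<bullet> i)) (at v within S)"
        by cases (auto simp: g_def g'_def inner_axis intro!: derivative_eq_intros rr n
            simp: algebra_simps fun_eq_iff)
    qed
  qed
  have inj: "inj_on g S"
  proof (rule inj_onI)
    fix v w assume vw: "v \<in> S" "w \<in> S" "g v = g w"
    then have "c (g v) = c (g w)" by simp
    then have "of_real (r (v$1)) * cis (v$2) = of_real (r (w$1)) * cis (w$2)" by (simp only: cg)
    then have "r (v$1) = r (w$1) \<and> v$2 = w$2"
      using vw r_pos by (intro polar_unique) (auto simp: S_def)
    then have "v$1 = w$1 \<and> v$2 = w$2" using injr vw by (auto simp: S_def inj_on_def)
    then show "v = w" by (simp add: vec_eq_iff forall_2)
  qed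
  have img: "g ` S = c -` box l u - {0}"
  proof (intro equalityI subsetI)
    fix x assume "x \<in> g ` S"
    then obtain v where v: "v \<in> S" "x = g v" by auto
    then have "c x \<in> box l u" by (simp add: cg S_def)
    moreover have "c x \<noteq> 0" unfolding v cg using v r_pos[of "v$1"] by (auto simp: S_def)
    moreover have "c 0 = 0" by (simp add: c_def complex_eq_iff)
    ultimately show "x \<in> c -` box l u - {0}" by auto
  next
    fix x assume x: "x \<in> c -` box l u - {0}"
    then have "c x \<noteq> 0" by (auto simp: c_def complex_eq_iff vec_eq_iff forall_2)
    then obtain \<phi> where p: "0 \<le> \<phi>" "\<phi> < 2 * pi" "c x = of_real (norm (c x)) * cis \<phi>"
      by (rule polar_surj)
    have "norm (c x) \<in> r ` I" using \<open>c x \<noteq> 0\<close> imr by simp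
    then obtain s where s: "s \<in> I" "norm (c x) = r s" by auto
    define v :: "real^2" where "v = vector [s, \<phi>]"
    have "c (g v) = c x" unfolding cg using p(3) s by (simp add: v_def)
    then have "g v = x" by (simp add: c_def vec_eq_iff forall_2)
    moreover have "v \<in> S" using s p x by (auto simp: S_def v_def)
    ultimately show "x \<in> g ` S" by blast
  qed
  have det: "\<bar>det (matrix (g' v))\<bar> = \<bar>r (v$1) * r' (v$1)\<bar>" for v
  proof -
    have "det (matrix (g' v)) = r (v$1) * r' (v$1) * ((cos (v$2))\<^sup>2 + (sin (v$2))\<^sup>2)"
      by (simp add: det_2 matrix_def g'_def axis_def power2_eq_square algebra_simps del: sin_cos_squared_add sin_cos_squared_add2 sin_cos_squared_add3)
    then show ?thesis by simp
  qed
  have em: "emeasure lborel (c -` box l u) = emeasure (lborel :: complex measure) (box l u)"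
    unfolding lborel_complex_eq_real2 c_def[symmetric] by (subst emeasure_distr) auto
  have lm: "g ` S \<in> lmeasurable"
  proof -
    have "c -` box l u \<in> sets borel" using measurable_sets_borel[OF cm, of "box l u"] by simp
    then have "c -` box l u - {0} \<in> sets borel" by (intro sets.Diff) auto
    moreover have "emeasure lborel (c -` box l u - {0}) \<le> emeasure lborel (c -` box l u)"
      by (rule emeasure_mono) (use \<open>c -` box l u \<in> sets borel\<close> in auto)
    moreover have "emeasure lborel (c -` box l u) < \<infinity>" unfolding em using emeasure_lborel_box_finite by auto
    ultimately show ?thesis unfolding img fmeasurable_def by (auto)
  qed
  define m where "m = measure lebesgue (g ` S)"
  have hi: "((\<lambda>v. \<bar>r (v$1) * r' (v$1)\<bar>) has_integral m) S"
    using has_measure_differentiable_image[OF S_leb der inj, of m] lm by (simp add: m_def det)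
  have "emeasure (distr (density lborel (\<lambda>x. ennreal (jac x))) borel chart) (box l u)
     = emeasure (density lborel (\<lambda>x. ennreal (jac x))) (chart -` box l u)"
    by (subst emeasure_distr) auto
  also have "\<dots> = (\<integral>\<^sup>+x. ennreal (jac x) * indicator (chart -` box l u) x \<partial>lborel)"
    by (subst emeasure_density) (auto intro!: measurable_sets_borel[OF chart_measurable])
  also have "\<dots> = (\<integral>\<^sup>+v. ennreal (jac (v$1,v$2)) * indicator (chart -` box l u) (v$1,v$2) \<partial>(lborel::(real^2) measure))"
    unfolding lborel_prod_eq_real2
    by (subst nn_integral_distr) (auto intro!: borel_measurable_times_ennreal borel_measurable_indicator measurable_sets_borel[OF chart_measurable])
  also have "\<dots> = (\<integral>\<^sup>+v. ennreal \<bar>r (v$1) * r' (v$1)\<bar> * indicator S v \<partial>lborel)"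
    by (intro nn_integral_cong) (auto simp: jac_def chart_def S_def indicator_def)
  also have "\<dots> = ennreal m"
    by (rule nn_integral_has_integral_lebesgue'[OF _ hi]) auto
  also have "\<dots> = emeasure lborel (c -` box l u - {0})"
  proof -
    have "c -` box l u - {0} \<in> sets borel" using measurable_sets_borel[OF cm, of "box l u"] by auto
    then show ?thesis using lm unfolding m_def img
      by (subst emeasure_eq_measure2[symmetric]) auto
  qed
  also have "\<dots> = emeasure lborel (c -` box l u)"
    using measurable_sets_borel[OF cm, of "box l u"]
    by (intro emeasure_Diff_null_set) auto
  also have "\<dots> = (\<Prod>b\<in>Basis. (u - l) \<bullet> b)" unfolding em using * by (rule emeasure_lborel_box)
  finally show "emeasure (distr (density lborel (\<lambda>x. ennreal (jac x))) borel chart) (box l u) = (\<Prod>b\<in>Basis. (u - l) \<bullet> b)" .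
qed simp

lemma integrable_chart:
  fixes f :: "complex \<Rightarrow> complex"
  assumes [measurable]: "f \<in> borel_measurable borel"
  shows "integrable lborel f \<longleftrightarrow> integrable lborel (\<lambda>x. jac x *\<^sub>R f (chart x))"
proof -
  have nn: "AE x in lborel. 0 \<le> jac x" by (auto simp: jac_def)
  show ?thesis
    by (subst lborel_eq_chart, subst integrable_distr_eq) (auto simp: integrable_density nn)
qed

lemma integral_chart:
  fixes f :: "complex \<Rightarrow> complex"
  assumes [measurable]: "f \<in> borel_measurable borel"
  shows "(LINT z|lborel. f z) = (LINT x|lborel. jac x *\<^sub>R f (chart x))"
proof -
  have nn: "AE x in lborel. 0 \<le> jac x" by (auto simp: jac_def)
  show ?thesis
    by (subst lborel_eq_chart, subst integral_distr) (auto simp: integral_density nn)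
qed

lemma integrable_chart_pair:
  fixes f :: "complex \<Rightarrow> complex"
  assumes f: "integrable lborel f"
  shows "integrable (lborel \<Otimes>\<^sub>M lborel) (\<lambda>(s, \<phi>). jac (s, \<phi>) *\<^sub>R f (chart (s, \<phi>)))"
proof -
  have "f \<in> borel_measurable borel" using f by auto
  from integrable_chart[OF this] f show ?thesis
    by (simp add: lborel_prod case_prod_beta')
qed

lemma integral_chart_fst:
  fixes f :: "complex \<Rightarrow> complex"
  assumes f: "integrable lborel f"
  shows "(LINT z|lborel. f z) = (LINT s|lborel. LINT \<phi>|lborel. jac (s, \<phi>) *\<^sub>R f (chart (s, \<phi>)))"
proof -
  have "f \<in> borel_measurable borel" using f by auto
  then have "(LINT z|lborel. f z) = integral\<^sup>L (lborel \<Otimes>\<^sub>M lborel) (\<lambda>(s, \<phi>). jac (s, \<phi>) *\<^sub>R f (chart (s, \<phi>)))"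
    by (simp add: integral_chart lborel_prod case_prod_beta')
  then show ?thesis using lborel_pair.integral_fst'[OF integrable_chart_pair[OF f]] by simp
qed

lemma integral_chart_snd:
  fixes f :: "complex \<Rightarrow> complex"
  assumes f: "integrable lborel f"
  shows "(LINT z|lborel. f z) = (LINT \<phi>|lborel. LINT s|lborel. jac (s, \<phi>) *\<^sub>R f (chart (s, \<phi>)))"
proof -
  have "f \<in> borel_measurable borel" using f by auto
  then have "(LINT z|lborel. f z) = integral\<^sup>L (lborel \<Otimes>\<^sub>M lborel) (\<lambda>(s, \<phi>). jac (s, \<phi>) *\<^sub>R f (chart (s, \<phi>)))"
    by (simp add: integral_chart lborel_prod case_prod_beta')
  then show ?thesis using lborel_pair.integral_snd[OF integrable_chart_pair[OF f]] by simp
qed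

end

section \<open>The plane and the sphere as charts; equality of the two scalar products\<close>

interpretation pol: radial_chart "{0<..}" "\<lambda>s. s" "\<lambda>s. 1"
  by unfold_locales auto

definition cot_half :: "real \<Rightarrow> real" where
  "cot_half \<theta> = cot (\<theta> / 2)"

definition cot_half' :: "real \<Rightarrow> real" where
  "cot_half' \<theta> = - inverse (2 * (sin (\<theta> / 2))\<^sup>2)"

lemma cot_half_deriv:
  assumes "s \<in> {0<..<pi}"
  shows "(cot_half has_real_derivative cot_half' s) (at s)"
proof -
  have "sin (s / 2) > 0" using assms by (intro sin_gt_zero) auto
  then have "((\<lambda>\<theta>. cot (\<theta> / 2)) has_real_derivative - inverse ((sin (s / 2))\<^sup>2) * (1 / 2)) (at s)"
    by (intro DERIV_chain2[OF DERIV_cot]) (auto intro!: derivative_eq_intros)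
  then show ?thesis
    by (simp add: cot_half_def[abs_def] cot_half'_def)
qed

lemma cot_half_image: "cot_half ` {0<..<pi} = {0<..}"
proof (intro equalityI subsetI)
  fix x :: real assume x: "x \<in> {0<..}"
  define t where "t = 2 * arctan (1 / x)"
  have "t > 0" "t < pi" using x arctan_ubound[of "1/x"] by (auto simp: t_def)
  moreover have "cot (t / 2) = x" using tan_arctan[of "1/x"]
    using x by (simp add: t_def cot_altdef)
  ultimately show "x \<in> cot_half ` {0<..<pi}" by (auto intro!: image_eqI[of _ _ t] simp: cot_half_def)
next
  fix x :: real assume "x \<in> cot_half ` {0<..<pi}"
  then show "x \<in> {0<..}" by (auto simp: cot_gt_zero cot_half_def)
qed

lemma cot_half_inj: "inj_on cot_half {0<..<pi}"
proof -
  have "cot_half x \<noteq> cot_half y" if "0 < x" "x < y" "y < pi" for x y :: real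
  proof -
    have "cot_half y < cot_half x"
    proof (rule DERIV_neg_imp_decreasing[of x y cot_half])
      show "x < y" by fact
      fix t assume "x \<le> t" "t \<le> y"
      then have t: "t \<in> {0<..<pi}" using that by auto
      then have "sin (t / 2) > 0" by (intro sin_gt_zero) auto
      then show "\<exists>d. (cot_half has_real_derivative d) (at t) \<and> d < 0"
        using cot_half_deriv[OF t] by (auto intro!: exI[of _ "cot_half' t"] simp: cot_half'_def)
    qed
    then show ?thesis by simp
  qed
  then show ?thesis by (auto simp: inj_on_def) (metis linorder_neqE_linordered_idom)
qed

interpretation sph: radial_chart "{0<..<pi}" cot_half cot_half'
proof
  show "continuous_on {0<..<pi} cot_half'"
    unfolding cot_half'_def
    by (auto intro!: continuous_intros) (smt (verit) sin_gt_zero field_sum_of_halves)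
qed (auto simp: cot_half_image cot_half_inj intro!: cot_half_deriv)

text \<open>With s and c the sine and cosine of half the polar angle, 1 + |z|^2 is 1/s^2, so the two
  weights differ by 1/s^4, while the Jacobian is c/(2 s^3). Since sin of the angle is 2 s c, the
  factor 4 remains, the ratio of the prefactors 1/2 and 1/8 of the two scalar products.\<close>

lemma sphere_integrand_eq:
  assumes "q > 0" "\<theta> \<in> {0<..<pi}" "0 \<le> \<phi>" "\<phi> < 2 * pi"
  shows "of_real (sin \<theta>) * sphere_integrand q \<psi>1 \<psi>2 \<theta> \<phi>
    = 4 * (sph.jac (\<theta>, \<phi>) *\<^sub>R plane_integrand q \<psi>1 \<psi>2 (sph.chart (\<theta>, \<phi>)))"
proof -
  define s c where "s = sin (\<theta> / 2)" and "c = cos (\<theta> / 2)"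
  have sc: "s > 0" "c > 0" using assms
    by (auto simp: s_def c_def intro!: sin_gt_zero cos_gt_zero)
  have s1: "s\<^sup>2 + c\<^sup>2 = 1" by (simp add: s_def c_def)
  have sin: "sin \<theta> = 2 * s * c" using sin_double[of "\<theta>/2"] by (simp add: s_def c_def)
  define z where "z = sph.chart (\<theta>, \<phi>)"
  have z: "z = of_real (c / s) * cis \<phi>" using assms by (simp add: z_def sph.chart_def cot_half_def cot_def s_def c_def)
  have nz: "(norm z)\<^sup>2 = c\<^sup>2 / s\<^sup>2" using sc by (simp add: z norm_mult norm_divide power_divide)
  have jac: "sph.jac (\<theta>, \<phi>) = c / (2 * s ^ 3)"
    using assms sc by (simp add: sph.jac_def cot_half_def cot_half'_def cot_def s_def[symmetric] c_def[symmetric] abs_mult field_simps power_numeral_reduce)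
  have "tan (\<theta> / 2) = s / c" by (simp add: tan_def s_def c_def)
  then have dil: "cot (polar_dilate p \<theta> / 2) = p * (c / s)" if "p > 0" for p
    using sc that by (simp add: polar_dilate_def cot_altdef tan_arctan)
  have on: "on_sphere \<psi> p \<theta> \<phi> = \<psi> p z" for \<psi> p
    by (simp add: on_sphere_def z cot_def s_def c_def)
  have on': "on_sphere \<psi> p (polar_dilate p' \<theta>) \<phi> = \<psi> p (of_real p' * z)" if "p' > 0" for \<psi> p p'
    by (simp add: on_sphere_def dil[OF that] z mult.assoc)
  have w: "1 / (s\<^sup>2 + a * c\<^sup>2) = (1 / s ^ 4) * (1 / ((1 + (norm z)\<^sup>2) * (1 + a * (norm z)\<^sup>2)))" if "a > 0" for a
  proof -
    have "1 + (norm z)\<^sup>2 = 1 / s\<^sup>2" using s1 sc by (simp add: nz field_simps)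
    moreover have "1 + a * (norm z)\<^sup>2 = (s\<^sup>2 + a * c\<^sup>2) / s\<^sup>2" using sc by (simp add: nz field_simps)
    ultimately show ?thesis using sc by (simp add: power_numeral_reduce)
  qed
  have si: "sphere_integrand q \<psi>1 \<psi>2 \<theta> \<phi> = of_real (1 / s ^ 4) * plane_integrand q \<psi>1 \<psi>2 z"
    unfolding sphere_integrand_def plane_integrand_def s_def[symmetric] c_def[symmetric]
    using assms(1) by (simp add: on on' w del: of_real_divide of_real_power) (simp add: algebra_simps)
  show ?thesis unfolding si sin jac z_def[symmetric]
    using sc by (simp add: scaleR_conv_of_real field_simps power_numeral_reduce)
qed

lemma sphere_eq_plane:
  assumes q: "q > 0" and c: "plane_converges q \<psi>1 \<psi>2"
  shows "sphere_converges q \<psi>1 \<psi>2" "scalar_sphere q \<psi>1 \<psi>2 = scalar_plane q \<psi>1 \<psi>2"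
proof -
  let ?p = "plane_integrand q \<psi>1 \<psi>2" and ?s = "sphere_integrand q \<psi>1 \<psi>2"
  have p: "integrable lborel ?p" using c by (simp add: plane_converges_def)
  then have pm [measurable]: "?p \<in> borel_measurable borel" by auto
  define G where "G x = (4 :: complex) * (sph.jac x *\<^sub>R ?p (sph.chart x))" for x
  have iG: "integrable lborel G" unfolding G_def
    by (intro integrable_mult_right sph.integrable_chart[THEN iffD1] pm p)
  then have Gm [measurable]: "G \<in> borel_measurable borel" by auto
  define F where "F x = indicat_real ({0..pi} \<times> {0..2*pi}) x *\<^sub>R (of_real (sin (fst x)) * ?s (fst x) (snd x))" for x
  \<comment> \<open>The closed rectangle contains the null edge at angle \<open>2 * pi\<close>,
    which the half-open chart omits. Its values are those at angle 0; keeping them explicit makes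
    \<open>F\<close> measurable because \<open>G\<close> is.\<close>
  have FG: "F x = G x + indicat_real ({0<..<pi} \<times> {2*pi}) x *\<^sub>R G (fst x, 0)" for x
  proof (cases "fst x \<in> {0<..<pi}")
    case True
    then consider "0 \<le> snd x \<and> snd x < 2 * pi" | "snd x = 2 * pi" | "snd x < 0 \<or> snd x > 2 * pi" by linarith
    then show ?thesis
    proof cases
      case 1 then show ?thesis using True sphere_integrand_eq[OF q True, of "snd x" \<psi>1 \<psi>2]
        by (auto simp: F_def G_def indicator_def mem_Times_iff)
    next
      case 2
      have "?s (fst x) (2 * pi) = ?s (fst x) 0" by (simp add: sphere_integrand_def on_sphere_def)
      then show ?thesis using True 2 sphere_integrand_eq[OF q True, of 0 \<psi>1 \<psi>2]
        by (cases x) (auto simp: F_def G_def sph.jac_def indicator_def mem_Times_iff)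
    next
      case 3 then show ?thesis by (auto simp: F_def G_def sph.jac_def indicator_def mem_Times_iff)
    qed
  next
    case False
    then have "sin (fst x) = 0 \<or> fst x \<notin> {0..pi}" by (cases "fst x = 0"; cases "fst x = pi") auto
    with False show ?thesis by (auto simp: F_def G_def sph.jac_def indicator_def mem_Times_iff)
  qed
  have "(\<lambda>x. (fst x, 0)) \<in> borel_measurable (borel :: (real\<times>real) measure)"
    by (intro borel_measurable_continuous_onI continuous_intros)
  then have [measurable]: "(\<lambda>x::real\<times>real. G (fst x, 0::real)) \<in> borel_measurable borel"
    by (rule measurable_compose) measurable
  have [measurable]: "{0<..<pi} \<times> {2*pi} \<in> sets (borel :: (real\<times>real) measure)"
    by (auto simp: borel_prod[symmetric])
  have "emeasure (lborel :: (real \<times> real) measure) ({0<..<pi} \<times> {2*pi}) = 0"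
    unfolding lborel_prod[symmetric] by (subst lborel.emeasure_pair_measure_Times) auto
  then have ae: "AE x in (lborel :: (real \<times> real) measure). x \<notin> {0<..<pi} \<times> {2*pi}"
    by (intro AE_not_in) (auto simp: null_sets_def)
  have Fm: "F \<in> borel_measurable borel" unfolding FG[abs_def] by measurable
  have "AE x in lborel. F x = G x" using ae by eventually_elim (simp add: FG)
  then have iF: "integrable lborel F" using iG Fm Gm by (subst integrable_cong_AE[where g=G]) auto
  then show "sphere_converges q \<psi>1 \<psi>2"
    by (simp add: sphere_converges_def set_integrable_def F_def[abs_def] case_prod_beta')
  have inner: "indicat_real {0..pi} \<theta> *\<^sub>R (of_real (sin \<theta>) * (LINT \<phi>:{0..2 * pi}|lborel. ?s \<theta> \<phi>))
    = 4 * (LINT \<phi>|lborel. sph.jac (\<theta>, \<phi>) *\<^sub>R ?p (sph.chart (\<theta>, \<phi>)))" for \<theta>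
  proof -
    have tm [measurable]: "(\<lambda>\<phi>. (\<theta>, \<phi>)) \<in> borel_measurable (borel :: real measure)"
      by (intro borel_measurable_continuous_onI continuous_intros)
    have "indicat_real {0..pi} \<theta> *\<^sub>R (of_real (sin \<theta>) * (LINT \<phi>:{0..2 * pi}|lborel. ?s \<theta> \<phi>)) = (LINT \<phi>|lborel. F (\<theta>, \<phi>))"
      by (auto simp: set_lebesgue_integral_def F_def indicator_def mem_Times_iff
          simp flip: integral_mult_right_zero integral_scaleR_right intro!: Bochner_Integration.integral_cong)
    also have "\<dots> = (LINT \<phi>|lborel. G (\<theta>, \<phi>))"
    proof (rule integral_cong_AE)
      show "(\<lambda>\<phi>. F (\<theta>, \<phi>)) \<in> borel_measurable lborel" using measurable_compose[OF tm Fm] by simp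
      show "(\<lambda>\<phi>. G (\<theta>, \<phi>)) \<in> borel_measurable lborel" using measurable_compose[OF tm Gm] by simp
      have "AE \<phi> in lborel. \<phi> \<noteq> 2 * pi" by (rule AE_lborel_singleton)
      then show "AE \<phi> in lborel. F (\<theta>, \<phi>) = G (\<theta>, \<phi>)" by eventually_elim (simp add: FG)
    qed
    finally show ?thesis unfolding G_def integral_mult_right_zero .
  qed
  have "scalar_sphere q \<psi>1 \<psi>2 = of_real (log_factor q / 4) *
     (LINT \<theta>|lborel. 4 * (LINT \<phi>|lborel. sph.jac (\<theta>, \<phi>) *\<^sub>R ?p (sph.chart (\<theta>, \<phi>))))"
    unfolding scalar_sphere_def by (subst set_lebesgue_integral_def) (simp only: inner)
  also have "\<dots> = scalar_plane q \<psi>1 \<psi>2"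
    unfolding scalar_plane_def sph.integral_chart_fst[OF p] by simp
  finally show "scalar_sphere q \<psi>1 \<psi>2 = scalar_plane q \<psi>1 \<psi>2" .
qed

subsection \<open>Analytic continuation in the phase\<close>

text \<open>The unit circle accumulates at 1 and the punctured plane is connected, so the identity
  theorem applies. At 0 a continuation is unconstrained.\<close>

lemma phase_extension_unique:
  assumes g: "phase_extension f \<rho> g" and h: "phase_extension f \<rho> h" and u: "u \<noteq> 0"
  shows "g u = h u"
proof -
  have s1: "connected (sphere (0::complex) 1)" by (rule connected_sphere) simp
  have s2: "sphere (0::complex) 1 \<noteq> {x}" for x
  proof
    assume "sphere (0::complex) 1 = {x}"
    moreover have "(1 :: complex) \<in> sphere 0 1" "(- 1 :: complex) \<in> sphere 0 1" by simp_all
    ultimately have "(1 :: complex) = x" "(- 1 :: complex) = x" by blast+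
    then show False by simp
  qed
  have isl: "(1::complex) islimpt sphere 0 1"
    by (rule connected_imp_perfect[OF s1 _ s2]) simp
  have hol: "(\<lambda>u. g u - h u) holomorphic_on - {0}"
    using g h unfolding phase_extension_def by (intro holomorphic_intros) blast+
  have "g u - h u = 0"
  proof (rule analytic_continuation[OF hol, of "sphere 0 1" 1])
    show "connected (- {0::complex})" by (rule connected_punctured_universe) simp
    show "sphere (0::complex) 1 \<subseteq> - {0}" by auto
    show "g v - h v = 0" if "v \<in> sphere 0 1" for v
      using g h that by (simp add: phase_extension_def)
  qed (use isl u in \<open>simp_all add: open_Compl\<close>)
  then show ?thesis by simp
qed

lemma phase_extension_phase_ext: "phase_extension f \<rho> g \<Longrightarrow> phase_extension f \<rho> (phase_ext f \<rho>)"
  unfolding phase_ext_def by (rule someI[of "phase_extension f \<rho>"])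

lemma phase_ext_eqI: "phase_extension f \<rho> g \<Longrightarrow> u \<noteq> 0 \<Longrightarrow> phase_ext f \<rho> u = g u"
  using phase_extension_phase_ext phase_extension_unique by metis

lemma qpowI:
  assumes "phase_extension f (q powr ((a + b) / 2) * norm z) g" "q > 0" "q \<noteq> 1" "z \<noteq> 0"
  shows "qpow q a b f z = g (of_real (q powr ((a - b) / 2)) * sgn z)"
  using assms by (auto simp: qpow_def sgn_zero_iff intro!: phase_ext_eqI)

lemma admissible_phase_extension:
  assumes "admissible f" "\<rho> > 0" shows "phase_extension f \<rho> (phase_ext f \<rho>)"
  using assms phase_extension_phase_ext unfolding admissible_def by blast

lemma phase_ext_holomorphic: "admissible f \<Longrightarrow> \<rho> > 0 \<Longrightarrow> phase_ext f \<rho> holomorphic_on (- {0})"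
  using admissible_phase_extension unfolding phase_extension_def by blast

lemma phase_ext_unit: "admissible f \<Longrightarrow> \<rho> > 0 \<Longrightarrow> norm u = 1 \<Longrightarrow> phase_ext f \<rho> u = f (of_real \<rho> * u)"
  using admissible_phase_extension unfolding phase_extension_def by blast

lemma phase_ext_sgn: "admissible f \<Longrightarrow> p > 0 \<Longrightarrow> z \<noteq> 0 \<Longrightarrow> phase_ext f (p * norm z) (sgn z) = f (of_real p * z)"
  by (subst phase_ext_unit) (auto simp: sgn_eq norm_divide)

lemma admissible_continuous: "admissible f \<Longrightarrow> continuous_on (- {0}) f"
  unfolding admissible_def
  by (auto intro!: differentiable_imp_continuous_on differentiable_at_imp_differentiable_on)

text \<open>The bound in \<open>admissible\<close> may depend on the circle. The maximum modulus
  principle spreads the bounds on two circles over the annulus between them and preserves uniformity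
  in the radius \<open>\<rho>\<close>; local boundedness of the family is what Montel's theorem asks
  for.\<close>

lemma phase_ext_annulus_bound:
  assumes f: "admissible f" and r: "0 < r"
  obtains B where "\<And>\<rho> u. \<rho> > 0 \<Longrightarrow> r \<le> norm u \<Longrightarrow> norm u \<le> R \<Longrightarrow> norm (phase_ext f \<rho> u) \<le> B"
proof -
  \<comment> \<open>The two auxiliary circles lie strictly inside and outside the given annulus, so
    that its points are in the open set \<open>S\<close>. The absolute value keeps \<open>R0\<close>
    positive for every \<open>R\<close>.\<close>
  define r0 R0 where "r0 = r / 2" and "R0 = \<bar>R\<bar> + r"
  have rR: "0 < r0" "r0 < r" "R < R0" "0 < R0" using r by (auto simp: r0_def R0_def)
  have ex: "\<exists>B. \<forall>\<rho>>0. \<forall>u. norm u = s \<longrightarrow> norm (phase_ext f \<rho> u) \<le> B" if "s > 0" for s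
    using f that unfolding admissible_def by blast
  obtain B1 where B1: "\<And>\<rho> u. \<rho> > 0 \<Longrightarrow> norm u = r0 \<Longrightarrow> norm (phase_ext f \<rho> u) \<le> B1"
    using ex[of r0] rR by blast
  obtain B2 where B2: "\<And>\<rho> u. \<rho> > 0 \<Longrightarrow> norm u = R0 \<Longrightarrow> norm (phase_ext f \<rho> u) \<le> B2"
    using ex[of R0] rR by blast
  define S where "S = ball (0::complex) R0 - cball 0 r0"
  have "open S" by (auto simp: S_def)
  have clS: "closure S \<subseteq> cball 0 R0 - ball 0 r0"
    by (rule closure_minimal) (auto simp: S_def)
  then have frS: "frontier S \<subseteq> {u. norm u = r0 \<or> norm u = R0}"
    using \<open>open S\<close> by (auto simp: frontier_def interior_open S_def)
  have "norm (phase_ext f \<rho> u) \<le> max B1 B2" if "\<rho> > 0" "r \<le> norm u" "norm u \<le> R" for \<rho> u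
  proof (rule maximum_modulus_frontier[where f = "phase_ext f \<rho>" and S = S])
    have h: "phase_ext f \<rho> holomorphic_on - {0}" using phase_ext_holomorphic[OF f] that by blast
    have cl: "closure S \<subseteq> - {0}" using clS rR by auto
    then have "interior S \<subseteq> - {0}" using interior_subset closure_subset by (meson subset_trans)
    then show "phase_ext f \<rho> holomorphic_on interior S" by (rule holomorphic_on_subset[OF h])
    show "continuous_on (closure S) (phase_ext f \<rho>)"
      by (rule continuous_on_subset[OF holomorphic_on_imp_continuous_on[OF h] cl])
    show "bounded S" unfolding S_def by (intro bounded_diff bounded_ball)
    show "u \<in> S" using that rR by (auto simp: S_def)
    fix z assume "z \<in> frontier S"
    then show "norm (phase_ext f \<rho> z) \<le> max B1 B2"
      using frS B1[OF that(1), of z] B2[OF that(1), of z] by (auto simp: le_max_iff_disj)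
  qed
  then show ?thesis by (rule that)
qed

text \<open>Montel's theorem gives a limit of the continuations along a subsequence; on the unit circle it is
  \<open>f\<close>, so by uniqueness it is the continuation at the limit radius.\<close>

lemma phase_ext_tendsto:
  assumes f: "admissible f" and \<rho>n: "\<And>n. \<rho>n n > 0" and \<rho>: "\<rho> > 0" and un: "\<And>n. un n \<noteq> 0" and u: "u \<noteq> 0"
    and lr: "\<rho>n \<longlonglongrightarrow> \<rho>" and lu: "un \<longlonglongrightarrow> u"
  obtains s :: "nat \<Rightarrow> nat" where "strict_mono s" "(\<lambda>n. phase_ext f (\<rho>n (s n)) (un (s n))) \<longlonglongrightarrow> phase_ext f \<rho> u"
proof -
  define \<H> where "\<H> = phase_ext f ` {0<..}"
  have "\<exists>g r. g holomorphic_on (- {0}) \<and> strict_mono (r :: nat \<Rightarrow> nat) \<and>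
     (\<forall>x. x \<in> - {0} \<longrightarrow> ((\<lambda>n. phase_ext f (\<rho>n (r n)) x) \<longlonglongrightarrow> g x)) \<and>
     (\<forall>K. compact K \<longrightarrow> K \<subseteq> - {0} \<longrightarrow> uniform_limit K ((\<lambda>n. phase_ext f (\<rho>n n)) \<circ> r) g sequentially)"
  proof (rule Montel[of "- {0}" \<H> "\<lambda>n. phase_ext f (\<rho>n n)"])
    show "h holomorphic_on - {0}" if "h \<in> \<H>" for h
      using that phase_ext_holomorphic[OF f] by (auto simp: \<H>_def)
    show "range (\<lambda>n. phase_ext f (\<rho>n n)) \<subseteq> \<H>" using \<rho>n by (auto simp: \<H>_def)
    show "\<exists>B. \<forall>h\<in>\<H>. \<forall>z\<in>K. norm (h z) \<le> B" if K: "compact K" "K \<subseteq> - {0}" for K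
    proof -
      obtain r where r: "r > 0" "\<And>z. z \<in> K \<Longrightarrow> r \<le> norm z"
        using separate_point_closed[of K 0] K by (auto simp: compact_imp_closed)
      obtain R where R: "\<And>z. z \<in> K \<Longrightarrow> norm z \<le> R"
        using compact_imp_bounded[OF K(1)] by (auto simp: bounded_iff)
      obtain B where "\<And>\<rho> u. \<rho> > 0 \<Longrightarrow> r \<le> norm u \<Longrightarrow> norm u \<le> R \<Longrightarrow> norm (phase_ext f \<rho> u) \<le> B"
        using phase_ext_annulus_bound[OF f r(1)] by blast
      then show ?thesis using r R by (auto simp: \<H>_def intro!: exI[of _ B])
    qed
  next
    fix g and r :: "nat \<Rightarrow> nat"
    assume "g holomorphic_on - {0}" "strict_mono r"
      "\<And>x. x \<in> - {0} \<Longrightarrow> (\<lambda>n. phase_ext f (\<rho>n (r n)) x) \<longlonglongrightarrow> g x"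
      "\<And>K. compact K \<Longrightarrow> K \<subseteq> - {0} \<Longrightarrow> uniform_limit K ((\<lambda>n. phase_ext f (\<rho>n n)) \<circ> r) g sequentially"
    then show "\<exists>g r. g holomorphic_on (- {0}) \<and> strict_mono (r :: nat \<Rightarrow> nat) \<and>
     (\<forall>x. x \<in> - {0} \<longrightarrow> ((\<lambda>n. phase_ext f (\<rho>n (r n)) x) \<longlonglongrightarrow> g x)) \<and>
     (\<forall>K. compact K \<longrightarrow> K \<subseteq> - {0} \<longrightarrow> uniform_limit K ((\<lambda>n. phase_ext f (\<rho>n n)) \<circ> r) g sequentially)"
      by (intro exI[of _ g] exI[of _ r]) auto
  qed (simp add: open_Compl)
  then obtain g s where g: "g holomorphic_on (- {0})" and s: "strict_mono (s :: nat \<Rightarrow> nat)"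
    and lim: "\<And>x. x \<noteq> 0 \<Longrightarrow> (\<lambda>n. phase_ext f (\<rho>n (s n)) x) \<longlonglongrightarrow> g x"
    and ul: "\<And>K. compact K \<Longrightarrow> K \<subseteq> - {0} \<Longrightarrow> uniform_limit K ((\<lambda>n. phase_ext f (\<rho>n n)) \<circ> s) g sequentially"
    by auto
  have lrs: "(\<lambda>n. \<rho>n (s n)) \<longlonglongrightarrow> \<rho>" and lus: "(\<lambda>n. un (s n)) \<longlonglongrightarrow> u"
    using LIMSEQ_subseq_LIMSEQ[OF lr s] LIMSEQ_subseq_LIMSEQ[OF lu s] by (auto simp: o_def)
  have "g w = f (of_real \<rho> * w)" if w: "norm w = 1" for w
  proof (rule LIMSEQ_unique)
    have w0: "w \<noteq> 0" using w by auto
    show "(\<lambda>n. phase_ext f (\<rho>n (s n)) w) \<longlonglongrightarrow> g w" by (rule lim[OF w0])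
    have "isCont f (of_real \<rho> * w)"
      using admissible_continuous[OF f] w0 \<rho> by (auto simp: continuous_on_eq_continuous_at open_Compl)
    then have "(\<lambda>n. f (of_real (\<rho>n (s n)) * w)) \<longlonglongrightarrow> f (of_real \<rho> * w)"
      by (rule isCont_tendsto_compose) (intro tendsto_intros lrs)
    then show "(\<lambda>n. phase_ext f (\<rho>n (s n)) w) \<longlonglongrightarrow> f (of_real \<rho> * w)"
      using phase_ext_unit[OF f \<rho>n w] by simp
  qed
  then have "phase_extension f \<rho> g" using g by (simp add: phase_extension_def)
  then have gu: "phase_ext f \<rho> u = g u" using phase_ext_eqI u by blast
  \<comment> \<open>The points of evaluation move with \<open>n\<close>, so pointwise convergence
    does not suffice: on a compact neighbourhood of \<open>u\<close> the limit is uniform, and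
    continuity of \<open>g\<close> does the rest.\<close>
  define K where "K = cball u (norm u / 2)"
  have K: "compact K" "K \<subseteq> - {0}" using u by (auto simp: K_def dist_norm)
  have ev: "\<forall>\<^sub>F n in sequentially. un (s n) \<in> K"
    using tendstoD[OF lus, of "norm u / 2"] u
    by (auto simp: K_def dist_commute less_imp_le elim!: eventually_mono)
  have "(\<lambda>n. phase_ext f (\<rho>n (s n)) (un (s n)) - g (un (s n))) \<longlonglongrightarrow> 0"
  proof (rule tendstoI)
    fix e :: real assume "e > 0"
    from uniform_limitD[OF ul[OF K] this] ev
    show "\<forall>\<^sub>F n in sequentially. dist (phase_ext f (\<rho>n (s n)) (un (s n)) - g (un (s n))) 0 < e"
      by eventually_elim (simp add: dist_norm)
  qed
  moreover have "(\<lambda>n. g (un (s n))) \<longlonglongrightarrow> g u"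
    using holomorphic_on_imp_continuous_on[OF g] u lus un
    by (auto simp: continuous_on_sequentially o_def)
  ultimately have "(\<lambda>n. phase_ext f (\<rho>n (s n)) (un (s n))) \<longlonglongrightarrow> g u"
    by (auto dest: tendsto_add)
  then show ?thesis using that[OF s] gu by simp
qed

text \<open>The previous lemma gives convergence along some subsequence only. If continuity failed,
  it could be applied to a subsequence whose values stay at distance \<open>e\<close> from the
  expected limit, a contradiction.\<close>

lemma phase_ext_continuous:
  assumes f: "admissible f"
  shows "continuous_on ({0<..} \<times> - {0}) (\<lambda>(\<rho>, u). phase_ext f \<rho> u)"
  unfolding continuous_on_sequentially
proof (intro allI ballI impI, elim conjE)
  fix x :: "nat \<Rightarrow> real \<times> complex" and a assume a: "a \<in> {0<..} \<times> - {0::complex}" and x: "\<forall>n. x n \<in> {0<..} \<times> - {0::complex}"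
    and lim: "x \<longlonglongrightarrow> a"
  let ?F = "\<lambda>(\<rho>, u). phase_ext f \<rho> u"
  show "(?F \<circ> x) \<longlonglongrightarrow> ?F a"
  proof (rule ccontr)
    assume "\<not> (?F \<circ> x) \<longlonglongrightarrow> ?F a"
    then obtain e where e: "e > 0" "\<not> (\<forall>\<^sub>F n in sequentially. dist ((?F \<circ> x) n) (?F a) < e)"
      by (auto simp: tendsto_iff)
    then have "\<exists>\<^sub>F n in sequentially. e \<le> dist ((?F \<circ> x) n) (?F a)"
      by (auto simp: frequently_def not_le)
    then obtain r :: "nat \<Rightarrow> nat" where r: "strict_mono r" "\<And>n. e \<le> dist ((?F \<circ> x) (r n)) (?F a)"
      using infinite_enumerate[of "{n. e \<le> dist ((?F \<circ> x) n) (?F a)}"]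
      by (auto simp: frequently_cofinite cofinite_eq_sequentially[symmetric])
    have lim': "(\<lambda>n. x (r n)) \<longlonglongrightarrow> a" using LIMSEQ_subseq_LIMSEQ[OF lim r(1)] by (simp add: o_def)
    obtain s :: "nat \<Rightarrow> nat" where "(\<lambda>n. phase_ext f (fst (x (r (s n)))) (snd (x (r (s n))))) \<longlonglongrightarrow> phase_ext f (fst a) (snd a)"
      using phase_ext_tendsto[OF f, of "\<lambda>n. fst (x (r n))" "fst a" "\<lambda>n. snd (x (r n))" "snd a"]
        x a tendsto_fst[OF lim'] tendsto_snd[OF lim'] by (fastforce simp: mem_Times_iff)
    from tendstoD[OF this e(1)] obtain n where "dist (phase_ext f (fst (x (r (s n)))) (snd (x (r (s n))))) (phase_ext f (fst a) (snd a)) < e"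
      by (auto simp: eventually_sequentially)
    with r(2)[of "s n"] show False by (simp add: case_prod_beta')
  qed
qed

lemma sgn_of_real_mult: "\<rho> > 0 \<Longrightarrow> norm u = 1 \<Longrightarrow> sgn (of_real \<rho> * u :: complex) = u"
  by (simp add: sgn_eq norm_mult)

context
  fixes p :: real and f :: "complex \<Rightarrow> complex"
  assumes p: "p > 0" "p \<noteq> 1" and f: "admissible f"
begin

lemma powr_half: "p powr (1 / 2) * p powr (1 / 2) = p" "p powr - (1 / 2) * p powr (1 / 2) = 1"
  "p powr (1 / 2) * p powr - (1 / 2) = 1" "p powr - (1 / 2) * p powr - (1 / 2) = inverse p"
proof -
  show h: "p powr (1 / 2) * p powr (1 / 2) = p" using p by (simp flip: powr_add)
  show "p powr - (1 / 2) * p powr (1 / 2) = 1" "p powr (1 / 2) * p powr - (1 / 2) = 1"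
    using p by (simp_all flip: powr_add)
  show "p powr - (1 / 2) * p powr - (1 / 2) = inverse p"
    by (simp only: powr_minus inverse_mult_distrib[symmetric] h)
qed

lemma phase_ext_scaled:
  assumes "\<rho> > 0" "c > 0" "a > 0"
  shows "phase_extension (\<lambda>w. phase_ext f (a * norm w) (of_real c * sgn w)) \<rho>
    (\<lambda>u. phase_ext f (a * \<rho>) (of_real c * u))"
proof -
  have "(phase_ext f (a * \<rho>) \<circ> (\<lambda>u. of_real c * u)) holomorphic_on - {0}"
    by (rule holomorphic_on_compose_gen[of _ _ _ "- {0}"])
      (use assms in \<open>auto intro!: holomorphic_intros phase_ext_holomorphic[OF f]\<close>)
  then show ?thesis using assms
    by (auto simp: phase_extension_def sgn_of_real_mult norm_mult o_def)
qed

lemma qpow_0_1: "qpow p 0 1 f w = phase_ext f (p powr (1 / 2) * norm w) (of_real (p powr - (1 / 2)) * sgn w)"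
  "qpow p 0 (- 1) f w = phase_ext f (p powr - (1 / 2) * norm w) (of_real (p powr (1 / 2)) * sgn w)"
  using p by (simp_all add: qpow_def)

lemma qnum_T_qpow:
  assumes z: "z \<noteq> 0"
  shows "qnum_T p c (\<lambda>w. of_real k * qpow p 0 1 f w) z =
    of_real k * (of_real (p powr c) * f (of_real p * z)
      - of_real (p powr (- c)) * phase_ext f (norm z) (of_real (inverse p) * sgn z)) / of_real (p - inverse p)"
proof -
  have ext: "phase_extension (\<lambda>w. of_real k * qpow p 0 1 f w) \<rho>
    (\<lambda>u. of_real k * phase_ext f (p powr (1 / 2) * \<rho>) (of_real (p powr - (1 / 2)) * u))" if "\<rho> > 0" for \<rho>
    using phase_ext_scaled[OF that, of "p powr - (1 / 2)" "p powr (1/2)"] p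
    by (auto simp: phase_extension_def qpow_0_1 intro!: holomorphic_intros)
  have 1: "qpow p 1 0 (\<lambda>w. of_real k * qpow p 0 1 f w) z = of_real k * f (of_real p * z)"
    by (subst qpowI[OF ext]) (use p z in \<open>auto simp flip: mult.assoc of_real_mult simp: powr_half phase_ext_sgn[OF f]\<close>)
  have 2: "qpow p (- 1) 0 (\<lambda>w. of_real k * qpow p 0 1 f w) z = of_real k * phase_ext f (norm z) (of_real (inverse p) * sgn z)"
    by (subst qpowI[OF ext]) (use p z in \<open>auto simp flip: mult.assoc of_real_mult simp: powr_half\<close>)
  show ?thesis using p by (simp add: qnum_T_def 1 2 algebra_simps)
qed

text \<open>The hypothesis on \<open>k\<close> says that the multiplier \<open>h\<close> is fixed by
  q to the power T. It is used for \<open>cnj\<close> and its reciprocal, which depend on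
  \<open>cnj z\<close> alone and are annihilated by T; such a factor passes through the
  operator.\<close>

lemma qpow_qnum_Tbar:
  assumes z: "z \<noteq> 0" and h: "\<And>\<rho>. \<rho> > 0 \<Longrightarrow> phase_extension h \<rho> (k \<rho>)"
    and kh: "k (p powr (1 / 2) * norm z) (of_real (p powr (1 / 2)) * sgn z) = h z"
  shows "qpow p 1 0 (\<lambda>w. h w * qnum_Tbar p c f w) z =
    h z * (of_real (p powr c) * f (of_real p * z)
      - of_real (p powr (- c)) * phase_ext f (norm z) (of_real p * sgn z)) / of_real (p - inverse p)"
proof -
  have ext: "phase_extension (\<lambda>w. h w * qnum_Tbar p c f w) \<rho>
    (\<lambda>u. k \<rho> u * (of_real (p powr c) * phase_ext f (p powr (1 / 2) * \<rho>) (of_real (p powr - (1 / 2)) * u)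
       - of_real (p powr (- c)) * phase_ext f (p powr - (1 / 2) * \<rho>) (of_real (p powr (1 / 2)) * u)) / of_real (p - inverse p))" if "\<rho> > 0" for \<rho>
    using phase_ext_scaled[OF that, of "p powr - (1 / 2)" "p powr (1/2)"] phase_ext_scaled[OF that, of "p powr (1/2)" "p powr - (1 / 2)"] p h[OF that]
    by (auto simp: phase_extension_def qnum_Tbar_def qpow_0_1 intro!: holomorphic_intros)
  show ?thesis
    by (subst qpowI[OF ext]) (use p z kh in \<open>auto simp flip: mult.assoc of_real_mult simp: powr_half phase_ext_sgn[OF f]\<close>)
qed

end

text \<open>On the unit circle conjugation agrees with inversion, which is holomorphic off 0. This
  provides the continuations in the phase of \<open>cnj\<close> and of its reciprocal.\<close>

lemma inverse_unit_complex: "norm u = 1 \<Longrightarrow> inverse u = cnj u" for u :: complex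
  using complex_norm_square[of u] by (intro inverse_unique) simp

lemma sgn_polar:
  assumes "z \<noteq> 0"
  shows "of_real (norm z) * sgn z = z" "of_real (norm z) * inverse (sgn z) = cnj z"
proof -
  show s: "of_real (norm z) * sgn z = z" using assms by (simp add: sgn_eq)
  have "inverse (sgn z) = cnj (sgn z)" using assms by (intro inverse_unit_complex) (simp add: norm_sgn)
  then have "of_real (norm z) * inverse (sgn z) = cnj (of_real (norm z) * sgn z)" by simp
  then show "of_real (norm z) * inverse (sgn z) = cnj z" by (simp only: s)
qed

lemma mult_inverse_cancel: "s \<noteq> 0 \<Longrightarrow> (s * n) * inverse (s * g) = n * inverse g" for s n g :: complex
  unfolding divide_inverse[symmetric] by (rule mult_divide_mult_cancel_left)

text \<open>Composing the dilations turns \<open>q powr T\<close> \<open>q powr Tbar\<close> into an honest dilation, while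
  \<open>q powr (- T)\<close> \<open>q powr Tbar\<close> and its inverse only move the phase; hence each operator has three terms.\<close>

lemma Hplus_eq:
  fixes \<psi> :: wavefun
  assumes p: "p > 0" "p \<noteq> 1" and f: "admissible (\<psi> p)" and z: "z \<noteq> 0"
  shows "Hplus N \<psi> p z = - inverse z *
    (of_real (p powr (- N / 2) * (1 + (norm z)\<^sup>2)) * \<psi> p (of_real p * z)
     - of_real (p powr (- N / 2)) * phase_ext (\<psi> p) (norm z) (of_real (inverse p) * sgn z)
     - of_real (p powr (3 * N / 2) * (norm z)\<^sup>2) * phase_ext (\<psi> p) (norm z) (of_real p * sgn z)) / of_real (p - inverse p)"
proof -
  have 1: "qpow p 1 0 (\<lambda>w. cnj w * qnum_Tbar p (- N) (\<psi> p) w) z =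
    cnj z * (of_real (p powr (- N)) * \<psi> p (of_real p * z)
      - of_real (p powr (- (- N))) * phase_ext (\<psi> p) (norm z) (of_real p * sgn z)) / of_real (p - inverse p)"
  proof (rule qpow_qnum_Tbar[OF p f z, where k = "\<lambda>\<rho> u. of_real \<rho> * inverse u"])
    show "phase_extension cnj \<rho> (\<lambda>u. of_real \<rho> * inverse u)" if "\<rho> > 0" for \<rho>
      by (auto simp: phase_extension_def inverse_unit_complex intro!: holomorphic_intros)
    show "of_real (p powr (1 / 2) * norm z) * inverse (of_real (p powr (1 / 2)) * sgn z) = cnj z"
      unfolding of_real_mult by (subst mult_inverse_cancel) (use p sgn_polar(2)[OF z] in auto)
  qed
  have c: "cnj z = of_real ((norm z)\<^sup>2) * inverse z" using z complex_norm_square[of z] by (simp add: field_simps)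
  \<comment> \<open>Once \<open>cnj z\<close> is written through \<open>inverse z\<close>, both
    parts of the operator share that prefactor. Their dilation terms then carry the same power of
    \<open>p\<close> and add up to the factor \<open>1 + (norm z)^2\<close>, which later cancels one
    factor of the weight.\<close>
  have e: "p powr (N / 2) * p powr (- N) = p powr (- N / 2)" "p powr (N / 2) * p powr N = p powr (3 * N / 2)"
    by (simp_all flip: powr_add add: field_simps)
  have alg: "- i * (m * kN * (1 * a - 1 * b) / d) - m * (R * i * (kN * a - kP * c) / d)
    = - i * (m * kN * (1 + R) * a - m * kN * b - m * kP * R * c) / d" for i m kN a b c d R kP :: complex
    by (simp add: divide_inverse) algebra
  have p0: "p powr 0 = 1" using p by simp
  show ?thesis
    unfolding Hplus_def 1 qnum_T_qpow[OF p f z] unfolding c e[symmetric] minus_zero minus_minus p0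
      of_real_mult of_real_add of_real_1 by (rule alg)
qed

lemma Hminus_eq:
  fixes \<psi> :: wavefun
  assumes p: "p > 0" "p \<noteq> 1" and f: "admissible (\<psi> p)" and z: "z \<noteq> 0"
  shows "Hminus N \<psi> p z = inverse (cnj z) *
    (of_real (p powr (N / 2) * (1 + (norm z)\<^sup>2)) * \<psi> p (of_real p * z)
     - of_real (p powr (- 3 * N / 2) * (norm z)\<^sup>2) * phase_ext (\<psi> p) (norm z) (of_real (inverse p) * sgn z)
     - of_real (p powr (N / 2)) * phase_ext (\<psi> p) (norm z) (of_real p * sgn z)) / of_real (p - inverse p)"
proof -
  have 1: "qpow p 1 0 (\<lambda>w. inverse (cnj w) * qnum_Tbar p 0 (\<psi> p) w) z =
    inverse (cnj z) * (of_real (p powr 0) * \<psi> p (of_real p * z)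
      - of_real (p powr (- 0)) * phase_ext (\<psi> p) (norm z) (of_real p * sgn z)) / of_real (p - inverse p)"
  proof (rule qpow_qnum_Tbar[OF p f z, where k = "\<lambda>\<rho> u. inverse (of_real \<rho>) * u"])
    show "phase_extension (\<lambda>w. inverse (cnj w)) \<rho> (\<lambda>u. inverse (of_real \<rho>) * u)" if "\<rho> > 0" for \<rho>
      by (auto simp: phase_extension_def inverse_unit_complex intro!: holomorphic_intros)
    show "inverse (of_real (p powr (1 / 2) * norm z)) * (of_real (p powr (1 / 2)) * sgn z) = inverse (cnj z)"
      unfolding of_real_mult
      by (subst mult.commute, subst mult_inverse_cancel)
        (use p arg_cong[OF sgn_polar(2)[OF z], of inverse] in \<open>auto simp: mult.commute\<close>)
  qed
  have c: "z = of_real ((norm z)\<^sup>2) * inverse (cnj z)" using z complex_norm_square[of z] by (simp add: field_simps)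
  have e: "p powr (- N / 2) * p powr N = p powr (N / 2)" "p powr (- N / 2) * p powr (- N) = p powr (- 3 * N / 2)"
    by (simp_all flip: powr_add add: field_simps)
  have zY: "z * Y = of_real ((norm z)\<^sup>2) * inverse (cnj z) * Y" for Y
    using arg_cong[OF c, of "\<lambda>t. t * Y"] .
  have alg: "R * i * (k * (kN * a - kM * b) / d) + k * kN * (i * (1 * a - 1 * c) / d)
    = i * (k * kN * (1 + R) * a - k * kM * R * b - k * kN * c) / d" for i k kN a b c d R kM :: complex
    by (simp add: divide_inverse) algebra
  have p0: "p powr 0 = 1" using p by simp
  show ?thesis
    unfolding Hminus_def 1 qnum_T_qpow[OF p f z] zY unfolding e[symmetric] minus_zero minus_minus p0
      of_real_mult of_real_add of_real_1 by (rule alg)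
qed

subsection \<open>Integration over the plane\<close>

lemma nn_integral_Cauchy_density:
  assumes a: "a > 0"
  shows "(\<integral>\<^sup>+x. ennreal (1 / (1 + a * x\<^sup>2)) * indicator {0..} x \<partial>lborel) < \<infinity>"
proof -
  have pos: "1 + a * x\<^sup>2 > 0" for x :: real using a by (simp add: add_pos_nonneg)
  have "(\<integral>\<^sup>+x. ennreal (1 / (1 + a * x\<^sup>2)) * indicator {0..} x \<partial>lborel) = ennreal (pi / 2 / sqrt a - arctan (sqrt a * 0) / sqrt a)"
  proof (rule nn_integral_FTC_atLeast)
    show "((\<lambda>x. arctan (sqrt a * x) / sqrt a) has_real_derivative 1 / (1 + a * x\<^sup>2)) (at x)" for x :: real
    proof -
      have "((\<lambda>x. arctan (sqrt a * x)) has_real_derivative inverse (1 + (sqrt a * x)\<^sup>2) * sqrt a) (at x)"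
        by (rule DERIV_chain2[OF DERIV_arctan]) (auto intro!: derivative_eq_intros)
      from DERIV_cdivide[OF this, of "sqrt a"]
      show ?thesis using a by (simp add: power_mult_distrib inverse_eq_divide)
    qed
    have "filterlim (\<lambda>x. sqrt a * x) at_top at_top"
      using a by (intro filterlim_tendsto_pos_mult_at_top[OF tendsto_const] filterlim_ident) auto
    then have "((\<lambda>x. arctan (sqrt a * x)) \<longlongrightarrow> pi / 2) at_top"
      by (rule filterlim_compose[OF tendsto_arctan_at_top])
    then show "((\<lambda>x. arctan (sqrt a * x) / sqrt a) \<longlongrightarrow> pi / 2 / sqrt a) at_top"
      using a by (intro tendsto_divide tendsto_const) auto
  qed (use pos in \<open>auto intro!: less_imp_le\<close>)
  then show ?thesis by simp
qed

lemma borel_measurable_punctured: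
  "continuous_on (- {0}) f \<Longrightarrow> f \<in> borel_measurable borel" for f :: "complex \<Rightarrow> 'a::topological_space"
  by (rule borel_measurable_continuous_countable_exceptions[of "{0}"]) auto

text \<open>The majorant behind the convergence claims: its singularity at 0 and decay at infinity
  are what the weight leaves of the growth produced by the ladder operators. The Jacobian removes
  \<open>norm z\<close> and leaves the Cauchy density.\<close>

lemma integrable_kernel:
  assumes a: "a > 0"
  shows "integrable lborel (\<lambda>z::complex. complex_of_real (1 / (norm z * (1 + a * (norm z)\<^sup>2))))"
proof -
  let ?K = "\<lambda>z::complex. complex_of_real (1 / (norm z * (1 + a * (norm z)\<^sup>2)))"
  have pos: "1 + a * x\<^sup>2 > 0" for x :: real using a by (simp add: add_pos_nonneg)
  have m [measurable]: "?K \<in> borel_measurable borel"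
    by (intro borel_measurable_punctured continuous_intros) (auto, metis pos less_irrefl)
  have eq: "norm (pol.jac (s, \<phi>) *\<^sub>R ?K (pol.chart (s, \<phi>))) = indicator {0<..} s * (1 / (1 + a * s\<^sup>2)) * indicator {0..<2*pi} \<phi>" for s \<phi>
    using pos[of s] by (auto simp: pol.jac_def pol.chart_def norm_mult norm_divide abs_mult indicator_def mem_Times_iff simp del: of_real_mult of_real_add of_real_divide)
  have "(\<lambda>x. pol.jac x *\<^sub>R ?K (pol.chart x)) \<in> borel_measurable borel" by measurable
  moreover have "(\<integral>\<^sup>+x. norm (pol.jac x *\<^sub>R ?K (pol.chart x)) \<partial>lborel) < \<infinity>"
  proof -
    have "(\<integral>\<^sup>+x. norm (pol.jac x *\<^sub>R ?K (pol.chart x)) \<partial>lborel)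
      = (\<integral>\<^sup>+s. \<integral>\<^sup>+\<phi>. norm (pol.jac (s, \<phi>) *\<^sub>R ?K (pol.chart (s, \<phi>))) \<partial>lborel \<partial>lborel)"
      unfolding lborel_prod[symmetric]
      by (rule lborel.nn_integral_fst[symmetric]) (unfold lborel_prod, measurable)
    also have "\<dots> = (\<integral>\<^sup>+s. \<integral>\<^sup>+\<phi>. ennreal (indicator {0<..} s * (1 / (1 + a * s\<^sup>2))) * indicator {0..<2*pi} \<phi> \<partial>lborel \<partial>lborel)"
      unfolding eq using pos by (intro nn_integral_cong) (auto simp: indicator_def)
    also have "\<dots> = (\<integral>\<^sup>+s. ennreal (indicator {0<..} s * (1 / (1 + a * s\<^sup>2))) * ennreal (2 * pi) \<partial>lborel)"
      by (simp add: nn_integral_cmult)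
    also have "\<dots> \<le> (\<integral>\<^sup>+s. ennreal (1 / (1 + a * s\<^sup>2)) * indicator {0..} s * ennreal (2 * pi) \<partial>lborel)"
      by (intro nn_integral_mono mult_right_mono) (auto simp: indicator_def)
    also have "\<dots> = (\<integral>\<^sup>+s. ennreal (1 / (1 + a * s\<^sup>2)) * indicator {0..} s \<partial>lborel) * ennreal (2 * pi)"
      by (rule nn_integral_multc) measurable
    also have "\<dots> < \<infinity>" using nn_integral_Cauchy_density[OF a] by (simp add: ennreal_mult_less_top)
    finally show ?thesis .
  qed
  ultimately have "integrable lborel (\<lambda>x. pol.jac x *\<^sub>R ?K (pol.chart x))"
    by (intro integrableI_bounded) auto
  then show ?thesis by (simp only: pol.integrable_chart[OF m])
qed

lemma integrable_punctured_bound: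
  fixes f :: "complex \<Rightarrow> complex"
  assumes c: "continuous_on (- {0}) f" and a: "a > 0"
    and b: "\<And>z. z \<noteq> 0 \<Longrightarrow> norm (f z) * (norm z * (1 + a * (norm z)\<^sup>2)) \<le> B"
  shows "integrable lborel f"
proof (rule Bochner_Integration.integrable_bound)
  show "integrable lborel (\<lambda>z::complex. of_real B * complex_of_real (1 / (norm z * (1 + a * (norm z)\<^sup>2))))"
    by (intro integrable_mult_right integrable_kernel a)
  show "f \<in> borel_measurable lborel" using borel_measurable_punctured[OF c] by simp
  have "AE z in lborel. (z::complex) \<noteq> 0" by (rule AE_lborel_singleton)
  then show "AE z in lborel. norm (f z) \<le> norm (of_real B * complex_of_real (1 / (norm z * (1 + a * (norm z)\<^sup>2))))"
  proof eventually_elim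
    case (elim z)
    have p: "norm z * (1 + a * (norm z)\<^sup>2) > 0" using elim a by (intro mult_pos_pos add_pos_nonneg) auto
    then have "norm (f z) \<le> B / (norm z * (1 + a * (norm z)\<^sup>2))"
      using b[OF elim] by (simp add: pos_le_divide_eq)
    also have "\<dots> = B * (1 / (norm z * (1 + a * (norm z)\<^sup>2)))" by simp
    also have "\<dots> \<le> \<bar>B\<bar> * \<bar>1 / (norm z * (1 + a * (norm z)\<^sup>2))\<bar>"
      by (metis abs_ge_self abs_mult)
    also have "\<dots> = norm (of_real B * complex_of_real (1 / (norm z * (1 + a * (norm z)\<^sup>2))))"
      by (simp only: norm_mult norm_of_real)
    finally show ?case .
  qed
qed

lemma continuous_on_circle:
  assumes "continuous_on (- {0}) f" "s > 0"
  shows "continuous_on A (\<lambda>\<phi>. f (of_real s * cis \<phi>))"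
  by (rule continuous_on_compose2[OF assms(1)]) (use assms(2) in \<open>auto intro!: continuous_intros\<close>)

lemma pol_inner:
  fixes f :: "complex \<Rightarrow> complex"
  assumes c: "continuous_on (- {0}) f"
  shows "(LINT \<phi>|lborel. pol.jac (s, \<phi>) *\<^sub>R f (pol.chart (s, \<phi>)))
    = (if s > 0 then s *\<^sub>R integral {0..2*pi} (\<lambda>\<phi>. f (of_real s * cis \<phi>)) else 0)"
proof (cases "s > 0")
  case True
  let ?g = "\<lambda>\<phi>. f (of_real s * cis \<phi>)"
  have cg: "continuous_on A ?g" for A by (rule continuous_on_circle[OF c True])
  have gm: "?g \<in> borel_measurable borel" by (intro borel_measurable_continuous_onI cg)
  have "(LINT \<phi>|lborel. pol.jac (s, \<phi>) *\<^sub>R f (pol.chart (s, \<phi>))) = (LINT \<phi>|lborel. s *\<^sub>R (indicator {0..2*pi} \<phi> *\<^sub>R ?g \<phi>))"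
  proof (rule integral_cong_AE)
    have "(\<lambda>\<phi>. pol.jac (s, \<phi>) *\<^sub>R f (pol.chart (s, \<phi>))) = (\<lambda>\<phi>. (indicator {0..<2*pi} \<phi> * s) *\<^sub>R ?g \<phi>)"
      using True by (auto simp: pol.jac_def pol.chart_def indicator_def mem_Times_iff)
    then show "(\<lambda>\<phi>. pol.jac (s, \<phi>) *\<^sub>R f (pol.chart (s, \<phi>))) \<in> borel_measurable lborel"
      using gm by simp
    show "(\<lambda>\<phi>. s *\<^sub>R (indicator {0..2*pi} \<phi> *\<^sub>R ?g \<phi>)) \<in> borel_measurable lborel"
      using gm by simp
    have "AE \<phi> in lborel. \<phi> \<noteq> 2 * pi" by (rule AE_lborel_singleton)
    then show "AE \<phi> in lborel. pol.jac (s, \<phi>) *\<^sub>R f (pol.chart (s, \<phi>)) = s *\<^sub>R (indicator {0..2*pi} \<phi> *\<^sub>R ?g \<phi>)"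
      by eventually_elim (use True in \<open>auto simp: pol.jac_def pol.chart_def indicator_def mem_Times_iff\<close>)
  qed
  also have "\<dots> = s *\<^sub>R (LINT \<phi>:{0..2*pi}|lborel. ?g \<phi>)"
    by (simp only: set_lebesgue_integral_def integral_scaleR_right)
  also have "(LINT \<phi>:{0..2*pi}|lborel. ?g \<phi>) = integral {0..2*pi} ?g"
    by (rule set_borel_integral_eq_integral) (rule borel_integrable_atLeastAtMost'[OF cg])
  finally show ?thesis using True by simp
next
  case False
  then show ?thesis by (simp add: pol.jac_def)
qed

text \<open>Contour shifts and angular integrations by parts take place at a fixed radius; this
  carries their results to the plane. Continuity makes every circle integral meaningful, not only
  almost every one.\<close>

lemma integral_eq_circlewise:
  fixes f g :: "complex \<Rightarrow> complex"
  assumes f: "integrable lborel f" "continuous_on (- {0}) f" and g: "integrable lborel g" "continuous_on (- {0}) g"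
    and eq: "\<And>s. s > 0 \<Longrightarrow> integral {0..2*pi} (\<lambda>\<phi>. f (of_real s * cis \<phi>)) = integral {0..2*pi} (\<lambda>\<phi>. g (of_real s * cis \<phi>))"
  shows "(LINT z|lborel. f z) = (LINT z|lborel. g z)"
  unfolding pol.integral_chart_fst[OF f(1)] pol.integral_chart_fst[OF g(1)] pol_inner[OF f(2)] pol_inner[OF g(2)]
  by (intro Bochner_Integration.integral_cong) (simp_all add: eq)

lemma integral_eq_raywise:
  fixes f g :: "complex \<Rightarrow> complex"
  assumes f: "integrable lborel f" and g: "integrable lborel g" 
    and eq: "\<And>u. norm u = 1 \<Longrightarrow> (LINT s:{0<..}|lborel. s *\<^sub>R f (of_real s * u)) = (LINT s:{0<..}|lborel. s *\<^sub>R g (of_real s * u))"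
  shows "(LINT z|lborel. f z) = (LINT z|lborel. g z)"
proof -
  have "(LINT s|lborel. pol.jac (s, \<phi>) *\<^sub>R h (pol.chart (s, \<phi>))) = indicator {0..<2*pi} \<phi> *\<^sub>R (LINT s:{0<..}|lborel. s *\<^sub>R h (of_real s * cis \<phi>))"
    for \<phi> and h :: "complex \<Rightarrow> complex"
    unfolding set_lebesgue_integral_def integral_scaleR_right[symmetric]
    by (intro Bochner_Integration.integral_cong) (auto simp: pol.jac_def pol.chart_def indicator_def mem_Times_iff)
  then show ?thesis
    unfolding pol.integral_chart_snd[OF f] pol.integral_chart_snd[OF g] by (simp add: eq)
qed

lemma lborel_complex_dilate:
  assumes "c > 0"
  shows "lborel = density (distr lborel borel (\<lambda>z::complex. of_real c * z)) (\<lambda>_. ennreal (c\<^sup>2))"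
  using lborel_affine[of c "0::complex"] assms by (simp add: scaleR_conv_of_real ennreal_power)

lemma integrable_dilate:
  fixes f :: "complex \<Rightarrow> complex"
  assumes c: "c > 0" and f: "integrable lborel f"
  shows "integrable lborel (\<lambda>z. f (of_real c * z))"
proof -
  have [measurable]: "(\<lambda>z. complex_of_real c * z) \<in> borel_measurable borel"
    by (intro borel_measurable_continuous_onI continuous_intros)
  have m [measurable]: "f \<in> borel_measurable borel" using f by auto
  from f have "integrable (density (distr lborel borel (\<lambda>z::complex. of_real c * z)) (\<lambda>_. ennreal (c\<^sup>2))) f"
    by (subst (asm) lborel_complex_dilate[OF c])
  then have "integrable lborel (\<lambda>z. c\<^sup>2 *\<^sub>R f (of_real c * z))"
    by (simp add: integrable_density integrable_distr_eq)
  then have "integrable lborel (\<lambda>z. (1 / c\<^sup>2) *\<^sub>R (c\<^sup>2 *\<^sub>R f (of_real c * z)))"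
    using integrable_scaleR_right[of "1 / c\<^sup>2" lborel "\<lambda>z. c\<^sup>2 *\<^sub>R f (of_real c * z)"] by blast
  then show ?thesis using c by (simp add: scaleR_conv_of_real)
qed

lemma integral_dilate:
  fixes f :: "complex \<Rightarrow> complex"
  assumes c: "c > 0" and f: "f \<in> borel_measurable borel"
  shows "(LINT z|lborel. f z) = of_real (c\<^sup>2) * (LINT z|lborel. f (of_real c * z))"
proof -
  have [measurable]: "(\<lambda>z. complex_of_real c * z) \<in> borel_measurable borel"
    by (intro borel_measurable_continuous_onI continuous_intros)
  note [measurable] = f
  have "(LINT z|lborel. f z) = (LINT z|density (distr lborel borel (\<lambda>z::complex. of_real c * z)) (\<lambda>_. ennreal (c\<^sup>2)). f z)"
    by (subst lborel_complex_dilate[OF c]) simp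
  also have "\<dots> = (LINT z|lborel. c\<^sup>2 *\<^sub>R f (of_real c * z))"
    by (simp add: integral_density integral_distr)
  finally show ?thesis by (simp add: scaleR_conv_of_real)
qed

text \<open>The integrand is holomorphic off \<open>0\<close>, because \<open>cnj (A (c / cnj v))\<close> is, and the circles of
  radius \<open>c\<close> and \<open>1\<close> are homologous there.\<close>

lemma circle_shift:
  assumes A: "A holomorphic_on - {0}" and F: "F holomorphic_on - {0}" and c: "c > 0"
  shows "integral {0..2*pi} (\<lambda>\<phi>. cnj (A (cis \<phi>)) * F (of_real c * cis \<phi>) * inverse (cis \<phi>))
    = of_real c * integral {0..2*pi} (\<lambda>\<phi>. cnj (A (of_real c * cis \<phi>)) * F (cis \<phi>) * inverse (cis \<phi>))"
proof -
  \<comment> \<open>On the circle of radius \<open>c\<close> the point \<open>c / cnj v\<close> is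
    \<open>cis t\<close>, on the unit circle it is \<open>c\<close> times \<open>cis t\<close>, so
    one function yields both integrands. One factor \<open>inverse v\<close> is absorbed by dv = i v
    dt; the other is the \<open>inverse (cis \<phi>)\<close> of the statement and produces the
    factor \<open>c\<close>.\<close>
  define G where "G v = cnj (A (of_real c / cnj v)) * F v * inverse (v\<^sup>2)" for v
  have Ac: "(\<lambda>v. cnj (A (of_real c / cnj v))) holomorphic_on - {0}"
  proof -
    have h: "(cnj \<circ> A \<circ> cnj) holomorphic_on - {0}"
    proof (rule holomorphic_on_compose_cnj_cnj)
      have "cnj ` (- {0}) \<subseteq> - {0}" by auto
      then show "A holomorphic_on cnj ` (- {0})" by (rule holomorphic_on_subset[OF A])
    qed (simp add: open_Compl)
    have d: "(\<lambda>v. of_real c / v) holomorphic_on - {0}" by (intro holomorphic_intros) auto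
    have "(cnj \<circ> A \<circ> cnj) \<circ> (\<lambda>v. of_real c / v) holomorphic_on - {0}"
      by (rule holomorphic_on_compose_gen[OF d h]) (use c in auto)
    then show ?thesis by (simp add: o_def)
  qed
  have G: "G holomorphic_on (UNIV - {0})"
  proof -
    have i: "(\<lambda>v::complex. inverse (v\<^sup>2)) holomorphic_on - {0}" by (intro holomorphic_intros) auto
    show ?thesis unfolding G_def Compl_eq_Diff_UNIV[symmetric]
      by (rule holomorphic_on_mult[OF holomorphic_on_mult[OF Ac F] i])
  qed
  have eq: "contour_integral (circlepath 0 c) G = contour_integral (circlepath 0 1) G"
  proof (cases "c \<le> 1")
    case True
    show ?thesis
      by (rule contour_integral_circlepath_eq(3)[OF _ G, symmetric]) (use True c in auto)
  next
    case False
    show ?thesis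
      by (rule contour_integral_circlepath_eq(3)[OF _ G]) (use False c in auto)
  qed
  have cp: "contour_integral (circlepath 0 r) G = integral {0..2*pi} (\<lambda>t. G (of_real r * cis t) * of_real r * \<i> * cis t)" for r
    unfolding circlepath_def by (subst contour_integral_part_circlepath_eq) auto
  have ic: "inverse (cis t) = cnj (cis t)" for t by (simp add: cis_cnj cis_inverse)
  have cc: "of_real c / cnj (cis t) = of_real c * cis t" for t
    by (simp add: divide_inverse cis_cnj cis_inverse)
  have alg: "X * Y * inverse ((k * u)\<^sup>2) * k * \<i> * u = (\<i> / k) * (X * Y * inverse u)"
    if "k \<noteq> 0" "u \<noteq> 0" for X Y k u :: complex
    using that by (simp add: field_simps power2_eq_square)
  have "1 / cnj (cis t) = cis t" for t by (simp add: divide_inverse cis_cnj cis_inverse)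
  then have "of_real c / cnj (of_real c * cis t) = cis t" for t
    using c by simp
  then have l: "G (of_real c * cis t) * of_real c * \<i> * cis t = (\<i> / of_real c) * (cnj (A (cis t)) * F (of_real c * cis t) * inverse (cis t))" for t
    unfolding G_def by (subst alg) (use c in auto)
  have r: "G (of_real 1 * cis t) * of_real 1 * \<i> * cis t = (\<i> / of_real 1) * (cnj (A (of_real c * cis t)) * F (cis t) * inverse (cis t))" for t
    unfolding G_def of_real_1 by (subst alg) (use cc[of t] in auto)
  show ?thesis
    using eq c unfolding cp l r integral_mult_right by (simp add: field_simps)
qed

subsection \<open>Adjointness\<close>

lemma powr_minus_two: "p > 0 \<Longrightarrow> p powr (- 2) = inverse (p\<^sup>2)" for p :: real
  by (simp add: powr_minus powr_numeral)

text \<open>The second summand of the scalar product is the first one at \<open>inverse q\<close>; it is also its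
  conjugate with the arguments swapped, up to a dilation.  Adjointness and orthonormality already
  hold for each summand alone.\<close>

definition half_integrand :: "real \<Rightarrow> wavefun \<Rightarrow> wavefun \<Rightarrow> complex \<Rightarrow> complex" where
  "half_integrand p \<psi>1 \<psi>2 z =
     cnj (\<psi>1 (inverse p) z) * of_real (1 / ((1 + (norm z)\<^sup>2) * (1 + p powr (- 2) * (norm z)\<^sup>2)))
       * (of_real (inverse p) * \<psi>2 p (of_real (inverse p) * z))"

lemma plane_integrand_halves:
  assumes "q > 0"
  shows "plane_integrand q \<psi>1 \<psi>2 z = half_integrand q \<psi>1 \<psi>2 z + half_integrand (inverse q) \<psi>1 \<psi>2 z"
proof -
  have "inverse q powr (- 2) = q\<^sup>2" using assms by (simp add: powr_minus_two power_inverse)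
  then show ?thesis by (simp add: plane_integrand_def half_integrand_def)
qed

section \<open>Growth classes, convergence of a single summand, and its conjugate symmetry\<close>

definition bounded_off_pole :: "(complex \<Rightarrow> complex) \<Rightarrow> bool" where
  "bounded_off_pole f \<longleftrightarrow> continuous_on (- {0}) f \<and> (\<exists>B. \<forall>z. z \<noteq> 0 \<longrightarrow> norm (f z) \<le> B)"

text \<open>The permitted growth is 1/r + r: singular to first order at either pole, as the images
  of admissible functions under \<open>Hplus\<close> and \<open>Hminus\<close> may be.\<close>

definition tame :: "(complex \<Rightarrow> complex) \<Rightarrow> bool" where
  "tame f \<longleftrightarrow> continuous_on (- {0}) f \<and> (\<exists>B. \<forall>z. z \<noteq> 0 \<longrightarrow> norm (f z) \<le> B * ((1 + (norm z)\<^sup>2) / norm z))"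

lemma one_le_weight: "r > 0 \<Longrightarrow> 1 \<le> (1 + r\<^sup>2) / r" for r :: real
  by (simp add: pos_le_divide_eq) (smt (verit) power2_eq_square mult_le_one mult_left_le zero_le_power2 mult_less_cancel_left2)

lemma bounded_imp_tame: "bounded_off_pole f \<Longrightarrow> tame f"
  unfolding bounded_off_pole_def tame_def
proof (elim conjE exE, intro conjI)
  fix B assume B: "\<forall>z. z \<noteq> 0 \<longrightarrow> norm (f z) \<le> B"
  have "0 \<le> B" using B[rule_format, of 1] by (smt (verit) norm_ge_zero zero_neq_one)
  then have "norm (f z) \<le> B * ((1 + (norm z)\<^sup>2) / norm z)" if "z \<noteq> 0" for z
    using B[rule_format, OF that] mult_left_mono[OF one_le_weight[of "norm z"], of B] that by simp
  then show "\<exists>B. \<forall>z. z \<noteq> 0 \<longrightarrow> norm (f z) \<le> B * ((1 + (norm z)\<^sup>2) / norm z)" by blast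
qed

lemma continuous_half_integrand:
  assumes p: "p > 0" and c1: "continuous_on (- {0}) (\<psi>1 (inverse p))" and c2: "continuous_on (- {0}) (\<psi>2 p)"
  shows "continuous_on (- {0}) (half_integrand p \<psi>1 \<psi>2)"
proof -
  have "continuous_on (- {0}) (\<lambda>z. \<psi>2 p (of_real (inverse p) * z))"
    by (rule continuous_on_compose2[OF c2]) (use p in \<open>auto intro!: continuous_intros\<close>)
  moreover have nz: "(1 + (norm z)\<^sup>2) * (1 + p powr (- 2) * (norm z)\<^sup>2) \<noteq> 0" for z :: complex
    by (smt (verit) mult_nonneg_nonneg no_zero_divisors powr_ge_zero zero_le_power2)
  have "continuous_on (- {0}) (\<lambda>z::complex. 1 / ((1 + (norm z)\<^sup>2) * (1 + p powr (- 2) * (norm z)\<^sup>2)))"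
    by (intro continuous_on_divide continuous_intros) (use nz in blast)
  ultimately show ?thesis
    unfolding half_integrand_def using c1 by (intro continuous_on_mult continuous_on_cnj continuous_on_of_real continuous_on_const)
qed

lemma integrable_half_integrand:
  assumes p: "p > 0" and c1: "continuous_on (- {0}) (\<psi>1 (inverse p))" and c2: "continuous_on (- {0}) (\<psi>2 p)"
    and b: "\<And>z. z \<noteq> 0 \<Longrightarrow> norm (\<psi>1 (inverse p) z) * norm (\<psi>2 p (of_real (inverse p) * z)) \<le> B * ((1 + (norm z)\<^sup>2) / norm z)"
  shows "integrable lborel (half_integrand p \<psi>1 \<psi>2)"
proof (rule integrable_punctured_bound)
  show "continuous_on (- {0}) (half_integrand p \<psi>1 \<psi>2)"
    by (rule continuous_half_integrand) fact+
  show "p powr (- 2) > 0" using p by simp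
  fix z :: complex assume z: "z \<noteq> 0"
  define r x where "r = norm z" and "x = norm (\<psi>1 (inverse p) z) * norm (\<psi>2 p (of_real (inverse p) * z))"
  have pos: "1 + p powr (- 2) * r\<^sup>2 > 0" "1 + r\<^sup>2 > 0" "r > 0" using z by (auto simp: r_def add_pos_nonneg)
  have "norm (half_integrand p \<psi>1 \<psi>2 z) = x * inverse p / ((1 + r\<^sup>2) * (1 + p powr (- 2) * r\<^sup>2))"
    unfolding half_integrand_def norm_mult norm_of_real r_def[symmetric] using pos p
    by (simp add: x_def)
  then have "norm (half_integrand p \<psi>1 \<psi>2 z) * (norm z * (1 + p powr (- 2) * (norm z)\<^sup>2)) = inverse p * (x * (r / (1 + r\<^sup>2)))"
    using pos by (simp add: r_def[symmetric])
  also have "\<dots> \<le> inverse p * ((B * ((1 + r\<^sup>2) / r)) * (r / (1 + r\<^sup>2)))"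
    using b[OF z] pos p unfolding x_def r_def[symmetric] by (intro mult_left_mono mult_right_mono) auto
  also have "\<dots> = inverse p * B" using pos by simp
  finally show "norm (half_integrand p \<psi>1 \<psi>2 z) * (norm z * (1 + p powr (- 2) * (norm z)\<^sup>2)) \<le> inverse p * B" .
qed

text \<open>The numerator \<open>1 + r^2\<close> of the tame bound cancels the same factor of the
  weight and leaves the kernel. The dilation by \<open>inverse p\<close> costs only the constant
  \<open>p + inverse p\<close>.\<close>

lemma integrable_half_bounded_tame:
  assumes p: "p > 0" and 1: "bounded_off_pole (\<psi>1 (inverse p))" and 2: "tame (\<psi>2 p)"
  shows "integrable lborel (half_integrand p \<psi>1 \<psi>2)"
proof -
  obtain B where B: "\<And>z. z \<noteq> 0 \<Longrightarrow> norm (\<psi>1 (inverse p) z) \<le> B" using 1 by (auto simp: bounded_off_pole_def)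
  obtain C where C: "\<And>z. z \<noteq> 0 \<Longrightarrow> norm (\<psi>2 p z) \<le> C * ((1 + (norm z)\<^sup>2) / norm z)" using 2 by (auto simp: tame_def)
  have B0: "0 \<le> B" using B[of 1] by (smt (verit) norm_ge_zero zero_neq_one)
  have C0: "0 \<le> C" using C[of 1] order_trans[OF norm_ge_zero[of "\<psi>2 p 1"], of "C * 2"] by simp
  show ?thesis
  proof (rule integrable_half_integrand[OF p, where B = "B * (C * (p + inverse p))"])
    show "continuous_on (- {0}) (\<psi>1 (inverse p))" "continuous_on (- {0}) (\<psi>2 p)"
      using 1 2 by (auto simp: bounded_off_pole_def tame_def)
    fix z :: complex assume z: "z \<noteq> 0"
    define r where "r = norm z"
    have r: "r > 0" using z by (simp add: r_def)
    have "norm (\<psi>2 p (of_real (inverse p) * z)) \<le> C * ((1 + (inverse p * r)\<^sup>2) / (inverse p * r))"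
      using C[of "of_real (inverse p) * z"] z p by (simp add: norm_mult norm_inverse r_def)
    also have "\<dots> \<le> C * ((p + inverse p) * ((1 + r\<^sup>2) / r))"
    proof (intro mult_left_mono C0)
      have "(1 + (inverse p * r)\<^sup>2) / (inverse p * r) = (p + inverse p * r\<^sup>2) / r"
        using p r by (simp add: field_simps power2_eq_square)
      also have "\<dots> \<le> ((p + inverse p) * (1 + r\<^sup>2)) / r"
        using p r by (intro divide_right_mono) (auto simp: algebra_simps)
      finally show "(1 + (inverse p * r)\<^sup>2) / (inverse p * r) \<le> (p + inverse p) * ((1 + r\<^sup>2) / r)" by simp
    qed
    finally have "norm (\<psi>1 (inverse p) z) * norm (\<psi>2 p (of_real (inverse p) * z)) \<le> B * (C * ((p + inverse p) * ((1 + r\<^sup>2) / r)))"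
      using B[OF z] by (intro mult_mono) (auto intro: B0)
    then show "norm (\<psi>1 (inverse p) z) * norm (\<psi>2 p (of_real (inverse p) * z)) \<le> B * (C * (p + inverse p)) * ((1 + (norm z)\<^sup>2) / norm z)"
      by (simp add: r_def mult.assoc)
  qed
qed

lemma half_integrand_swap:
  assumes p: "p > 0"
  shows "half_integrand (inverse p) \<psi>2 \<psi>1 z = of_real (p\<^sup>2) * cnj (half_integrand p \<psi>1 \<psi>2 (of_real p * z))"
proof -
  have 1: "inverse p powr (- 2) = p\<^sup>2" using p by (simp add: powr_minus_two power_inverse)
  have 2: "p powr (- 2) * (norm (of_real p * z))\<^sup>2 = (norm z)\<^sup>2"
    using p by (simp add: powr_minus_two norm_mult power_mult_distrib)
  have 3: "of_real (inverse p) * (of_real p * z) = z" using p by simp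
  have 4: "1 + (norm (of_real p * z))\<^sup>2 = 1 + p\<^sup>2 * (norm z)\<^sup>2" by (simp add: norm_mult power_mult_distrib)
  have 5: "complex_of_real (p\<^sup>2) * (X * W * (of_real (inverse p) * Y)) = Y * W * (of_real p * X)" for X W Y
    using p by (simp add: power2_eq_square)
  have 6: "(1 + p\<^sup>2 * (norm z)\<^sup>2) * (1 + (norm z)\<^sup>2) = (1 + (norm z)\<^sup>2) * (1 + p\<^sup>2 * (norm z)\<^sup>2)"
    by (rule mult.commute)
  show ?thesis
    unfolding half_integrand_def 1 2 3 4 6 inverse_inverse_eq complex_cnj_mult complex_cnj_cnj complex_cnj_complex_of_real
    by (rule 5[symmetric])
qed

lemma integrable_half_swap:
  assumes p: "p > 0" and i: "integrable lborel (half_integrand p \<psi>1 \<psi>2)"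
  shows "integrable lborel (half_integrand (inverse p) \<psi>2 \<psi>1)"
proof -
  have "integrable lborel (\<lambda>z. cnj (half_integrand p \<psi>1 \<psi>2 (of_real p * z)))"
    using integrable_dilate[OF p i] integrable_cnj by blast
  then have "integrable lborel (\<lambda>z. of_real (p\<^sup>2) * cnj (half_integrand p \<psi>1 \<psi>2 (of_real p * z)))"
    by (intro integrable_mult_right)
  then show ?thesis unfolding half_integrand_swap[OF p, abs_def] .
qed

lemma integral_half_swap:
  assumes p: "p > 0" and i: "integrable lborel (half_integrand p \<psi>1 \<psi>2)"
  shows "(LINT z|lborel. half_integrand (inverse p) \<psi>2 \<psi>1 z) = cnj (LINT z|lborel. half_integrand p \<psi>1 \<psi>2 z)"
proof -
  have m: "half_integrand p \<psi>1 \<psi>2 \<in> borel_measurable borel" using i by auto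
  have "(LINT z|lborel. half_integrand (inverse p) \<psi>2 \<psi>1 z)
    = of_real (p\<^sup>2) * cnj (LINT z|lborel. half_integrand p \<psi>1 \<psi>2 (of_real p * z))"
    unfolding half_integrand_swap[OF p, abs_def] by (simp only: integral_mult_right_zero Bochner_Integration.integral_cnj)
  also have "\<dots> = cnj (of_real (p\<^sup>2) * (LINT z|lborel. half_integrand p \<psi>1 \<psi>2 (of_real p * z)))"
    by simp
  also have "\<dots> = cnj (LINT z|lborel. half_integrand p \<psi>1 \<psi>2 z)" by (simp only: integral_dilate[OF p m])
  finally show ?thesis .
qed

lemma scalar_plane_halves:
  assumes q: "q > 0" and i: "integrable lborel (half_integrand q \<psi>1 \<psi>2)" "integrable lborel (half_integrand (inverse q) \<psi>1 \<psi>2)"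
  shows "plane_converges q \<psi>1 \<psi>2"
    "scalar_plane q \<psi>1 \<psi>2 = of_real (log_factor q) * ((LINT z|lborel. half_integrand q \<psi>1 \<psi>2 z) + (LINT z|lborel. half_integrand (inverse q) \<psi>1 \<psi>2 z))"
  using i unfolding plane_converges_def scalar_plane_def plane_integrand_halves[OF q, abs_def] by simp_all

text \<open>The quantified \<open>p\<close> inside is a bound variable, different from the
  parameter: both families have to be admissible at every positive value, because a summand uses the
  left family at \<open>inverse p\<close> and the right one at \<open>p\<close>.\<close>

definition half_adjoint :: "real \<Rightarrow> (wavefun \<Rightarrow> wavefun) \<Rightarrow> (wavefun \<Rightarrow> wavefun) \<Rightarrow> bool" where
  "half_adjoint p A B \<longleftrightarrow> (\<forall>\<psi>1 \<psi>2. (\<forall>p>0. admissible (\<psi>1 p)) \<and> (\<forall>p>0. admissible (\<psi>2 p)) \<longrightarrow>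
     integrable lborel (half_integrand p \<psi>1 \<psi>2) \<and>
     integrable lborel (half_integrand p \<psi>1 (A \<psi>2)) \<and> integrable lborel (half_integrand p (B \<psi>1) \<psi>2) \<and>
     (LINT z|lborel. half_integrand p \<psi>1 (A \<psi>2) z) = (LINT z|lborel. half_integrand p (B \<psi>1) \<psi>2 z))"

lemma adjoint_wrt_plane_of_halves:
  assumes "q > 0" "half_adjoint q A B" "half_adjoint (inverse q) A B"
  shows "adjoint_wrt scalar_plane plane_converges q A B"
  unfolding adjoint_wrt_def
proof (intro allI impI, elim conjE)
  fix \<psi>1 \<psi>2 :: wavefun
  assume a: "\<forall>p>0. admissible (\<psi>1 p)" "\<forall>p>0. admissible (\<psi>2 p)"
  note h1 = assms(2)[unfolded half_adjoint_def, rule_format, OF conjI[OF a]]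
  note h2 = assms(3)[unfolded half_adjoint_def, rule_format, OF conjI[OF a]]
  show "plane_converges q \<psi>1 \<psi>2 \<and> plane_converges q \<psi>1 (A \<psi>2) \<and> plane_converges q (B \<psi>1) \<psi>2 \<and>
    scalar_plane q \<psi>1 (A \<psi>2) = scalar_plane q (B \<psi>1) \<psi>2"
    using h1 h2 assms(1) by (simp add: scalar_plane_halves)
qed

text \<open>Conjugate symmetry exchanges the arguments and inverts \<open>p\<close>, so the relation
  for \<open>Hminus\<close> follows from the one for \<open>Hplus\<close> without a second
  computation.\<close>

lemma half_adjoint_swap:
  assumes p: "p > 0" and h: "half_adjoint (inverse p) A B"
  shows "half_adjoint p B A"
  unfolding half_adjoint_def
proof (intro allI impI, elim conjE)
  fix \<psi>1 \<psi>2 :: wavefun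
  assume a: "\<forall>p>0. admissible (\<psi>1 p)" "\<forall>p>0. admissible (\<psi>2 p)"
  have ip: "inverse p > 0" using p by simp
  have h': "integrable lborel (half_integrand (inverse p) \<psi>2 \<psi>1)"
     "integrable lborel (half_integrand (inverse p) \<psi>2 (A \<psi>1))" "integrable lborel (half_integrand (inverse p) (B \<psi>2) \<psi>1)"
     "(LINT z|lborel. half_integrand (inverse p) \<psi>2 (A \<psi>1) z) = (LINT z|lborel. half_integrand (inverse p) (B \<psi>2) \<psi>1 z)"
    using h a by (auto simp: half_adjoint_def)
  show "integrable lborel (half_integrand p \<psi>1 \<psi>2) \<and>
     integrable lborel (half_integrand p \<psi>1 (B \<psi>2)) \<and> integrable lborel (half_integrand p (A \<psi>1) \<psi>2) \<and>
     (LINT z|lborel. half_integrand p \<psi>1 (B \<psi>2) z) = (LINT z|lborel. half_integrand p (A \<psi>1) \<psi>2 z)"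
    using integrable_half_swap[OF ip h'(1)] integrable_half_swap[OF ip h'(2)] integrable_half_swap[OF ip h'(3)]
      integral_half_swap[OF ip h'(2)] integral_half_swap[OF ip h'(3)] h'(4) by simp
qed

lemma admissible_bounded: "admissible f \<Longrightarrow> bounded_off_pole f"
  unfolding bounded_off_pole_def
proof
  assume f: "admissible f"
  obtain B where B: "\<And>\<rho> u. \<rho> > 0 \<Longrightarrow> 1 \<le> norm u \<Longrightarrow> norm u \<le> 1 \<Longrightarrow> norm (phase_ext f \<rho> u) \<le> B"
    using phase_ext_annulus_bound[OF f, of 1 1] by auto
  have "norm (f z) \<le> B" if "z \<noteq> 0" for z
    using B[of "norm z" "sgn z"] phase_ext_sgn[OF f, of 1 z] that by (simp add: norm_sgn)
  then show "\<exists>B. \<forall>z. z \<noteq> 0 \<longrightarrow> norm (f z) \<le> B" by blast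
qed (rule admissible_continuous)

lemma admissible_T_bounded:
  assumes "admissible f" shows "bounded_off_pole (T_op f)" "bounded_off_pole (Tbar_op f)"
  using assms unfolding admissible_def bounded_off_pole_def by blast+

text \<open>Here the joint continuity in radius and phase is used: as \<open>z\<close> varies, the
  continuation itself changes with \<open>norm z\<close>.\<close>

lemma bounded_off_pole_phase_ext:
  assumes f: "admissible f" and c: "c > 0"
  shows "bounded_off_pole (\<lambda>z. phase_ext f (norm z) (of_real c * sgn z))"
  unfolding bounded_off_pole_def
proof
  have "continuous_on (- {0}) (\<lambda>z. (norm z, of_real c * sgn z :: complex))"
    by (intro continuous_intros) auto
  moreover have "(\<lambda>z. (norm z, of_real c * sgn z :: complex)) ` (- {0}) \<subseteq> {0<..} \<times> - {0}"
    using c by (auto simp: sgn_zero_iff)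
  ultimately show "continuous_on (- {0}) (\<lambda>z. phase_ext f (norm z) (of_real c * sgn z))"
    using continuous_on_compose2[OF phase_ext_continuous[OF f]] by fastforce
  obtain B where B: "\<And>\<rho> u. \<rho> > 0 \<Longrightarrow> c \<le> norm u \<Longrightarrow> norm u \<le> c \<Longrightarrow> norm (phase_ext f \<rho> u) \<le> B"
    using phase_ext_annulus_bound[OF f c, of c] by auto
  have "norm (phase_ext f (norm z) (of_real c * sgn z)) \<le> B" if "z \<noteq> 0" for z
    using B[of "norm z" "of_real c * sgn z"] that c by (simp add: norm_sgn norm_mult)
  then show "\<exists>B. \<forall>z. z \<noteq> 0 \<longrightarrow> norm (phase_ext f (norm z) (of_real c * sgn z)) \<le> B" by blast
qed

lemma bounded_off_pole_dilate:
  assumes f: "bounded_off_pole f" and c: "c > 0"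
  shows "bounded_off_pole (\<lambda>z. f (of_real c * z))"
  unfolding bounded_off_pole_def
proof
  show "continuous_on (- {0}) (\<lambda>z. f (of_real c * z))"
    by (rule continuous_on_compose2[of "- {0}" f]) (use f c in \<open>auto simp: bounded_off_pole_def intro!: continuous_intros\<close>)
  show "\<exists>B. \<forall>z. z \<noteq> 0 \<longrightarrow> norm (f (of_real c * z)) \<le> B"
    using f c unfolding bounded_off_pole_def by (metis mult_eq_0_iff of_real_eq_0_iff less_irrefl)
qed

section \<open>The ladder operators for q different from 1\<close>

lemma tame_H_form:
  assumes p: "p > 0" and f: "admissible f" and h: "continuous_on (- {0}) h" "\<And>z. z \<noteq> 0 \<Longrightarrow> norm (h z) = 1 / norm z"
    and eq: "\<And>z. z \<noteq> 0 \<Longrightarrow> H z = h z * (of_real (k1 * (1 + (norm z)\<^sup>2)) * f (of_real p * z)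
      - of_real (k2 z) * phase_ext f (norm z) (of_real (inverse p) * sgn z)
      - of_real (k3 z) * phase_ext f (norm z) (of_real p * sgn z)) / d"
    and k: "continuous_on (- {0}) k2" "continuous_on (- {0}) k3"
      "\<And>z. \<bar>k2 z\<bar> \<le> K * (1 + (norm z)\<^sup>2)" "\<And>z. \<bar>k3 z\<bar> \<le> K * (1 + (norm z)\<^sup>2)"
  shows "tame H"
proof -
  note b1 = bounded_off_pole_dilate[OF admissible_bounded[OF f] p]
  note b2 = bounded_off_pole_phase_ext[OF f, of "inverse p"]
  note b3 = bounded_off_pole_phase_ext[OF f p]
  have "inverse p > 0" using p by simp
  note b2 = b2[OF this]
  obtain B1 B2 B3 where B: "\<And>z. z \<noteq> 0 \<Longrightarrow> norm (f (of_real p * z)) \<le> B1"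
    "\<And>z. z \<noteq> 0 \<Longrightarrow> norm (phase_ext f (norm z) (of_real (inverse p) * sgn z)) \<le> B2"
    "\<And>z. z \<noteq> 0 \<Longrightarrow> norm (phase_ext f (norm z) (of_real p * sgn z)) \<le> B3"
    using b1 b2 b3 unfolding bounded_off_pole_def by blast
  show ?thesis unfolding tame_def
  proof
    have "continuous_on (- {0}) (\<lambda>z. h z * (of_real (k1 * (1 + (norm z)\<^sup>2)) * f (of_real p * z)
      - of_real (k2 z) * phase_ext f (norm z) (of_real (inverse p) * sgn z)
      - of_real (k3 z) * phase_ext f (norm z) (of_real p * sgn z)) * inverse d)"
      using b1 b2 b3 unfolding bounded_off_pole_def
      by (intro continuous_on_mult continuous_on_diff continuous_on_of_real h k continuous_intros) auto
    then show "continuous_on (- {0}) H"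
      by (rule continuous_on_eq) (simp add: eq divide_inverse)
    have "norm (H z) \<le> (norm (inverse d) * (\<bar>k1\<bar> * B1 + K * B2 + K * B3)) * ((1 + (norm z)\<^sup>2) / norm z)" if z: "z \<noteq> 0" for z
    proof -
      have n: "1 + (norm z)\<^sup>2 > 0" by (simp add: add_pos_nonneg)
      have "norm (of_real (k1 * (1 + (norm z)\<^sup>2)) * f (of_real p * z)
        - of_real (k2 z) * phase_ext f (norm z) (of_real (inverse p) * sgn z)
        - of_real (k3 z) * phase_ext f (norm z) (of_real p * sgn z))
        \<le> norm (of_real (k1 * (1 + (norm z)\<^sup>2)) * f (of_real p * z))
        + norm (of_real (k2 z) * phase_ext f (norm z) (of_real (inverse p) * sgn z))
        + norm (of_real (k3 z) * phase_ext f (norm z) (of_real p * sgn z))"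
        by (meson add_mono norm_triangle_ineq4 order_trans order_refl)
      also have "\<dots> \<le> \<bar>k1\<bar> * (1 + (norm z)\<^sup>2) * B1 + K * (1 + (norm z)\<^sup>2) * B2 + K * (1 + (norm z)\<^sup>2) * B3"
        unfolding norm_mult norm_of_real abs_mult
        using n k(3,4)[of z] B[OF z] by (intro add_mono mult_mono) (auto intro: order_trans[OF abs_ge_zero])
      also have "\<dots> = (\<bar>k1\<bar> * B1 + K * B2 + K * B3) * (1 + (norm z)\<^sup>2)" by (simp add: algebra_simps)
      finally have "norm (H z) \<le> 1 / norm z * ((\<bar>k1\<bar> * B1 + K * B2 + K * B3) * (1 + (norm z)\<^sup>2)) * norm (inverse d)"
        unfolding eq[OF z] divide_inverse[of _ d] norm_mult h(2)[OF z]
        by (intro mult_right_mono mult_left_mono) auto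
      then show ?thesis by (simp add: divide_inverse mult_ac)
    qed
    then show "\<exists>B. \<forall>z. z \<noteq> 0 \<longrightarrow> norm (H z) \<le> B * ((1 + (norm z)\<^sup>2) / norm z)" by blast
  qed
qed

lemma weight_split_bounds:
  fixes x y n :: real
  assumes "0 \<le> x" "0 \<le> y" "0 \<le> n"
  shows "x \<le> (x + y) * (1 + n)" "y * n \<le> (x + y) * (1 + n)"
  using mult_mono[of x "x + y" 1 "1 + n"] mult_mono[of y "x + y" n "1 + n"] assms by auto

lemma Hplus_tame_ne1:
  assumes p: "p > 0" "p \<noteq> 1" and f: "admissible (\<psi> p)"
  shows "tame (Hplus N \<psi> p)"
proof (rule tame_H_form[OF p(1) f, where h = "\<lambda>z. - inverse z"])
  let ?K = "p powr (- N / 2) + p powr (3 * N / 2)"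
  show "Hplus N \<psi> p z = - inverse z *
    (of_real (p powr (- N / 2) * (1 + (norm z)\<^sup>2)) * \<psi> p (of_real p * z)
     - of_real (p powr (- N / 2)) * phase_ext (\<psi> p) (norm z) (of_real (inverse p) * sgn z)
     - of_real (p powr (3 * N / 2) * (norm z)\<^sup>2) * phase_ext (\<psi> p) (norm z) (of_real p * sgn z)) / of_real (p - inverse p)"
    if "z \<noteq> 0" for z by (rule Hplus_eq) fact+
  show "\<bar>p powr (- N / 2)\<bar> \<le> ?K * (1 + (norm z)\<^sup>2)" for z :: complex
    using weight_split_bounds(1)[of "p powr (- N / 2)" "p powr (3 * N / 2)" "(norm z)\<^sup>2"] by simp
  show "\<bar>p powr (3 * N / 2) * (norm z)\<^sup>2\<bar> \<le> ?K * (1 + (norm z)\<^sup>2)" for z :: complex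
    using weight_split_bounds(2)[of "p powr (- N / 2)" "p powr (3 * N / 2)" "(norm z)\<^sup>2"] by (simp add: abs_mult)
qed (auto intro!: continuous_intros simp: norm_inverse inverse_eq_divide norm_divide)

lemma Hminus_tame_ne1:
  assumes p: "p > 0" "p \<noteq> 1" and f: "admissible (\<psi> p)"
  shows "tame (Hminus N \<psi> p)"
proof (rule tame_H_form[OF p(1) f, where h = "\<lambda>z. inverse (cnj z)"])
  let ?K = "p powr (N / 2) + p powr (- 3 * N / 2)"
  show "Hminus N \<psi> p z = inverse (cnj z) *
    (of_real (p powr (N / 2) * (1 + (norm z)\<^sup>2)) * \<psi> p (of_real p * z)
     - of_real (p powr (- 3 * N / 2) * (norm z)\<^sup>2) * phase_ext (\<psi> p) (norm z) (of_real (inverse p) * sgn z)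
     - of_real (p powr (N / 2)) * phase_ext (\<psi> p) (norm z) (of_real p * sgn z)) / of_real (p - inverse p)"
    if "z \<noteq> 0" for z by (rule Hminus_eq) fact+
  show "\<bar>p powr (N / 2)\<bar> \<le> ?K * (1 + (norm z)\<^sup>2)" for z :: complex
    using weight_split_bounds(1)[of "p powr (N / 2)" "p powr (- 3 * N / 2)" "(norm z)\<^sup>2"] by simp
  show "\<bar>p powr (- 3 * N / 2) * (norm z)\<^sup>2\<bar> \<le> ?K * (1 + (norm z)\<^sup>2)" for z :: complex
    using weight_split_bounds(2)[of "p powr (N / 2)" "p powr (- 3 * N / 2)" "(norm z)\<^sup>2"] by (simp add: abs_mult)
qed (auto intro!: continuous_intros simp: norm_inverse inverse_eq_divide norm_divide)

text \<open>The radial weights of the three terms of an operator: one factor of the full weight has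
  cancelled in the dilation term, while the two phase terms keep the full weight, one of them with
  an extra \<open>r^2\<close>.\<close>

lemma weight_bounds:
  assumes "a > 0" "r > 0"
  shows "r * (1 + a * r\<^sup>2) * (1 / r * (1 / (1 + a * r\<^sup>2))) = (1::real)"
    "r * (1 + a * r\<^sup>2) * (1 / r * (1 / ((1 + r\<^sup>2) * (1 + a * r\<^sup>2)))) \<le> 1"
    "r * (1 + a * r\<^sup>2) * (1 / r * (r\<^sup>2 * (1 / ((1 + r\<^sup>2) * (1 + a * r\<^sup>2))))) \<le> 1"
proof -
  have n: "1 + a * r\<^sup>2 > 0" "1 + r\<^sup>2 > 0" using assms by (auto simp: add_pos_nonneg)
  show "r * (1 + a * r\<^sup>2) * (1 / r * (1 / (1 + a * r\<^sup>2))) = 1" using n assms by simp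
  have "r * (1 + a * r\<^sup>2) * (1 / r * (1 / ((1 + r\<^sup>2) * (1 + a * r\<^sup>2)))) = 1 / (1 + r\<^sup>2)" using n assms by simp
  then show "r * (1 + a * r\<^sup>2) * (1 / r * (1 / ((1 + r\<^sup>2) * (1 + a * r\<^sup>2)))) \<le> 1" using n by simp
  have "r * (1 + a * r\<^sup>2) * (1 / r * (r\<^sup>2 * (1 / ((1 + r\<^sup>2) * (1 + a * r\<^sup>2))))) = r\<^sup>2 / (1 + r\<^sup>2)" using n assms by simp
  then show "r * (1 + a * r\<^sup>2) * (1 / r * (r\<^sup>2 * (1 / ((1 + r\<^sup>2) * (1 + a * r\<^sup>2))))) \<le> 1" using n by simp
qed

lemma integrable_bounded_weight:
  assumes a: "a > 0" and f: "bounded_off_pole f" and g: "bounded_off_pole g"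
    and w: "continuous_on (- {0}) (w :: complex \<Rightarrow> real)" "\<And>z. z \<noteq> 0 \<Longrightarrow> w z \<ge> 0"
      "\<And>z. z \<noteq> 0 \<Longrightarrow> norm z * (1 + a * (norm z)\<^sup>2) * (1 / norm z * w z) \<le> 1"
  shows "integrable lborel (\<lambda>z. cnj (f z) * g z * inverse z * of_real (w z))"
    "continuous_on (- {0}) (\<lambda>z. cnj (f z) * g z * inverse z * of_real (w z))"
proof -
  obtain B C where B: "\<And>z. z \<noteq> 0 \<Longrightarrow> norm (f z) \<le> B" and C: "\<And>z. z \<noteq> 0 \<Longrightarrow> norm (g z) \<le> C"
    using f g unfolding bounded_off_pole_def by blast
  have BC: "0 \<le> B" "0 \<le> C" using B[of 1] C[of 1] by (auto intro: order_trans[OF norm_ge_zero])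
  show c: "continuous_on (- {0}) (\<lambda>z. cnj (f z) * g z * inverse z * of_real (w z))"
    using f g unfolding bounded_off_pole_def
    by (intro continuous_on_mult continuous_on_cnj continuous_on_of_real w continuous_intros) auto
  show "integrable lborel (\<lambda>z. cnj (f z) * g z * inverse z * of_real (w z))"
  proof (rule integrable_punctured_bound[OF c a])
    fix z :: complex assume z: "z \<noteq> 0"
    have "norm (cnj (f z) * g z * inverse z * of_real (w z)) * (norm z * (1 + a * (norm z)\<^sup>2))
      = (norm (f z) * norm (g z)) * (norm z * (1 + a * (norm z)\<^sup>2) * (1 / norm z * w z))"
      using w(2)[OF z] by (simp add: norm_mult norm_inverse norm_divide divide_inverse)
    also have "\<dots> \<le> (B * C) * 1"
      using B[OF z] C[OF z] BC w(2,3)[OF z] a by (intro mult_mono) (auto intro!: mult_nonneg_nonneg add_nonneg_nonneg)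
    finally show "norm (cnj (f z) * g z * inverse z * of_real (w z)) * (norm z * (1 + a * (norm z)\<^sup>2)) \<le> B * C" by simp
  qed
qed

text \<open>The terms of \<open>H\<^sub>+\<close> and \<open>H\<^sub>-\<close> that move the phase are matched circle by circle; the dilation term
  is matched by a change of variable.\<close>

lemma circle_terms_eq:
  assumes f: "admissible f" and g: "admissible g" and p: "p > 0" and c: "c > 0"
    and w: "continuous_on (- {0}) (\<lambda>z::complex. w (norm z) :: real)" "\<And>r. r > 0 \<Longrightarrow> w r \<ge> 0"
      "\<And>r. r > 0 \<Longrightarrow> r * (1 + a * r\<^sup>2) * (1 / r * w r) \<le> 1" and a: "a > 0"
  defines "t \<equiv> \<lambda>z. cnj (f z) * phase_ext g (p * norm z) (of_real c * sgn z) * inverse z * of_real (w (norm z))"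
    and "s \<equiv> \<lambda>z. cnj (phase_ext f (norm z) (of_real c * sgn z)) * g (of_real p * z) * inverse z * of_real (w (norm z))"
  shows "integrable lborel t" "integrable lborel s" "(LINT z|lborel. t z) = of_real c * (LINT z|lborel. s z)"
proof -
  note bf = admissible_bounded[OF f] and bg = admissible_bounded[OF g]
  note bF = bounded_off_pole_phase_ext[OF f c]
  have "bounded_off_pole (\<lambda>z. phase_ext g (norm (of_real p * z)) (of_real c * sgn (of_real p * z)))"
    using bounded_off_pole_dilate[OF bounded_off_pole_phase_ext[OF g c] p] .
  moreover have "sgn (of_real p * z) = sgn z" for z :: complex using p by (simp add: sgn_eq norm_mult)
  ultimately have bG: "bounded_off_pole (\<lambda>z. phase_ext g (p * norm z) (of_real c * sgn z))"
    using p by (simp add: norm_mult)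
  have w': "\<And>z::complex. z \<noteq> 0 \<Longrightarrow> w (norm z) \<ge> 0"
      "\<And>z::complex. z \<noteq> 0 \<Longrightarrow> norm z * (1 + a * (norm z)\<^sup>2) * (1 / norm z * w (norm z)) \<le> 1"
    using w by auto
  note T = integrable_bounded_weight[OF a bf bG w(1) w', folded t_def]
  note S = integrable_bounded_weight[OF a bF bounded_off_pole_dilate[OF bg p] w(1) w']
  show "integrable lborel t" by (rule T(1))
  show int_s: "integrable lborel s" using S(1) by (simp add: s_def)
  have "(LINT z|lborel. t z) = (LINT z|lborel. of_real c * s z)"
  proof (rule integral_eq_circlewise)
    show "integrable lborel t" by (rule T(1))
    show "continuous_on (- {0}) t" by (rule T(2))
    show "integrable lborel (\<lambda>z. of_real c * s z)" "continuous_on (- {0}) (\<lambda>z. of_real c * s z)"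
      by (intro integrable_mult_right int_s continuous_on_mult continuous_on_const S(2)[folded s_def])+
    fix r :: real assume r: "r > 0"
    let ?F = "phase_ext f r" and ?G = "phase_ext g (p * r)"
    have "t (of_real r * cis \<phi>) = of_real (w r / r) * (cnj (?F (cis \<phi>)) * ?G (of_real c * cis \<phi>) * inverse (cis \<phi>))" for \<phi>
      using r p phase_ext_unit[OF f r, of "cis \<phi>"] by (simp add: t_def norm_mult sgn_of_real_mult divide_inverse)
    moreover have "s (of_real r * cis \<phi>) = of_real (w r / r) * (cnj (?F (of_real c * cis \<phi>)) * ?G (cis \<phi>) * inverse (cis \<phi>))" for \<phi>
      using r p phase_ext_unit[OF g, of "p * r" "cis \<phi>"] by (simp add: s_def norm_mult sgn_of_real_mult divide_inverse mult.assoc)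
    ultimately show "integral {0..2*pi} (\<lambda>\<phi>. t (of_real r * cis \<phi>)) = integral {0..2*pi} (\<lambda>\<phi>. of_real c * s (of_real r * cis \<phi>))"
      using circle_shift[OF phase_ext_holomorphic[OF f r] phase_ext_holomorphic[OF g, of "p * r"] c] r p
      by (simp only: integral_mult_right) (simp add: ac_simps)
  qed
  then show "(LINT z|lborel. t z) = of_real c * (LINT z|lborel. s z)"
    by (simp only: integral_mult_right_zero)
qed

lemma inverse_powr: "p > 0 \<Longrightarrow> inverse p powr x = p powr (- x)" for p :: real
  by (simp add: powr_def ln_inverse)

lemma half_adjoint_Hplus_ne1:
  assumes p: "p > 0" "p \<noteq> 1"
  shows "half_adjoint p (Hplus N) (Hminus N)"
  unfolding half_adjoint_def
proof (intro allI impI, elim conjE)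
  fix \<psi>1 \<psi>2 :: wavefun
  assume adm: "\<forall>p>0. admissible (\<psi>1 p)" "\<forall>p>0. admissible (\<psi>2 p)"
  define f g i a where "f = \<psi>1 (inverse p)" and "g = \<psi>2 p" and "i = inverse p" and "a = p powr (- 2)"
  have i: "i > 0" "i \<noteq> 1" and a: "a > 0" "a = i\<^sup>2" using p by (auto simp: i_def a_def powr_minus_two power_inverse)
  have af: "admissible f" and ag: "admissible g" using adm p by (auto simp: f_def g_def)
  have bd: "bounded_off_pole (\<psi>1 (inverse p))" "bounded_off_pole (\<psi>2 p)"
    using admissible_bounded[OF af] admissible_bounded[OF ag] by (simp_all add: f_def g_def)
  define W where "W r = 1 / ((1 + r\<^sup>2) * (1 + a * r\<^sup>2))" for r :: real
  define d k0 k1 where "d = p - inverse p" and "k0 = p powr (- N / 2)" and "k1 = p powr (3 * N / 2)"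
  have n: "1 + a * r\<^sup>2 > 0" "1 + r\<^sup>2 > 0" for r :: real using a by (auto simp: add_pos_nonneg)
  have cW: "continuous_on (- {0}) (\<lambda>z::complex. W (norm z))"
    unfolding W_def by (intro continuous_intros) (use n in \<open>auto simp: less_le\<close>)
  have cW2: "continuous_on (- {0}) (\<lambda>z::complex. (norm z)\<^sup>2 * W (norm z))"
    by (intro continuous_on_mult cW continuous_intros)
  have W0: "W r \<ge> 0" for r unfolding W_def using n[of r] by simp
  \<comment> \<open>The \<open>t\<close> terms come from \<open>Hplus\<close> acting on the right
    and the \<open>s\<close> terms from \<open>Hminus\<close> acting on the left. In
    \<open>t1\<close> the outer dilation cancels the one in \<open>Hplus\<close>, so both functions
    stand at \<open>z\<close>; in \<open>s1\<close> both stand at \<open>i * z\<close>, and the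
    substitution of \<open>i * z\<close> for \<open>z\<close> links them.\<close>
  define t1 where "t1 z = cnj (f z) * g z * inverse z * of_real (1 / (1 + (norm z)\<^sup>2))" for z
  define s1 where "s1 z = cnj (f (of_real i * z)) * g (of_real i * z) * inverse z * of_real (1 / (1 + a * (norm z)\<^sup>2))" for z
  define t2 where "t2 z = cnj (f z) * phase_ext g (i * norm z) (of_real i * sgn z) * inverse z * of_real (W (norm z))" for z
  define s2 where "s2 z = cnj (phase_ext f (norm z) (of_real i * sgn z)) * g (of_real i * z) * inverse z * of_real (W (norm z))" for z
  define t3 where "t3 z = cnj (f z) * phase_ext g (i * norm z) (of_real p * sgn z) * inverse z * of_real ((norm z)\<^sup>2 * W (norm z))" for z
  define s3 where "s3 z = cnj (phase_ext f (norm z) (of_real p * sgn z)) * g (of_real i * z) * inverse z * of_real ((norm z)\<^sup>2 * W (norm z))" for z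
  have i1: "integrable lborel t1" unfolding t1_def
  proof (rule integrable_bounded_weight(1)[OF _ admissible_bounded[OF af] admissible_bounded[OF ag], where a = 1])
    show "continuous_on (- {0}) (\<lambda>z::complex. 1 / (1 + (norm z)\<^sup>2))"
      by (intro continuous_intros) (use n in \<open>auto simp: less_le\<close>)
    show "norm z * (1 + 1 * (norm z)\<^sup>2) * (1 / norm z * (1 / (1 + (norm z)\<^sup>2))) \<le> 1" if "z \<noteq> 0" for z :: complex
      using weight_bounds(1)[of 1 "norm z"] that by simp
  qed auto
  have ts1: "t1 (of_real i * z) = of_real p * s1 z" for z
    using i by (simp add: t1_def s1_def a norm_mult power_mult_distrib) (simp add: i_def)
  have "integrable lborel (\<lambda>z. of_real i * t1 (of_real i * z))"
    using integrable_dilate[OF i(1) i1] by (rule integrable_mult_right)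
  moreover have "of_real i * t1 (of_real i * z) = s1 z" for z unfolding ts1 using p by (simp add: i_def)
  ultimately have j1: "integrable lborel s1" by simp
  have I1: "(LINT z|lborel. t1 z) = of_real i * (LINT z|lborel. s1 z)"
  proof -
    have "(LINT z|lborel. t1 z) = of_real (i\<^sup>2) * (of_real p * (LINT z|lborel. s1 z))"
      using integral_dilate[OF i(1), of t1] i1 unfolding ts1 integral_mult_right_zero by simp
    then show ?thesis using p by (simp add: power2_eq_square i_def)
  qed
  have w2: "\<And>r. r > 0 \<Longrightarrow> r * (1 + a * r\<^sup>2) * (1 / r * W r) \<le> 1"
    and w3: "\<And>r. r > 0 \<Longrightarrow> r * (1 + a * r\<^sup>2) * (1 / r * (r\<^sup>2 * W r)) \<le> 1"
    unfolding W_def using weight_bounds(2,3)[OF a(1)] by auto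
  have W2: "r\<^sup>2 * W r \<ge> 0" for r using W0 by simp
  note c2 = circle_terms_eq[OF af ag i(1) i(1) cW W0 w2 a(1), folded t2_def s2_def]
  note c3 = circle_terms_eq[OF af ag i(1) p(1) cW2 W2 w3 a(1), folded t3_def s3_def]
  have I2: "integrable lborel t2" "integrable lborel s2" "(LINT z|lborel. t2 z) = of_real i * (LINT z|lborel. s2 z)"
    using c2 by (simp_all add: t2_def[abs_def] s2_def[abs_def])
  have I3: "integrable lborel t3" "integrable lborel s3" "(LINT z|lborel. t3 z) = of_real p * (LINT z|lborel. s3 z)"
    using c3 by (simp_all add: t3_def[abs_def] s3_def[abs_def])
  have WV: "W r * (1 + a * r\<^sup>2) = 1 / (1 + r\<^sup>2)" "W r * (1 + r\<^sup>2) = 1 / (1 + a * r\<^sup>2)" for r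
    using n[of r] by (simp_all add: W_def)
  then have WVc: "complex_of_real (W r) * of_real (1 + a * r\<^sup>2) = of_real (1 / (1 + r\<^sup>2))"
    "complex_of_real (W r) * of_real (1 + r\<^sup>2) = of_real (1 / (1 + a * r\<^sup>2))" for r
    by (simp_all only: of_real_mult[symmetric])
  have pi: "complex_of_real p * of_real i = 1" using p by (simp add: i_def)
  have alg1: "F * U * (I * (- (P * iz) * (K0 * L * G - K0 * X - K1 * (A * R) * Y) * E)) =
     - K0 * E * (F * G * iz * V) + K0 * E * (F * X * iz * U) + K1 * E * A * (F * Y * iz * (R * U))"
    if "P * I = 1" "U * L = V" for F U I P iz K0 L G X K1 A R Y E V :: complex
    using that by algebra
  have lhs: "half_integrand p \<psi>1 (Hplus N \<psi>2) z =
    - of_real k0 * inverse (of_real d) * t1 z + of_real k0 * inverse (of_real d) * t2 z + of_real k1 * inverse (of_real d) * of_real a * t3 z"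
    if z: "z \<noteq> 0" for z
  proof -
    have z': "of_real (inverse p) * z \<noteq> 0" using z p by simp
    have 1: "inverse (of_real (inverse p) * z) = of_real p * inverse z" by simp
    have 2: "norm (of_real (inverse p) * z) = i * norm z" using i by (simp add: norm_mult i_def[symmetric])
    have 3: "of_real p * (of_real (inverse p) * z) = z" using p by simp
    have 4: "sgn (of_real (inverse p) * z) = sgn z" using i by (simp add: sgn_eq norm_mult i_def[symmetric])
    have 5: "(inverse p * norm z)\<^sup>2 = a * (norm z)\<^sup>2" by (simp add: a(2) i_def power_mult_distrib)
    have "Hplus N \<psi>2 p (of_real (inverse p) * z) = - (of_real p * inverse z) *
      (of_real (k0 * (1 + a * (norm z)\<^sup>2)) * g z
       - of_real k0 * phase_ext g (i * norm z) (of_real i * sgn z)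
       - of_real (k1 * (a * (norm z)\<^sup>2)) * phase_ext g (i * norm z) (of_real p * sgn z)) * inverse (of_real d)"
      by (subst Hplus_eq[of p \<psi>2]) (use p z' adm in \<open>simp_all only: not_False_eq_True 1 2 3 4 5 k0_def k1_def d_def g_def i_def divide_inverse\<close>)
    then show ?thesis
      unfolding half_integrand_def a_def[symmetric] W_def[symmetric] f_def[symmetric] t1_def t2_def t3_def
      unfolding i_def[symmetric] by (simp only: of_real_mult) (rule alg1[OF pi WVc(1)])
  qed
  have alg2: "(iz * (K0 * L * F - K1 * R * Y - K0 * X) * (- E)) * U * (I * G) =
     - K0 * E * I * (F * G * iz * V) + K0 * E * I * (X * G * iz * U) + K1 * E * I * (Y * G * iz * (R * U))"
    if "U * L = V" for F U I iz K0 L G X K1 R Y E V :: complex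
    unfolding that[symmetric] by (simp add: algebra_simps)
  have rhs: "half_integrand p (Hminus N \<psi>1) \<psi>2 z =
    - of_real k0 * inverse (of_real d) * of_real i * s1 z + of_real k0 * inverse (of_real d) * of_real i * s2 z + of_real k1 * inverse (of_real d) * of_real i * s3 z"
    if z: "z \<noteq> 0" for z
  proof -
    \<comment> \<open>Evaluation at \<open>inverse p\<close> negates the exponents in
      \<open>Hminus\<close> and turns them into those of \<open>Hplus\<close> at \<open>p\<close>.
      It also reverses the sign of the denominator, which accounts for the minus sign in front of
      \<open>Hplus\<close>.\<close>
    have e: "inverse p powr (N / 2) = k0" "inverse p powr (- 3 * N / 2) = k1"
      using p by (simp_all add: inverse_powr k0_def k1_def)
    have d: "inverse (of_real (inverse p - p)) = - inverse (of_real d :: complex)"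
      unfolding d_def by (simp flip: inverse_minus_eq)
    have "Hminus N \<psi>1 (inverse p) z = inverse (cnj z) *
      (of_real (k0 * (1 + (norm z)\<^sup>2)) * f (of_real i * z)
       - of_real (k1 * (norm z)\<^sup>2) * phase_ext f (norm z) (of_real p * sgn z)
       - of_real k0 * phase_ext f (norm z) (of_real i * sgn z)) * (- inverse (of_real d))"
      by (subst Hminus_eq[of "inverse p" \<psi>1]) (use p z adm in \<open>simp_all only: e inverse_inverse_eq f_def i_def divide_inverse[of _ "complex_of_real (inverse p - p)"] d\<close>, simp_all)
    then have "cnj (Hminus N \<psi>1 (inverse p) z) = inverse z *
      (of_real (k0 * (1 + (norm z)\<^sup>2)) * cnj (f (of_real i * z))
       - of_real (k1 * (norm z)\<^sup>2) * cnj (phase_ext f (norm z) (of_real p * sgn z))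
       - of_real k0 * cnj (phase_ext f (norm z) (of_real i * sgn z))) * (- inverse (of_real d))"
      by simp
    then show ?thesis
      unfolding half_integrand_def a_def[symmetric] W_def[symmetric] g_def[symmetric] i_def[symmetric] s1_def s2_def s3_def
      by (simp only: of_real_mult) (rule alg2[OF WVc(2)])
  qed
  have ae: "AE z in lborel. (z::complex) \<noteq> 0" by (rule AE_lborel_singleton)
  have int: "integrable lborel (half_integrand p \<psi>1 (Hplus N \<psi>2))" 
    by (rule integrable_half_bounded_tame, rule p(1), rule bd(1), rule Hplus_tame_ne1) (use p adm in auto)
  have tm: "tame (Hminus N \<psi>1 (inverse p))" by (rule Hminus_tame_ne1) (use p adm in auto)
  have bd2: "bounded_off_pole (\<psi>2 (inverse (inverse p)))" using bd by simp
  have int2: "integrable lborel (half_integrand p (Hminus N \<psi>1) \<psi>2)"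
    using integrable_half_swap[OF i(1), of \<psi>2 "Hminus N \<psi>1"]
      integrable_half_bounded_tame[OF i(1), of \<psi>2 "Hminus N \<psi>1"] bd2 tm p by (simp add: i_def)
  have int0: "integrable lborel (half_integrand p \<psi>1 \<psi>2)"
    by (rule integrable_half_bounded_tame, rule p(1), rule bd(1), rule bounded_imp_tame, rule bd(2))
  have "(LINT z|lborel. half_integrand p \<psi>1 (Hplus N \<psi>2) z)
    = (LINT z|lborel. - of_real k0 * inverse (of_real d) * t1 z + of_real k0 * inverse (of_real d) * t2 z + of_real k1 * inverse (of_real d) * of_real a * t3 z)"
  proof (rule integral_cong_AE)
    show "half_integrand p \<psi>1 (Hplus N \<psi>2) \<in> borel_measurable lborel" using int by auto
    show "(\<lambda>z. - of_real k0 * inverse (of_real d) * t1 z + of_real k0 * inverse (of_real d) * t2 z + of_real k1 * inverse (of_real d) * of_real a * t3 z) \<in> borel_measurable lborel"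
      using i1 I2 I3 by (intro borel_measurable_add borel_measurable_times borel_measurable_const borel_measurable_integrable)
    show "AE z in lborel. half_integrand p \<psi>1 (Hplus N \<psi>2) z = - of_real k0 * inverse (of_real d) * t1 z + of_real k0 * inverse (of_real d) * t2 z + of_real k1 * inverse (of_real d) * of_real a * t3 z"
      using ae by eventually_elim (rule lhs)
  qed
  also have "\<dots> = - of_real k0 * inverse (of_real d) * (LINT z|lborel. t1 z) + of_real k0 * inverse (of_real d) * (LINT z|lborel. t2 z) + of_real k1 * inverse (of_real d) * of_real a * (LINT z|lborel. t3 z)"
    using i1 I2(1) I3(1) by (simp only: Bochner_Integration.integral_add integrable_mult_right Bochner_Integration.integrable_add integral_mult_right_zero)
  \<comment> \<open>All three terms acquire the same factor \<open>i\<close>: the first two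
    directly, the third because \<open>a * p = i\<close>, where \<open>a = i^2\<close> is left over
    from the dilated \<open>(norm z)^2\<close> and \<open>p\<close> comes from the contour
    shift.\<close>
  also have "\<dots> = - of_real k0 * inverse (of_real d) * of_real i * (LINT z|lborel. s1 z) + of_real k0 * inverse (of_real d) * of_real i * (LINT z|lborel. s2 z) + of_real k1 * inverse (of_real d) * of_real i * (LINT z|lborel. s3 z)"
    unfolding I1 I2(3) I3(3) a(2) using p by (simp add: i_def power2_eq_square)
  also have "\<dots> = (LINT z|lborel. - of_real k0 * inverse (of_real d) * of_real i * s1 z + of_real k0 * inverse (of_real d) * of_real i * s2 z + of_real k1 * inverse (of_real d) * of_real i * s3 z)"
    using j1 I2(2) I3(2) by (simp only: Bochner_Integration.integral_add integrable_mult_right Bochner_Integration.integrable_add integral_mult_right_zero)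
  also have "\<dots> = (LINT z|lborel. half_integrand p (Hminus N \<psi>1) \<psi>2 z)"
  proof (rule integral_cong_AE)
    show "half_integrand p (Hminus N \<psi>1) \<psi>2 \<in> borel_measurable lborel" using int2 by auto
    show "(\<lambda>z. - of_real k0 * inverse (of_real d) * of_real i * s1 z + of_real k0 * inverse (of_real d) * of_real i * s2 z + of_real k1 * inverse (of_real d) * of_real i * s3 z) \<in> borel_measurable lborel"
      using j1 I2 I3 by (intro borel_measurable_add borel_measurable_times borel_measurable_const borel_measurable_integrable)
    show "AE z in lborel. - of_real k0 * inverse (of_real d) * of_real i * s1 z + of_real k0 * inverse (of_real d) * of_real i * s2 z + of_real k1 * inverse (of_real d) * of_real i * s3 z = half_integrand p (Hminus N \<psi>1) \<psi>2 z"
      using ae by eventually_elim (rule rhs[symmetric])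
  qed
  finally show "integrable lborel (half_integrand p \<psi>1 \<psi>2) \<and>
     integrable lborel (half_integrand p \<psi>1 (Hplus N \<psi>2)) \<and> integrable lborel (half_integrand p (Hminus N \<psi>1) \<psi>2) \<and>
     (LINT z|lborel. half_integrand p \<psi>1 (Hplus N \<psi>2) z) = (LINT z|lborel. half_integrand p (Hminus N \<psi>1) \<psi>2 z)"
    using int0 int int2 by blast
qed

lemma bounded_off_pole_const: "bounded_off_pole (\<lambda>_. c)"
  unfolding bounded_off_pole_def by auto

lemma bounded_off_pole_cnj: "bounded_off_pole f \<Longrightarrow> bounded_off_pole (\<lambda>z. cnj (f z))"
  unfolding bounded_off_pole_def by (auto intro!: continuous_intros)

lemma bounded_off_pole_add:
  assumes "bounded_off_pole f" "bounded_off_pole g"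
  shows "bounded_off_pole (\<lambda>z. f z + g z)"
proof -
  obtain B C where "\<And>z. z \<noteq> 0 \<Longrightarrow> norm (f z) \<le> B" "\<And>z. z \<noteq> 0 \<Longrightarrow> norm (g z) \<le> C"
    using assms unfolding bounded_off_pole_def by blast
  then have "norm (f z + g z) \<le> B + C" if "z \<noteq> 0" for z using that by (meson add_mono norm_triangle_le)
  then show ?thesis using assms unfolding bounded_off_pole_def by (auto intro!: continuous_intros)
qed

lemma bounded_off_pole_mult:
  assumes "bounded_off_pole f" "bounded_off_pole g"
  shows "bounded_off_pole (\<lambda>z. f z * g z)"
proof -
  obtain B C where B: "\<And>z. z \<noteq> 0 \<Longrightarrow> norm (f z) \<le> B" and C: "\<And>z. z \<noteq> 0 \<Longrightarrow> norm (g z) \<le> C"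
    using assms unfolding bounded_off_pole_def by blast
  have "0 \<le> B" using B[of 1] by (auto intro: order_trans[OF norm_ge_zero])
  then have "norm (f z * g z) \<le> B * C" if "z \<noteq> 0" for z
    using B[OF that] C[OF that] by (auto simp: norm_mult intro!: mult_mono)
  then show ?thesis using assms unfolding bounded_off_pole_def by (auto intro!: continuous_intros)
qed

lemma bounded_off_pole_diff:
  assumes "bounded_off_pole f" "bounded_off_pole g"
  shows "bounded_off_pole (\<lambda>z. f z - g z)"
  using bounded_off_pole_add[OF assms(1) bounded_off_pole_mult[OF bounded_off_pole_const[of "- 1"] assms(2)]] by simp

lemmas bounded_off_pole_intros = bounded_off_pole_const bounded_off_pole_cnj bounded_off_pole_add
  bounded_off_pole_mult bounded_off_pole_diff

section \<open>Derivatives along circles and rays; self-adjointness of \<open>H3\<close>\<close>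

lemma admissible_has_derivative:
  assumes "admissible f" "z \<noteq> 0"
  shows "(f has_derivative frechet_derivative f (at z)) (at z)"
  using assms frechet_derivative_works unfolding admissible_def by blast

text \<open>The direction \<open>\<i> * z\<close> is tangent to the circle through \<open>z\<close>
  and the direction \<open>z\<close> to the ray, so these are the angular and the Euler derivative
  in terms of T and Tbar. Only real linearity of the derivative is available.\<close>

lemma frechet_derivative_T_Tbar:
  assumes "f differentiable (at z)"
  shows "frechet_derivative f (at z) (\<i> * z) = \<i> * (T_op f z - Tbar_op f z)"
    and "frechet_derivative f (at z) z = T_op f z + Tbar_op f z"
proof -
  let ?L = "frechet_derivative f (at z)"
  have lin: "linear ?L" using assms linear_frechet_derivative by blast
  have L: "?L w = of_real (Re w) * ?L 1 + of_real (Im w) * ?L \<i>" for w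
  proof -
    have "w = Re w *\<^sub>R 1 + Im w *\<^sub>R \<i>" by (simp add: complex_eq_iff)
    then have "?L w = ?L (Re w *\<^sub>R 1 + Im w *\<^sub>R \<i>)" by (rule arg_cong)
    also have "\<dots> = Re w *\<^sub>R ?L 1 + Im w *\<^sub>R ?L \<i>" using lin by (simp add: linear_add linear_scale)
    finally show ?thesis by (simp add: scaleR_conv_of_real)
  qed
  have z: "z = of_real (Re z) + \<i> * of_real (Im z)" "cnj z = of_real (Re z) - \<i> * of_real (Im z)"
    by (auto simp: complex_eq_iff)
  have r: "T_op f z = (of_real (Re z) + \<i> * of_real (Im z)) * ((?L 1 - \<i> * ?L \<i>) / 2)"
    "Tbar_op f z = (of_real (Re z) - \<i> * of_real (Im z)) * ((?L 1 + \<i> * ?L \<i>) / 2)"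
    unfolding T_op_def Tbar_op_def by (simp_all flip: z)
  have alg1: "- y * a + x * b = \<i> * ((x + \<i> * y) * ((a - \<i> * b) / 2) - (x - \<i> * y) * ((a + \<i> * b) / 2))"
    "x * a + y * b = (x + \<i> * y) * ((a - \<i> * b) / 2) + (x - \<i> * y) * ((a + \<i> * b) / 2)" for x y a b :: complex
    by (simp_all add: field_simps)
  show "?L (\<i> * z) = \<i> * (T_op f z - Tbar_op f z)"
    unfolding r by (subst L) (use alg1(1) in simp)
  show "?L z = T_op f z + Tbar_op f z"
    unfolding r by (subst L) (rule alg1(2))
qed

lemma circle_derivative:
  assumes f: "admissible f" and r: "r > 0"
  shows "((\<lambda>\<phi>. f (of_real r * cis \<phi>)) has_vector_derivative
    \<i> * (T_op f (of_real r * cis \<phi>) - Tbar_op f (of_real r * cis \<phi>))) (at \<phi> within S)"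
proof -
  let ?z = "of_real r * cis \<phi>"
  have z: "?z \<noteq> 0" using r by simp
  have "(cis has_vector_derivative \<i> * cis \<phi>) (at \<phi> within S)"
  proof -
    have "((\<lambda>w. exp (\<i> * w)) has_field_derivative \<i> * exp (\<i> * of_real \<phi>)) (at (of_real \<phi>))"
      by (auto intro!: derivative_eq_intros)
    from has_vector_derivative_real_field[OF this] show ?thesis by (simp add: cis_conv_exp[abs_def])
  qed
  then have "((\<lambda>\<phi>. of_real r * cis \<phi>) has_vector_derivative \<i> * ?z) (at \<phi> within S)"
    by (auto intro!: derivative_eq_intros)
  from vector_derivative_diff_chain_within[OF this has_derivative_at_withinI[OF admissible_has_derivative[OF f z]]]
  show ?thesis using f z by (simp add: o_def frechet_derivative_T_Tbar(1) admissible_def)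
qed

lemma ray_derivative:
  assumes f: "admissible f" and u: "norm u = 1" and s: "s > 0"
  shows "((\<lambda>s. f (of_real s * u)) has_vector_derivative
    (T_op f (of_real s * u) + Tbar_op f (of_real s * u)) / of_real s) (at s)"
proof -
  let ?z = "of_real s * u"
  have z: "?z \<noteq> 0" using s u by auto
  have l: "linear (frechet_derivative f (at ?z))"
    using f z by (auto simp: admissible_def intro!: linear_frechet_derivative)
  have "((\<lambda>s. of_real s * u) has_vector_derivative u) (at s)"
    by (auto intro!: derivative_eq_intros simp: has_vector_derivative_def scaleR_conv_of_real)
  from vector_derivative_diff_chain_within[OF this has_derivative_at_withinI[OF admissible_has_derivative[OF f z]]]
  have "((\<lambda>s. f (of_real s * u)) has_vector_derivative frechet_derivative f (at ?z) u) (at s)"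
    by (simp add: o_def)
  moreover have "frechet_derivative f (at ?z) u = (T_op f ?z + Tbar_op f ?z) / of_real s"
  proof -
    have "frechet_derivative f (at ?z) ?z = of_real s * frechet_derivative f (at ?z) u"
      using linear_scale[OF l, of s u] by (simp add: scaleR_conv_of_real)
    then show ?thesis using frechet_derivative_T_Tbar(2)[of f ?z] f z s
      by (simp add: admissible_def field_simps)
  qed
  ultimately show ?thesis by simp
qed

lemma circle_parts:
  fixes h h' :: "real \<Rightarrow> complex"
  assumes "\<And>\<phi>. (h has_vector_derivative h' \<phi>) (at \<phi>)" "h (2 * pi) = h 0"
  shows "(h' has_integral 0) {0..2*pi}"
proof -
  have "(h' has_integral (h (2*pi) - h 0)) {0..2*pi}"
    by (rule fundamental_theorem_of_calculus) (auto intro: has_vector_derivative_at_within assms)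
  then show ?thesis using assms by simp
qed

lemma H3_bounded: "admissible (\<psi> p) \<Longrightarrow> bounded_off_pole (H3 N \<psi> p)"
  using bounded_off_pole_diff[OF bounded_off_pole_diff bounded_off_pole_mult[OF bounded_off_pole_const]]
    admissible_T_bounded admissible_bounded by (fastforce simp: H3_def[abs_def])

text \<open>\<open>H3\<close> contains no power of q and differentiates along circles only, where
  the weight is constant and the dilation commutes with rotation. So q = 1 is no special case: the
  two integrands differ by a total derivative in the angle.\<close>

lemma half_adjoint_H3:
  assumes p: "p > 0"
  shows "half_adjoint p (H3 N) (H3 N)"
  unfolding half_adjoint_def
proof (intro allI impI, elim conjE)
  fix \<psi>1 \<psi>2 :: wavefun
  assume adm: "\<forall>p>0. admissible (\<psi>1 p)" "\<forall>p>0. admissible (\<psi>2 p)"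
  define f g i where "f = \<psi>1 (inverse p)" and "g = \<psi>2 p" and "i = inverse p"
  have i: "i > 0" using p by (simp add: i_def)
  have af: "admissible f" and ag: "admissible g" using adm p by (auto simp: f_def g_def)
  have bf: "bounded_off_pole (\<psi>1 (inverse p))" "bounded_off_pole (H3 N \<psi>1 (inverse p))"
    and bg: "bounded_off_pole (\<psi>2 p)" "bounded_off_pole (H3 N \<psi>2 p)"
    using adm p by (auto intro!: admissible_bounded H3_bounded)
  have int: "integrable lborel (half_integrand p \<psi>1 \<psi>2)"
    "integrable lborel (half_integrand p \<psi>1 (H3 N \<psi>2))" "integrable lborel (half_integrand p (H3 N \<psi>1) \<psi>2)"
    by (intro integrable_half_bounded_tame p bounded_imp_tame bf bg)+
  have cont: "continuous_on (- {0}) (half_integrand p \<psi>1 (H3 N \<psi>2))" "continuous_on (- {0}) (half_integrand p (H3 N \<psi>1) \<psi>2)"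
    using bf bg unfolding bounded_off_pole_def by (intro continuous_half_integrand p; blast)+
  define D where "D f z = T_op f z - Tbar_op f z" for f z
  have bD: "bounded_off_pole (D f)" if "admissible f" for f
    unfolding D_def[abs_def] by (intro bounded_off_pole_diff admissible_T_bounded that)
  have "(LINT z|lborel. half_integrand p \<psi>1 (H3 N \<psi>2) z) = (LINT z|lborel. half_integrand p (H3 N \<psi>1) \<psi>2 z)"
  proof (rule integral_eq_circlewise[OF int(2) cont(1) int(3) cont(2)])
    fix r :: real assume r: "r > 0"
    have ir: "i * r > 0" using i r by simp
    let ?z = "\<lambda>\<phi>. of_real r * cis \<phi>" and ?w = "\<lambda>\<phi>. of_real (i * r) * cis \<phi>"
    have d: "((\<lambda>\<phi>. cnj (f (?z \<phi>)) * g (?w \<phi>)) has_vector_derivative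
      cnj (f (?z \<phi>)) * (\<i> * D g (?w \<phi>)) + cnj (\<i> * D f (?z \<phi>)) * g (?w \<phi>)) (at \<phi>)" for \<phi>
      unfolding D_def
      by (intro has_vector_derivative_mult has_vector_derivative_cnj circle_derivative af ag r ir)
    have z: "((\<lambda>\<phi>. cnj (f (?z \<phi>)) * (\<i> * D g (?w \<phi>)) + cnj (\<i> * D f (?z \<phi>)) * g (?w \<phi>)) has_integral 0) {0..2*pi}"
      by (rule circle_parts[OF d]) simp
    define K where "K = complex_of_real (i / ((1 + r\<^sup>2) * (1 + p powr (- 2) * r\<^sup>2)))"
    have e: "half_integrand p \<psi>1 (H3 N \<psi>2) (?z \<phi>) = half_integrand p (H3 N \<psi>1) \<psi>2 (?z \<phi>)
       + \<i> * K * (cnj (f (?z \<phi>)) * (\<i> * D g (?w \<phi>)) + cnj (\<i> * D f (?z \<phi>)) * g (?w \<phi>))" for \<phi>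
    proof -
      have n: "norm (?z \<phi>) = r" using r by (simp add: norm_mult)
      have w: "of_real (inverse p) * ?z \<phi> = ?w \<phi>" by (simp add: i_def mult.assoc)
      have H: "H3 N \<psi>2 p (?w \<phi>) = - D g (?w \<phi>) - of_real N * g (?w \<phi>)"
        "H3 N \<psi>1 (inverse p) (?z \<phi>) = - D f (?z \<phi>) - of_real N * f (?z \<phi>)"
        by (simp_all add: H3_def D_def f_def g_def)
      have K': "of_real (1 / ((1 + r\<^sup>2) * (1 + p powr (- 2) * r\<^sup>2))) * (of_real (inverse p) * X) = K * X" for X
        by (simp add: K_def i_def)
      have alg: "F * (K * (- Dg - n * G)) = (- Df - n * F) * (K * G) + \<i> * K * (F * (\<i> * Dg) + (- \<i> * Df) * G)" for F Dg n G Df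
        by (simp add: algebra_simps)
      show ?thesis
        unfolding half_integrand_def n w H mult.assoc[of "cnj _" "of_real _"] K' f_def[symmetric] g_def[symmetric]
        using alg[of "cnj (f (?z \<phi>))" "D g (?w \<phi>)" "of_real N" "g (?w \<phi>)" "cnj (D f (?z \<phi>))"] by simp
    qed
    have ci: "(\<lambda>\<phi>. half_integrand p (H3 N \<psi>1) \<psi>2 (?z \<phi>)) integrable_on {0..2*pi}"
      by (intro integrable_continuous_real continuous_on_circle cont r)
    show "integral {0..2*pi} (\<lambda>\<phi>. half_integrand p \<psi>1 (H3 N \<psi>2) (?z \<phi>)) = integral {0..2*pi} (\<lambda>\<phi>. half_integrand p (H3 N \<psi>1) \<psi>2 (?z \<phi>))"
      unfolding e using has_integral_add[OF integrable_integral[OF ci] has_integral_mult_right[OF z, of "\<i> * K"]]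
      by (simp add: integral_unique)
  qed
  then show "integrable lborel (half_integrand p \<psi>1 \<psi>2) \<and> integrable lborel (half_integrand p \<psi>1 (H3 N \<psi>2)) \<and>
     integrable lborel (half_integrand p (H3 N \<psi>1) \<psi>2) \<and>
     (LINT z|lborel. half_integrand p \<psi>1 (H3 N \<psi>2) z) = (LINT z|lborel. half_integrand p (H3 N \<psi>1) \<psi>2 z)"
    using int by blast
qed

section \<open>The ladder operators at q = 1\<close>

lemma Hplus_at_1: "Hplus N \<psi> 1 z = - inverse z * T_op (\<psi> 1) z - cnj z * (Tbar_op (\<psi> 1) z - of_real N * \<psi> 1 z)"
  by (simp add: Hplus_def qnum_T_def qnum_Tbar_def qpow_def)

lemma Hminus_at_1: "Hminus N \<psi> 1 z = z * (T_op (\<psi> 1) z + of_real N * \<psi> 1 z) + inverse (cnj z) * Tbar_op (\<psi> 1) z"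
  by (simp add: Hminus_def qnum_T_def qnum_Tbar_def qpow_def)

lemma tame_sum:
  assumes a: "bounded_off_pole a" and b: "bounded_off_pole b"
    and h: "continuous_on (- {0}) h" "\<And>z. z \<noteq> 0 \<Longrightarrow> norm (h z) = 1 / norm z"
    and k: "continuous_on (- {0}) k" "\<And>z. z \<noteq> 0 \<Longrightarrow> norm (k z) = norm z"
  shows "tame (\<lambda>z. h z * a z + k z * b z)"
proof -
  obtain A B where A: "\<And>z. z \<noteq> 0 \<Longrightarrow> norm (a z) \<le> A" and B: "\<And>z. z \<noteq> 0 \<Longrightarrow> norm (b z) \<le> B"
    using a b unfolding bounded_off_pole_def by blast
  have AB: "0 \<le> A" "0 \<le> B" using A[of 1] B[of 1] by (auto intro: order_trans[OF norm_ge_zero])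
  have "norm (h z * a z + k z * b z) \<le> (A + B) * ((1 + (norm z)\<^sup>2) / norm z)" if z: "z \<noteq> 0" for z
  proof -
    have "norm (h z * a z + k z * b z) \<le> 1 / norm z * A + norm z * B"
    proof -
      have "norm (h z * a z) \<le> 1 / norm z * A" "norm (k z * b z) \<le> norm z * B"
        unfolding norm_mult h(2)[OF z] k(2)[OF z] using mult_left_mono[OF A[OF z], of "1 / norm z"] mult_left_mono[OF B[OF z], of "norm z"] by auto
      then show ?thesis by (intro norm_triangle_le add_mono)
    qed
    also have "\<dots> = (A + B * (norm z)\<^sup>2) / norm z" using z by (simp add: field_simps power2_eq_square)
    also have "\<dots> \<le> ((A + B) * (1 + (norm z)\<^sup>2)) / norm z"
      using AB by (intro divide_right_mono) (auto simp: algebra_simps)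
    finally show ?thesis by simp
  qed
  then show ?thesis using a b h k unfolding tame_def bounded_off_pole_def
    by (auto intro!: continuous_intros)
qed

lemma Hplus_tame_1:
  assumes "admissible (\<psi> 1)"
  shows "tame (Hplus N \<psi> 1)"
proof -
  have "tame (\<lambda>z. inverse z * (- 1 * T_op (\<psi> 1) z) + cnj z * (- 1 * (Tbar_op (\<psi> 1) z - of_real N * \<psi> 1 z)))"
  proof (rule tame_sum)
    show "bounded_off_pole (\<lambda>z. - 1 * T_op (\<psi> 1) z)"
      "bounded_off_pole (\<lambda>z. - 1 * (Tbar_op (\<psi> 1) z - of_real N * \<psi> 1 z))"
      by (intro bounded_off_pole_intros admissible_T_bounded admissible_bounded assms)+
  qed (auto simp: norm_inverse inverse_eq_divide norm_divide intro!: continuous_intros)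
  moreover have "(\<lambda>z. inverse z * (- 1 * T_op (\<psi> 1) z) + cnj z * (- 1 * (Tbar_op (\<psi> 1) z - of_real N * \<psi> 1 z))) = Hplus N \<psi> 1"
    by (auto simp: Hplus_at_1 algebra_simps)
  ultimately show ?thesis by simp
qed

lemma Hminus_tame_1:
  assumes "admissible (\<psi> 1)"
  shows "tame (Hminus N \<psi> 1)"
proof -
  have "tame (\<lambda>z. inverse (cnj z) * Tbar_op (\<psi> 1) z + z * (T_op (\<psi> 1) z + of_real N * \<psi> 1 z))"
  proof (rule tame_sum)
    show "bounded_off_pole (Tbar_op (\<psi> 1))" "bounded_off_pole (\<lambda>z. T_op (\<psi> 1) z + of_real N * \<psi> 1 z)"
      by (intro bounded_off_pole_intros admissible_T_bounded admissible_bounded assms)+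
  qed (auto simp: norm_inverse inverse_eq_divide norm_divide intro!: continuous_intros)
  moreover have "(\<lambda>z. inverse (cnj z) * Tbar_op (\<psi> 1) z + z * (T_op (\<psi> 1) z + of_real N * \<psi> 1 z)) = Hminus N \<psi> 1"
    by (auto simp: Hminus_at_1 algebra_simps)
  ultimately show ?thesis by simp
qed

lemma set_integrable_Cauchy_density: "set_integrable lborel {0<..} (\<lambda>s::real. 1 / (1 + s\<^sup>2))"
proof -
  have "set_integrable lborel {0..} (\<lambda>s::real. 1 / (1 + s\<^sup>2))"
    unfolding set_integrable_def
  proof (rule integrableI_bounded)
    have "(\<integral>\<^sup>+s. ennreal (norm (indicator {0..} s *\<^sub>R (1 / (1 + (s::real)\<^sup>2)))) \<partial>lborel)
      = (\<integral>\<^sup>+s. ennreal (1 / (1 + 1 * (s::real)\<^sup>2)) * indicator {0..} s \<partial>lborel)"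
      by (intro nn_integral_cong) (auto simp: indicator_def)
    then show "(\<integral>\<^sup>+s. ennreal (norm (indicator {0..} s *\<^sub>R (1 / (1 + (s::real)\<^sup>2)))) \<partial>lborel) < \<infinity>"
      using nn_integral_Cauchy_density[of 1] by simp
  qed measurable
  then show ?thesis by (rule set_integrable_subset) auto
qed

lemma integral_FTC_Ioi:
  fixes f F :: "real \<Rightarrow> 'a :: euclidean_space"
  assumes d: "\<And>s. s > 0 \<Longrightarrow> (F has_vector_derivative f s) (at s)" and c: "continuous_on {0<..} f"
    and i: "set_integrable lborel {0<..} f"
    and l: "(F \<longlongrightarrow> A) (at_right 0)" "(F \<longlongrightarrow> B) at_top"
  shows "(LINT s:{0<..}|lborel. f s) = B - A"
proof -
  have ei: "einterval 0 \<infinity> = {0<..}" by (auto simp: einterval_def)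
  have "(LBINT s=0..\<infinity>. f s) = B - A"
  proof (rule interval_integral_FTC_integrable)
    show "((F \<circ> real_of_ereal) \<longlongrightarrow> A) (at_right 0)" using l(1) by (simp add: ereal_tendsto_simps zero_ereal_def)
    show "((F \<circ> real_of_ereal) \<longlongrightarrow> B) (at_left \<infinity>)" using l(2) by (simp add: ereal_tendsto_simps)
  qed (use i d c in \<open>auto simp: ei continuous_on_eq_continuous_at\<close>)
  then show ?thesis by (simp add: interval_lebesgue_integral_def ei)
qed

text \<open>Here \<open>h'\<close> is the Euler derivative, s times the usual one. The integrand is
  the derivative of s/(1 + s^2) times \<open>h\<close>, which tends to 0 at both ends because
  \<open>h\<close> is bounded.\<close>

lemma ray_parts:
  fixes h h' :: "real \<Rightarrow> complex"
  assumes d: "\<And>s. s > 0 \<Longrightarrow> (h has_vector_derivative h' s / of_real s) (at s)"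
    and c: "continuous_on {0<..} h'"
    and b: "\<And>s. s > 0 \<Longrightarrow> norm (h s) \<le> B" "\<And>s. s > 0 \<Longrightarrow> norm (h' s) \<le> B'"
  shows "(LINT s:{0<..}|lborel. h' s / of_real (1 + s\<^sup>2) + of_real ((1 - s\<^sup>2) / (1 + s\<^sup>2)\<^sup>2) * h s) = 0"
proof -
  define f where "f s = h' s / of_real (1 + s\<^sup>2) + of_real ((1 - s\<^sup>2) / (1 + s\<^sup>2)\<^sup>2) * h s" for s
  define F where "F s = of_real (s / (1 + s\<^sup>2)) * h s" for s
  have ch: "continuous_on {0<..} h"
    by (rule continuous_on_vector_derivative[where f' = "\<lambda>s. h' s / of_real s"])
      (auto intro: has_vector_derivative_at_within d)
  have n: "1 + s\<^sup>2 > 0" for s :: real by (simp add: add_pos_nonneg)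
  have nz: "complex_of_real (1 + s\<^sup>2) \<noteq> 0" for s using n[of s] by (metis of_real_eq_0_iff less_irrefl)
  have cf: "continuous_on {0<..} f"
    unfolding f_def
    by (intro continuous_intros ch c) (use n nz in \<open>auto simp del: of_real_add of_real_power simp: less_le\<close>)
  have fi: "set_integrable lborel {0<..} f"
  proof (rule set_integrable_bound)
    show "set_integrable lborel {0<..} (\<lambda>s. (B' + B) * (1 / (1 + s\<^sup>2)))"
      by (intro set_integrable_mult_right set_integrable_Cauchy_density)
    show "set_borel_measurable lborel {0<..} f"
      using borel_measurable_continuous_on_indicator[OF _ cf] by (simp add: set_borel_measurable_def)
    have "norm (f s) \<le> norm ((B' + B) * (1 / (1 + s\<^sup>2)))" if s: "s > 0" for s
    proof -
      have "\<bar>1 - s\<^sup>2\<bar> \<le> 1 + s\<^sup>2" by (simp add: abs_le_iff)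
      then have w: "\<bar>(1 - s\<^sup>2) / (1 + s\<^sup>2)\<^sup>2\<bar> \<le> 1 / (1 + s\<^sup>2)"
        using n[of s] divide_right_mono[of "\<bar>1 - s\<^sup>2\<bar>" "1 + s\<^sup>2" "(1 + s\<^sup>2)\<^sup>2"]
        by (simp add: abs_divide power2_eq_square[of "1 + s\<^sup>2"])
      have "norm (f s) \<le> norm (h' s) / (1 + s\<^sup>2) + \<bar>(1 - s\<^sup>2) / (1 + s\<^sup>2)\<^sup>2\<bar> * norm (h s)"
        unfolding f_def using n[of s]
        by (intro norm_triangle_le) (simp add: norm_mult norm_divide del: of_real_add of_real_power of_real_divide of_real_diff)
      also have "\<dots> \<le> B' / (1 + s\<^sup>2) + 1 / (1 + s\<^sup>2) * B"
        using b[OF s] w n[of s] by (intro add_mono divide_right_mono mult_mono) auto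
      also have "\<dots> \<le> norm ((B' + B) * (1 / (1 + s\<^sup>2)))" by (simp add: add_divide_distrib)
      finally show ?thesis .
    qed
    then show "AE s\<in>{0<..} in lborel. norm (f s) \<le> norm ((B' + B) * (1 / (1 + s\<^sup>2)))" by auto
  qed
  have "(LINT s:{0<..}|lborel. f s) = 0 - 0"
  proof (rule integral_FTC_Ioi)
    fix s :: real assume s: "s > 0"
    have "((\<lambda>s. s / (1 + s\<^sup>2)) has_real_derivative (1 - s\<^sup>2) / (1 + s\<^sup>2)\<^sup>2) (at s)"
      using n[of s] by (auto intro!: derivative_eq_intros simp: power2_eq_square field_simps)
    then have "((\<lambda>s. complex_of_real (s / (1 + s\<^sup>2))) has_vector_derivative of_real ((1 - s\<^sup>2) / (1 + s\<^sup>2)\<^sup>2)) (at s)"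
      by (intro has_vector_derivative_of_real) (simp add: has_real_derivative_iff_has_vector_derivative)
    from has_vector_derivative_mult[OF this d[OF s]]
    show "(F has_vector_derivative f s) (at s)"
      unfolding F_def f_def using s by (simp add: add.commute)
  next
    have B0: "0 \<le> B" using b(1)[of 1] by (auto intro: order_trans[OF norm_ge_zero])
    have bd: "norm (F s) \<le> s / (1 + s\<^sup>2) * B" if "s > 0" for s
      unfolding F_def norm_mult norm_of_real
      using that n[of s] mult_left_mono[OF b(1)[OF that], of "s / (1 + s\<^sup>2)"] by simp
    have "((\<lambda>s. s / (1 + s\<^sup>2) * B) \<longlongrightarrow> 0 / (1 + 0\<^sup>2) * B) (at_right 0)"
      by (intro tendsto_intros) auto
    then have l0: "((\<lambda>s. s / (1 + s\<^sup>2) * B) \<longlongrightarrow> 0) (at_right 0)" by simp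
    have "\<forall>\<^sub>F s in at_right 0. norm (F s) \<le> s / (1 + s\<^sup>2) * B"
      by (rule eventually_mono[OF eventually_at_right_less[of 0]]) (rule bd)
    from Lim_null_comparison[OF this l0] show "(F \<longlongrightarrow> 0) (at_right 0)" .
    have "((\<lambda>s::real. inverse s * B) \<longlongrightarrow> 0 * B) at_top"
      by (intro tendsto_mult tendsto_inverse_0_at_top filterlim_ident tendsto_const)
    moreover have "s / (1 + s\<^sup>2) * B \<le> inverse s * B" if "s > 0" for s
      using that B0 n[of s] by (intro mult_right_mono) (auto simp: field_simps power2_eq_square)
    ultimately have l1: "((\<lambda>s. inverse s * B) \<longlongrightarrow> 0) at_top"
      and le: "\<And>s. s > 0 \<Longrightarrow> norm (F s) \<le> inverse s * B" using bd order_trans by (simp, blast)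
    have "\<forall>\<^sub>F s in at_top. norm (F s) \<le> inverse s * B"
      by (rule eventually_mono[OF eventually_gt_at_top[of 0]]) (rule le)
    from Lim_null_comparison[OF this l1] show "(F \<longlongrightarrow> 0) at_top" .
  qed (rule cf fi)+
  then show ?thesis by (simp add: f_def)
qed

text \<open>For \<open>q = 1\<close> the difference of the two sides is a divergence: its radial part (\<open>f1\<close>) and its angular
  part (\<open>f2\<close>), integrated by parts, give opposite multiples of the integral of \<open>f0\<close>.\<close>

lemma half_adjoint_Hplus_1: "half_adjoint 1 (Hplus N) (Hminus N)"
  unfolding half_adjoint_def
proof (intro allI impI, elim conjE)
  fix \<psi>1 \<psi>2 :: wavefun
  assume adm: "\<forall>p>0. admissible (\<psi>1 p)" "\<forall>p>0. admissible (\<psi>2 p)"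
  define f g where "f = \<psi>1 1" and "g = \<psi>2 1"
  have af: "admissible f" and ag: "admissible g" using adm by (auto simp: f_def g_def)
  have bf: "bounded_off_pole (\<psi>1 (inverse 1))" and bg: "bounded_off_pole (\<psi>2 1)"
    using admissible_bounded[OF af] admissible_bounded[OF ag] by (simp_all add: f_def g_def)
  have int0: "integrable lborel (half_integrand 1 \<psi>1 \<psi>2)"
    by (rule integrable_half_bounded_tame) (use bf bg bounded_imp_tame in auto)
  have intp: "integrable lborel (half_integrand 1 \<psi>1 (Hplus N \<psi>2))"
    by (rule integrable_half_bounded_tame) (use bf Hplus_tame_1 adm in auto)
  have intm: "integrable lborel (half_integrand 1 (Hminus N \<psi>1) \<psi>2)"
  proof -
    have "integrable lborel (half_integrand 1 \<psi>2 (Hminus N \<psi>1))"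
      by (rule integrable_half_bounded_tame) (use bg Hminus_tame_1 adm in auto)
    from integrable_half_swap[OF _ this] show ?thesis by simp
  qed
  \<comment> \<open>\<open>Rh\<close> is the Euler derivative of \<open>h\<close>, and
    \<open>Dh\<close> is its angular derivative divided by \<open>\<i>\<close>.\<close>
  define h Rh Dh where "h z = cnj (f z) * g z"
    and "Rh z = cnj (f z) * (T_op g z + Tbar_op g z) + cnj (T_op f z + Tbar_op f z) * g z"
    and "Dh z = cnj (f z) * (T_op g z - Tbar_op g z) - cnj (T_op f z - Tbar_op f z) * g z" for z
  have bh: "bounded_off_pole h" and bR: "bounded_off_pole Rh" and bD: "bounded_off_pole Dh"
    unfolding h_def[abs_def] Rh_def[abs_def] Dh_def[abs_def]
    by (intro bounded_off_pole_intros admissible_T_bounded admissible_bounded af ag)+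
  have n: "1 + s\<^sup>2 > 0" for s :: real by (simp add: add_pos_nonneg)
  define w where "w z = 1 / (1 + (norm z)\<^sup>2)" for z :: complex
  \<comment> \<open>Up to common factors the derivatives occur as T + r Tbar with r = |z|^2, which
    is half of (1 + r) times the radial plus (1 - r) times the angular part. Against the weight 1/(1
    + r)^2 these coefficients become \<open>w\<close> and \<open>e * w\<close>.\<close>
  define e where "e z = complex_of_real ((1 - (norm z)\<^sup>2) / (1 + (norm z)\<^sup>2))" for z :: complex
  have cw: "continuous_on (- {0}) w" unfolding w_def by (intro continuous_intros) (use n in \<open>auto simp: less_le\<close>)
  have be: "bounded_off_pole e"
    unfolding bounded_off_pole_def
  proof (intro conjI exI allI impI)
    show "continuous_on (- {0}) e" unfolding e_def
      by (intro continuous_on_of_real continuous_intros) (use n in \<open>auto simp: less_le\<close>)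
    show "norm (e z) \<le> 1" for z
    proof -
      have "\<bar>1 - (norm z)\<^sup>2\<bar> \<le> 1 + (norm z)\<^sup>2" by (simp add: abs_le_iff)
      then show ?thesis unfolding e_def norm_of_real abs_divide using n[of "norm z"] by (simp add: divide_le_eq)
    qed
  qed
  have w1: "norm z * (1 + 1 * (norm z)\<^sup>2) * (1 / norm z * w z) \<le> 1" if "z \<noteq> 0" for z
    using weight_bounds(1)[of 1 "norm z"] that by (simp add: w_def)
  have w0: "w z \<ge> 0" for z using n[of "norm z"] by (simp add: w_def)
  define f1 f2 f0 where "f1 z = cnj 1 * Rh z * inverse z * of_real (w z)"
    and "f2 z = cnj 1 * (Dh z * e z) * inverse z * of_real (w z)"
    and "f0 z = cnj 1 * (h z * e z) * inverse z * of_real (w z)" for z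
  note I1 = integrable_bounded_weight[where a = 1, OF _ bounded_off_pole_const[of 1] bR cw w0 w1, folded f1_def]
  note I2 = integrable_bounded_weight[where a = 1, OF _ bounded_off_pole_const[of 1] bounded_off_pole_mult[OF bD be] cw w0 w1, folded f2_def]
  note I0 = integrable_bounded_weight[where a = 1, OF _ bounded_off_pole_const[of 1] bounded_off_pole_mult[OF bh be] cw w0 w1, folded f0_def]
  have i1: "integrable lborel f1" "continuous_on (- {0}) f1" using I1 by (simp_all add: f1_def[abs_def])
  have i2: "integrable lborel f2" "continuous_on (- {0}) f2" using I2 by (simp_all add: f2_def[abs_def])
  have i0: "integrable lborel f0" "continuous_on (- {0}) f0" using I0 by (simp_all add: f0_def[abs_def])
  \<comment> \<open>The total derivative is taken of the product of \<open>h\<close> with the phase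
    \<open>cnj (cis \<phi>)\<close> of \<open>inverse z\<close>; the derivative of that phase
    contributes \<open>f0\<close>.\<close>
  have angular: "(LINT z|lborel. f2 z) = (LINT z|lborel. f0 z)"
  proof (rule integral_eq_circlewise[OF i2 i0])
    fix r :: real assume r: "r > 0"
    let ?z = "\<lambda>\<phi>. of_real r * cis \<phi>"
    have ic: "inverse (cis \<phi>) = cnj (cis \<phi>)" for \<phi> by (rule inverse_unit_complex) simp
    have "((\<lambda>\<phi>. cis \<phi>) has_vector_derivative \<i> * cis \<phi>) (at \<phi>)" for \<phi>
    proof -
      have "((\<lambda>w. exp (\<i> * w)) has_field_derivative \<i> * exp (\<i> * of_real \<phi>)) (at (of_real \<phi>))"
        by (auto intro!: derivative_eq_intros)
      from has_vector_derivative_real_field[OF this] show ?thesis by (simp add: cis_conv_exp[abs_def])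
    qed
    then have d: "((\<lambda>\<phi>. cnj (cis \<phi>) * (cnj (f (?z \<phi>)) * g (?z \<phi>))) has_vector_derivative
      cnj (cis \<phi>) * (cnj (f (?z \<phi>)) * (\<i> * (T_op g (?z \<phi>) - Tbar_op g (?z \<phi>))) + cnj (\<i> * (T_op f (?z \<phi>) - Tbar_op f (?z \<phi>))) * g (?z \<phi>))
        + cnj (\<i> * cis \<phi>) * (cnj (f (?z \<phi>)) * g (?z \<phi>))) (at \<phi>)" for \<phi>
      by (intro has_vector_derivative_mult has_vector_derivative_cnj circle_derivative af ag r)
    have "((\<lambda>\<phi>. cnj (cis \<phi>) * (cnj (f (?z \<phi>)) * (\<i> * (T_op g (?z \<phi>) - Tbar_op g (?z \<phi>))) + cnj (\<i> * (T_op f (?z \<phi>) - Tbar_op f (?z \<phi>))) * g (?z \<phi>))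
        + cnj (\<i> * cis \<phi>) * (cnj (f (?z \<phi>)) * g (?z \<phi>))) has_integral 0) {0..2*pi}"
      by (rule circle_parts[OF d]) simp
    moreover define K where "K = complex_of_real ((1 - r\<^sup>2) / (1 + r\<^sup>2) * (1 / (1 + r\<^sup>2)) / r)"
    ultimately have z: "((\<lambda>\<phi>. (- \<i> * K) * (cnj (cis \<phi>) * (cnj (f (?z \<phi>)) * (\<i> * (T_op g (?z \<phi>) - Tbar_op g (?z \<phi>))) + cnj (\<i> * (T_op f (?z \<phi>) - Tbar_op f (?z \<phi>))) * g (?z \<phi>))
        + cnj (\<i> * cis \<phi>) * (cnj (f (?z \<phi>)) * g (?z \<phi>)))) has_integral (- \<i> * K) * 0) {0..2*pi}"
      by (intro has_integral_mult_right)
    have ew: "e (?z \<phi>) = of_real ((1 - r\<^sup>2) / (1 + r\<^sup>2))" "w (?z \<phi>) = 1 / (1 + r\<^sup>2)" for \<phi>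
      using r by (simp_all add: e_def w_def norm_mult)
    have k: "X * of_real ((1 - r\<^sup>2) / (1 + r\<^sup>2)) * inverse (?z \<phi>) * of_real (1 / (1 + r\<^sup>2)) = K * cnj (cis \<phi>) * X" for X \<phi>
      unfolding K_def inverse_mult_distrib ic by (simp add: divide_inverse)
    have eq: "f2 (?z \<phi>) = f0 (?z \<phi>) + (- \<i> * K) * (cnj (cis \<phi>) * (cnj (f (?z \<phi>)) * (\<i> * (T_op g (?z \<phi>) - Tbar_op g (?z \<phi>))) + cnj (\<i> * (T_op f (?z \<phi>) - Tbar_op f (?z \<phi>))) * g (?z \<phi>))
        + cnj (\<i> * cis \<phi>) * (cnj (f (?z \<phi>)) * g (?z \<phi>)))" for \<phi>
    proof -
      have alg: "k * c * (F * Dg - Df * G) = k * c * (F * G) + (- \<i> * k) * (c * (F * (\<i> * Dg) + (- \<i> * Df) * G) + (- \<i> * c) * (F * G))" for k c F Dg Df G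
        by (simp add: algebra_simps)
      show ?thesis unfolding f2_def f0_def ew complex_cnj_one mult_1 k
        unfolding Dh_def h_def complex_cnj_mult complex_cnj_i by (rule alg)
    qed
    have ci: "(\<lambda>\<phi>. f0 (?z \<phi>)) integrable_on {0..2*pi}"
      by (intro integrable_continuous_real continuous_on_circle i0 r)
    show "integral {0..2*pi} (\<lambda>\<phi>. f2 (?z \<phi>)) = integral {0..2*pi} (\<lambda>\<phi>. f0 (?z \<phi>))"
      unfolding eq using has_integral_add[OF integrable_integral[OF ci] z] by (simp add: integral_unique)
  qed
  \<comment> \<open>The Jacobian \<open>s\<close> reduces \<open>inverse z\<close> to the constant
    \<open>inverse u\<close> on a ray, and \<open>e * w\<close> is the derivative of s/(1 + s^2);
    what remains is the integrand of \<open>ray_parts\<close>.\<close>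
  have radial: "(LINT z|lborel. f1 z + f0 z) = integral\<^sup>L (lborel :: complex measure) (\<lambda>_. 0)"
  proof (rule integral_eq_raywise[where f = "\<lambda>z. f1 z + f0 z" and g = "\<lambda>_. 0"])
    show "integrable lborel (\<lambda>z. f1 z + f0 z)" using i1 i0 by simp
    fix u :: complex assume u: "norm u = 1"
    obtain B where B: "\<And>z. z \<noteq> 0 \<Longrightarrow> norm (h z) \<le> B" using bh by (auto simp: bounded_off_pole_def)
    obtain B' where B': "\<And>z. z \<noteq> 0 \<Longrightarrow> norm (Rh z) \<le> B'" using bR by (auto simp: bounded_off_pole_def)
    have u0: "u \<noteq> 0" using u by auto
    have "(LINT s:{0<..}|lborel. Rh (of_real s * u) / of_real (1 + s\<^sup>2) + of_real ((1 - s\<^sup>2) / (1 + s\<^sup>2)\<^sup>2) * h (of_real s * u)) = 0"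
    proof (rule ray_parts)
      fix s :: real assume s: "s > 0"
      have alg: "X * (a / of_real s) + cnj (b / of_real s) * Y = (X * a + cnj b * Y) / of_real s" for X a b Y
        by (simp add: add_divide_distrib)
      have "((\<lambda>s. cnj (f (of_real s * u)) * g (of_real s * u)) has_vector_derivative
        cnj (f (of_real s * u)) * ((T_op g (of_real s * u) + Tbar_op g (of_real s * u)) / of_real s)
        + cnj ((T_op f (of_real s * u) + Tbar_op f (of_real s * u)) / of_real s) * g (of_real s * u)) (at s)"
        by (intro has_vector_derivative_mult has_vector_derivative_cnj ray_derivative af ag u s)
      then show "((\<lambda>s. h (of_real s * u)) has_vector_derivative Rh (of_real s * u) / of_real s) (at s)"
        unfolding h_def Rh_def alg .
      show "norm (h (of_real s * u)) \<le> B" "norm (Rh (of_real s * u)) \<le> B'" using B B' s u0 by auto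
    next
      show "continuous_on {0<..} (\<lambda>s. Rh (of_real s * u))"
        by (rule continuous_on_compose2[of "- {0}" Rh]) (use bR u0 in \<open>auto simp: bounded_off_pole_def intro!: continuous_intros\<close>)
    qed
    moreover have "s *\<^sub>R (f1 (of_real s * u) + f0 (of_real s * u)) = inverse u *
      (Rh (of_real s * u) / of_real (1 + s\<^sup>2) + of_real ((1 - s\<^sup>2) / (1 + s\<^sup>2)\<^sup>2) * h (of_real s * u))" if s: "s > 0" for s
    proof -
      have e: "e (of_real s * u) = of_real ((1 - s\<^sup>2) / (1 + s\<^sup>2))" "w (of_real s * u) = 1 / (1 + s\<^sup>2)"
        using s u by (simp_all add: e_def w_def norm_mult)
      have k: "of_real s * (X * inverse (of_real s * u) * Y) = inverse u * (X * Y)" for X Y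
        using s u0 by simp
      have m: "complex_of_real ((1 - s\<^sup>2) / (1 + s\<^sup>2)\<^sup>2) = of_real ((1 - s\<^sup>2) / (1 + s\<^sup>2)) * of_real (1 / (1 + s\<^sup>2))"
        by (simp add: power2_eq_square)
      have "of_real s * (f1 (of_real s * u) + f0 (of_real s * u)) = of_real s * (Rh (of_real s * u) * inverse (of_real s * u) * of_real (1 / (1 + s\<^sup>2)))
        + of_real s * ((h (of_real s * u) * of_real ((1 - s\<^sup>2) / (1 + s\<^sup>2))) * inverse (of_real s * u) * of_real (1 / (1 + s\<^sup>2)))"
        unfolding f1_def f0_def e complex_cnj_one mult_1 by (rule distrib_left)
      then show ?thesis
        unfolding scaleR_conv_of_real k m by (simp only: distrib_left of_real_mult of_real_inverse of_real_divide of_real_1 divide_inverse mult_1 mult_ac)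
    qed
    ultimately have "(LINT s:{0<..}|lborel. s *\<^sub>R (f1 (of_real s * u) + f0 (of_real s * u))) = inverse u * 0"
      by (subst set_lebesgue_integral_cong[of _ _ _ "\<lambda>s. inverse u *
      (Rh (of_real s * u) / of_real (1 + s\<^sup>2) + of_real ((1 - s\<^sup>2) / (1 + s\<^sup>2)\<^sup>2) * h (of_real s * u))"]) auto
    then show "(LINT s:{0<..}|lborel. s *\<^sub>R (f1 (of_real s * u) + f0 (of_real s * u))) = (LINT s:{0<..}|lborel. s *\<^sub>R 0)"
      by (simp add: set_lebesgue_integral_def)
  qed simp
  have sum: "(LINT z|lborel. f1 z) + (LINT z|lborel. f2 z) = 0"
    using radial angular i1 i0 by simp
  have pointwise: "half_integrand 1 \<psi>1 (Hplus N \<psi>2) z = half_integrand 1 (Hminus N \<psi>1) \<psi>2 z - (1/2) * (f1 z + f2 z)" if z: "z \<noteq> 0" for z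
  proof -
    define r W where "r = (norm z)\<^sup>2" and "W = complex_of_real (1 / ((1 + r) * (1 + r)))"
    have rp: "1 + complex_of_real r \<noteq> 0" using n[of "norm z"] unfolding r_def
      by (metis of_real_1 of_real_add of_real_eq_0_iff less_irrefl)
    have zc: "cnj z = of_real r * inverse z" using z complex_norm_square[of z] by (simp add: r_def field_simps)
    have one: "of_real (inverse 1) * z = z" by simp
    have w: "of_real (w z) = W * (1 + of_real r)" "e z * of_real (w z) = W * (1 - of_real r)"
      using rp by (simp_all add: w_def e_def W_def r_def[symmetric] divide_simps)
    have l: "half_integrand 1 \<psi>1 (Hplus N \<psi>2) z = cnj (f z) * W *
      (- inverse z * T_op g z - of_real r * inverse z * (Tbar_op g z - of_real N * g z))"
      unfolding half_integrand_def one Hplus_at_1 unfolding W_def zc by (simp add: f_def g_def r_def)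
    have m: "half_integrand 1 (Hminus N \<psi>1) \<psi>2 z =
      (of_real r * inverse z * (cnj (T_op f z) + of_real N * cnj (f z)) + inverse z * cnj (Tbar_op f z)) * W * g z"
    proof -
      have "cnj (Hminus N \<psi>1 1 z) = cnj z * (cnj (T_op f z) + of_real N * cnj (f z)) + inverse z * cnj (Tbar_op f z)"
        unfolding Hminus_at_1 f_def by simp
      then show ?thesis unfolding half_integrand_def one unfolding W_def zc by (simp add: g_def r_def)
    qed
    have f12: "f1 z = Rh z * inverse z * (W * (1 + of_real r))" "f2 z = Dh z * inverse z * (W * (1 - of_real r))"
      unfolding f1_def f2_def w(1)[symmetric] w(2)[symmetric] by (simp_all add: mult_ac)
    have alg: "F * W * (- i * Tg - r * i * (Bg - n * G)) = (r * i * (Tf + n * F) + i * Bf) * W * G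
      - (1/2) * ((F * (Tg + Bg) + (Tf + Bf) * G) * i * (W * (1 + r)) + (F * (Tg - Bg) - (Tf - Bf) * G) * i * (W * (1 - r)))"
      for F W i Tg r Bg n G Tf Bf :: complex by (simp add: field_simps)
    show ?thesis unfolding l m f12 Rh_def Dh_def complex_cnj_add complex_cnj_diff by (rule alg)
  qed
  have "(LINT z|lborel. half_integrand 1 \<psi>1 (Hplus N \<psi>2) z)
    = (LINT z|lborel. half_integrand 1 (Hminus N \<psi>1) \<psi>2 z - (1/2) * (f1 z + f2 z))"
  proof (rule integral_cong_AE)
    have "AE z in lborel. (z::complex) \<noteq> 0" by (rule AE_lborel_singleton)
    then show "AE z in lborel. half_integrand 1 \<psi>1 (Hplus N \<psi>2) z = half_integrand 1 (Hminus N \<psi>1) \<psi>2 z - (1/2) * (f1 z + f2 z)"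
      by eventually_elim (rule pointwise)
    show "(\<lambda>z. half_integrand 1 (Hminus N \<psi>1) \<psi>2 z - (1/2) * (f1 z + f2 z)) \<in> borel_measurable lborel"
      using intm i1 i2 by (intro borel_measurable_integrable) simp
  qed (use intp in auto)
  also have "\<dots> = (LINT z|lborel. half_integrand 1 (Hminus N \<psi>1) \<psi>2 z)"
    using intm i1 i2 sum by (simp add: add_divide_distrib[symmetric] flip: distrib_left)
  finally show "integrable lborel (half_integrand 1 \<psi>1 \<psi>2) \<and>
     integrable lborel (half_integrand 1 \<psi>1 (Hplus N \<psi>2)) \<and> integrable lborel (half_integrand 1 (Hminus N \<psi>1) \<psi>2) \<and>
     (LINT z|lborel. half_integrand 1 \<psi>1 (Hplus N \<psi>2) z) = (LINT z|lborel. half_integrand 1 (Hminus N \<psi>1) \<psi>2 z)"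
    using int0 intp intm by blast
qed

lemma half_adjoint_Hplus: "p > 0 \<Longrightarrow> half_adjoint p (Hplus N) (Hminus N)"
  using half_adjoint_Hplus_ne1 half_adjoint_Hplus_1 by (cases "p = 1") auto

lemma unitarizes_plane:
  assumes q: "q > 0"
  shows "unitarizes scalar_plane plane_converges q N"
proof -
  have iq: "inverse q > 0" using q by simp
  have h: "half_adjoint p (Hminus N) (Hplus N)" if "p > 0" for p
    using half_adjoint_swap[OF that half_adjoint_Hplus] that by simp
  show ?thesis unfolding unitarizes_def
    using q iq by (intro conjI adjoint_wrt_plane_of_halves half_adjoint_H3 half_adjoint_Hplus h)
qed

lemma unitarizes_sphere:
  assumes q: "q > 0"
  shows "unitarizes scalar_sphere sphere_converges q N"
proof -
  have "adjoint_wrt scalar_sphere sphere_converges q A B" if "adjoint_wrt scalar_plane plane_converges q A B" for A B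
    using that sphere_eq_plane[OF q] unfolding adjoint_wrt_def by metis
  then show ?thesis using unitarizes_plane[OF q] unfolding unitarizes_def by blast
qed

subsection \<open>Sums of symmetric \<open>q\<close>-numbers\<close>

lemma qnum_1: "qnum 1 x = x" by (simp add: qnum_def)

lemma q_diff_inverse_ne: "q > 0 \<Longrightarrow> q \<noteq> 1 \<Longrightarrow> q - inverse q \<noteq> 0" for q :: real
  by (smt (verit) inverse_less_1_iff one_less_inverse_iff)

lemma qnum_add: "q > 0 \<Longrightarrow> qnum q (x + y) = q powr (- y) * qnum q x + q powr x * qnum q y"
proof -
  assume q: "q > 0"
  have "q powr (x + y) - q powr (- (x + y)) = q powr (- y) * (q powr x - q powr (- x)) + q powr x * (q powr y - q powr (- y))"
    unfolding right_diff_distrib powr_add[symmetric] by (simp add: add.commute)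
  then show ?thesis by (simp add: qnum_def add_divide_distrib)
qed

lemma qnum_minus: "qnum q (- x) = - qnum q x"
  by (auto simp: qnum_def minus_divide_left)

lemma qnum_zero [simp]: "qnum q 0 = 0"
  by (simp add: qnum_def)

lemma qnum_one [simp]: "q > 0 \<Longrightarrow> qnum q 1 = 1"
  using q_diff_inverse_ne[of q] by (auto simp: qnum_def powr_minus)

lemma qnum_pos:
  assumes q: "q > 0" and x: "x > 0"
  shows "qnum q x > 0"
proof (cases "q = 1")
  case False
  consider "q > 1" | "q < 1" using False by linarith
  then show ?thesis
  proof cases
    case 1
    then have "q powr x > q powr (- x)" "q > inverse q" using x
      by (auto simp: powr_less_cancel_iff) (smt (verit) inverse_less_1_iff)
    then show ?thesis using False by (simp add: qnum_def)
  next
    case 2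
    then have "q powr x < q powr (- x)" "q < inverse q" using x q
      by (auto intro!: powr_less_mono') (smt (verit) one_less_inverse_iff)
    then show ?thesis using False by (simp add: qnum_def divide_neg_neg)
  qed
qed (use x in \<open>simp add: qnum_def\<close>)

lemma qnum_inverse: "q > 0 \<Longrightarrow> qnum (inverse q) x = qnum q x"
proof -
  assume q: "q > 0"
  have p: "inverse q powr y = q powr (- y)" for y using inverse_powr[OF q] .
  show ?thesis
  proof (cases "q = 1")
    case False
    have "(q powr - x - q powr - (- x)) / (inverse q - q) = (q powr x - q powr - x) / (q - inverse q)"
      using minus_divide_divide[of "q powr x - q powr - x" "q - inverse q"] by simp
    then show ?thesis using False by (simp add: qnum_def p)
  qed simp
qed

definition qfac :: "real \<Rightarrow> nat \<Rightarrow> real" where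
  "qfac q n = (\<Prod>k=1..n. qnum q (real k))"

lemma qfact_eq_qfac: "x = real n \<Longrightarrow> qfact q x = qfac q n"
  by (simp add: qfact_def qfac_def)

lemma qfac_0 [simp]: "qfac q 0 = 1" by (simp add: qfac_def)

lemma qfac_Suc: "qfac q (Suc n) = qnum q (real (Suc n)) * qfac q n"
  by (simp add: qfac_def mult.commute)

lemma qfac_1 [simp]: "q > 0 \<Longrightarrow> qfac q (Suc 0) = 1"
  by (simp add: qfac_Suc)

lemma qfac_pos: "q > 0 \<Longrightarrow> qfac q n > 0"
  by (auto simp: qfac_def intro!: prod_pos qnum_pos)

lemma qfac_nonzero [simp]: "q > 0 \<Longrightarrow> qfac q n \<noteq> 0"
  using qfac_pos[of q n] by simp

lemma qfac_inverse: "q > 0 \<Longrightarrow> qfac (inverse q) n = qfac q n"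
  by (simp add: qfac_def qnum_inverse)

lemma qfac_add: "qfac q (m + i) = qfac q m * (\<Prod>l=1..i. qnum q (real m + real l))"
  by (induction i) (auto simp: qfac_Suc algebra_simps)

text \<open>The Gaussian binomial coefficient in the symmetric normalisation, which is invariant
  under q to 1/q. The value 0 above the diagonal lets the Pascal rules hold without side
  conditions.\<close>

definition qbin :: "real \<Rightarrow> nat \<Rightarrow> nat \<Rightarrow> real" where
  "qbin q n k = (if k \<le> n then qfac q n / (qfac q k * qfac q (n - k)) else 0)"

lemma qbin_0 [simp]: "q > 0 \<Longrightarrow> qbin q n 0 = 1"
  by (simp add: qbin_def)

lemma qbin_gt [simp]: "k > n \<Longrightarrow> qbin q n k = 0"
  by (simp add: qbin_def)

lemma qbin_absorb:
  assumes q: "q > 0"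
  shows "qnum q (real (Suc k)) * qbin q (Suc n) (Suc k) = qnum q (real (Suc n)) * qbin q n k"
  using q qnum_pos[OF q, of "real (Suc k)"]
  by (auto simp: qbin_def qfac_Suc[of q k] qfac_Suc[of q n] simp del: of_nat_Suc)

lemma qbin_pascal:
  assumes q: "q > 0"
  shows "qbin q (Suc n) (Suc k) = q powr (- real (Suc k)) * qbin q n (Suc k) + q powr (real n - real k) * qbin q n k"
proof -
  consider "k > n" | "k = n" | "k < n" by linarith
  then show ?thesis
  proof cases
    case 3
    define j where "j = n - Suc k"
    have j: "n = Suc k + j" using 3 by (simp add: j_def)
    define A B c1 c2 where "A = qnum q (real (Suc k))" and "B = qnum q (real (Suc j))"
      and "c1 = q powr (- real (Suc k))" and "c2 = q powr (real n - real k)"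
    have "qnum q (real (Suc n)) = c1 * B + c2 * A"
      using qnum_add[OF q, of "real (Suc j)" "real (Suc k)"] by (simp add: A_def B_def c1_def c2_def j add_ac)
    then have 1: "qfac q (Suc n) = (c1 * B + c2 * A) * qfac q n" by (simp only: qfac_Suc)
    have 2: "qfac q (Suc k) = A * qfac q k" "qfac q (Suc j) = B * qfac q j" by (simp_all only: qfac_Suc A_def B_def)
    have 3: "Suc n - Suc k = Suc j" "n - Suc k = j" "n - k = Suc j" "Suc k \<le> Suc n" "Suc k \<le> n" "k \<le> n" using j by auto
    have 4: "A \<noteq> 0" "B \<noteq> 0" using qnum_pos[OF q, of "real (Suc k)"] qnum_pos[OF q, of "real (Suc j)"] by (auto simp: A_def B_def)
    have alg: "(c1 * B + c2 * A) * F / (A * f * (B * h)) = c1 * (F / (A * f * h)) + c2 * (F / (f * (B * h)))"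
      if "f \<noteq> 0" "h \<noteq> 0" for F f h using that 4 by (simp add: field_simps)
    show ?thesis unfolding qbin_def 3(1,2,3) 1 2 c1_def[symmetric] c2_def[symmetric]
      using 3 alg[of "qfac q k" "qfac q j" "qfac q n"] q by simp
  qed (use q in \<open>auto simp: qbin_def\<close>)
qed

text \<open>By invariance of the coefficients, this is the other Pascal rule read at
  \<open>inverse q\<close>.\<close>

lemma qbin_pascal':
  assumes q: "q > 0"
  shows "qbin q (Suc n) (Suc k) = q powr (real (Suc k)) * qbin q n (Suc k) + q powr (real k - real n) * qbin q n k"
proof -
  have i: "qbin (inverse q) n k = qbin q n k" for n k using q by (simp add: qbin_def qfac_inverse)
  have p: "inverse q powr y = q powr (- y)" for y using inverse_powr[OF q] .
  show ?thesis using qbin_pascal[of "inverse q" n k] q by (simp add: i p add_ac)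
qed

text \<open>Passing from \<open>a\<close> to \<open>Suc a\<close> multiplies the sum by 1 - q^(-2a),
  and this factor is 0 at the first step. In product form it is the q-binomial theorem evaluated at
  a zero.\<close>

lemma qbin_alternating_sum:
  assumes q: "q > 0"
  shows "(\<Sum>k\<le>Suc a. (- 1) ^ k * qbin q (Suc a) k * q powr (real k * (1 - real (Suc a)))) = 0"
proof -
  define g where "g a = (\<Sum>k\<le>a. (- 1) ^ k * qbin q a k * q powr (real k * (1 - real a)))" for a
  have step: "g (Suc a) = (1 - q powr (- 2 * real a)) * g a" for a
  proof -
    have "g (Suc a) = 1 + (\<Sum>k\<le>a. (- 1) ^ Suc k * qbin q (Suc a) (Suc k) * q powr (real (Suc k) * (1 - real (Suc a))))"
      unfolding g_def by (subst sum.atMost_Suc_shift) (use q in simp)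
    also have "(\<Sum>k\<le>a. (- 1) ^ Suc k * qbin q (Suc a) (Suc k) * q powr (real (Suc k) * (1 - real (Suc a))))
      = (\<Sum>k\<le>a. (- 1) ^ Suc k * qbin q a (Suc k) * q powr (real (Suc k) * (1 - real a))
          - q powr (- 2 * real a) * ((- 1) ^ k * qbin q a k * q powr (real k * (1 - real a))))"
    proof (rule sum.cong)
      fix k
      have e: "q powr (real (Suc k)) * q powr (real (Suc k) * (1 - real (Suc a))) = q powr (real (Suc k) * (1 - real a))"
        "q powr (real k - real a) * q powr (real (Suc k) * (1 - real (Suc a))) = q powr (- 2 * real a) * q powr (real k * (1 - real a))"
        by (simp_all flip: powr_add add: algebra_simps)
      have alg: "- 1 * s * (u * B + r * C) * w = - 1 * s * B * v - h * (s * C * e)"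
        if "u * w = v" "r * w = h * e" for s u B r C w v h e :: real 
      proof -
        have "- 1 * s * (u * B + r * C) * w = - 1 * s * B * (u * w) - s * C * (r * w)" by (simp add: algebra_simps)
        then show ?thesis unfolding that by (simp add: mult_ac)
      qed
      show "(- 1) ^ Suc k * qbin q (Suc a) (Suc k) * q powr (real (Suc k) * (1 - real (Suc a)))
         = (- 1) ^ Suc k * qbin q a (Suc k) * q powr (real (Suc k) * (1 - real a))
          - q powr (- 2 * real a) * ((- 1) ^ k * qbin q a k * q powr (real k * (1 - real a)))"
        unfolding qbin_pascal'[OF q] power_Suc by (rule alg[OF e])
    qed simp
    also have "1 + \<dots> = 1 + (\<Sum>k\<le>a. (- 1) ^ Suc k * qbin q a (Suc k) * q powr (real (Suc k) * (1 - real a)))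
        - q powr (- 2 * real a) * g a"
      by (simp add: sum_subtractf sum_distrib_left g_def)
    also have "1 + (\<Sum>k\<le>a. (- 1) ^ Suc k * qbin q a (Suc k) * q powr (real (Suc k) * (1 - real a))) =
      (\<Sum>k\<le>Suc a. (- 1) ^ k * qbin q a k * q powr (real k * (1 - real a)))"
      by (subst sum.atMost_Suc_shift) (use q in simp)
    also have "\<dots> = g a" by (simp add: g_def)
    finally show ?thesis by (simp add: algebra_simps)
  qed
  have "g (Suc a) = 0"
    by (induction a) (use q in \<open>auto simp: step\<close>)
  then show ?thesis by (simp add: g_def)
qed

text \<open>The \<open>q\<close>-analogue of the \<open>a\<close>-th finite difference, applied to a product of \<open>length xs\<close> linear
  \<open>q\<close>-factors: it vanishes below degree \<open>a\<close> and only sees the leading coefficient in degree \<open>a\<close>.\<close>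

definition qdiff_sum :: "real \<Rightarrow> nat \<Rightarrow> real list \<Rightarrow> real" where
  "qdiff_sum q a xs = (\<Sum>k\<le>a. (- 1) ^ k * qbin q a k * q powr (real k * (1 - real a + real (length xs)))
     * (\<Prod>x\<leftarrow>xs. qnum q (x + real k)))"

text \<open>The addition formula splits [x + k] into a multiple of [x] and a multiple of [k]. The
  first part leaves a shorter list at the same order; in the second, [k] is absorbed into the
  binomial coefficient, which lowers the order, and re-indexing shifts the remaining factors by
  1.\<close>

lemma qdiff_sum_Cons:
  assumes q: "q > 0"
  shows "qdiff_sum q (Suc a) (x # xs) = qnum q x * qdiff_sum q (Suc a) xs
    - q powr (x + real (length xs) + 1 - real a) * qnum q (real (Suc a)) * qdiff_sum q a (map (\<lambda>x. x + 1) xs)"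
proof -
  define E where "E k = 1 - real (Suc a) + real (length xs)" for k :: nat
  define P where "P k = (\<Prod>x\<leftarrow>xs. qnum q (x + real k))" for k
  have P1: "(\<Prod>x\<leftarrow>map (\<lambda>x. x + 1) xs. qnum q (x + real k)) = P (Suc k)" for k
    unfolding P_def by (simp add: o_def add_ac)
  have t: "(- 1) ^ k * qbin q (Suc a) k * q powr (real k * (E k + 1)) * (qnum q (x + real k) * P k)
    = qnum q x * ((- 1) ^ k * qbin q (Suc a) k * q powr (real k * E k) * P k)
      + q powr x * ((- 1) ^ k * (qnum q (real k) * qbin q (Suc a) k) * q powr (real k * (E k + 1)) * P k)" for k
  proof -
    have e: "q powr (real k * (E k + 1)) * q powr (- real k) = q powr (real k * E k)"
      by (simp flip: powr_add add: algebra_simps)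
    have alg: "s * B * w * ((v * X + e * K) * R) = X * (s * B * u * R) + e * (s * (K * B) * w * R)"
      if "w * v = u" for s B w v X e K R u :: real 
      proof -
        have "s * B * w * ((v * X + e * K) * R) = X * (s * B * (w * v) * R) + e * (s * (K * B) * w * R)" by (simp add: algebra_simps)
        then show ?thesis unfolding that by (simp add: mult_ac)
      qed
    show ?thesis unfolding qnum_add[OF q] by (rule alg[OF e])
  qed
  have "qdiff_sum q (Suc a) (x # xs) = (\<Sum>k\<le>Suc a. (- 1) ^ k * qbin q (Suc a) k * q powr (real k * (E k + 1)) * (qnum q (x + real k) * P k))"
    by (simp add: qdiff_sum_def E_def P_def add_ac)
  also have "\<dots> = qnum q x * qdiff_sum q (Suc a) xs + q powr x * (\<Sum>k\<le>Suc a. (- 1) ^ k * (qnum q (real k) * qbin q (Suc a) k) * q powr (real k * (E k + 1)) * P k)"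
    unfolding t sum.distrib sum_distrib_left[symmetric] by (simp only: qdiff_sum_def E_def P_def)
  also have "(\<Sum>k\<le>Suc a. (- 1) ^ k * (qnum q (real k) * qbin q (Suc a) k) * q powr (real k * (E k + 1)) * P k)
    = (\<Sum>k\<le>a. (- 1) ^ Suc k * (qnum q (real (Suc k)) * qbin q (Suc a) (Suc k)) * q powr (real (Suc k) * (E k + 1)) * P (Suc k))"
    by (subst sum.atMost_Suc_shift) (simp add: E_def)
  also have "\<dots> = (\<Sum>k\<le>a. - (q powr (real (length xs) + 1 - real a) * qnum q (real (Suc a))) *
     ((- 1) ^ k * qbin q a k * q powr (real k * (1 - real a + real (length xs))) * P (Suc k)))"
  proof (rule sum.cong)
    fix k
    have "q powr (real (Suc k) * (E k + 1)) = q powr (real (length xs) + 1 - real a) * q powr (real k * (1 - real a + real (length xs)))"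
      by (simp flip: powr_add add: E_def algebra_simps)
    then show "(- 1) ^ Suc k * (qnum q (real (Suc k)) * qbin q (Suc a) (Suc k)) * q powr (real (Suc k) * (E k + 1)) * P (Suc k)
       = - (q powr (real (length xs) + 1 - real a) * qnum q (real (Suc a))) *
     ((- 1) ^ k * qbin q a k * q powr (real k * (1 - real a + real (length xs))) * P (Suc k))"
      unfolding qbin_absorb[OF q] power_Suc by (simp add: mult_ac)
  qed simp
  also have "\<dots> = - (q powr (real (length xs) + 1 - real a) * qnum q (real (Suc a))) * qdiff_sum q a (map (\<lambda>x. x + 1) xs)"
    unfolding sum_distrib_left[symmetric] by (simp only: qdiff_sum_def P1 length_map)
  finally show ?thesis
    by (simp add: powr_add powr_diff mult_ac)
qed

lemma sum_list_shift: "(\<Sum>x\<leftarrow>map (\<lambda>x. x + 1) xs. x) = (\<Sum>x\<leftarrow>xs. x) + real (length xs)"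
  by (induction xs) auto

text \<open>Induction on the number of factors. In the recursion the first term has excess order and
  vanishes even in the borderline case, while the second loses one factor and one order
  together.\<close>

lemma qdiff_sum_eval:
  assumes q: "q > 0"
  shows "length xs < a \<Longrightarrow> qdiff_sum q a xs = 0"
    and "length xs = a \<Longrightarrow> qdiff_sum q a xs = (- 1) ^ a * qfac q a * q powr (real a * (real a + 1) / 2 + (\<Sum>x\<leftarrow>xs. x))"
proof (induction "length xs" arbitrary: xs a)
  case 0
  { case 1
    then obtain b where "a = Suc b" by (cases a) auto
    then show ?case using qbin_alternating_sum[OF q, of b] 0 by (simp add: qdiff_sum_def)
  next
    case 2
    then show ?case using 0 q by (simp add: qdiff_sum_def qbin_def) }
next
  case (Suc n)
  then obtain x ys where xs: "xs = x # ys" "length ys = n" by (cases xs) auto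
  { case 1
    then obtain b where b: "a = Suc b" "n < b" using xs by (cases a) auto
    have "qdiff_sum q (Suc b) ys = 0" using Suc.hyps(1)[of ys "Suc b"] xs b by simp
    moreover have "qdiff_sum q b (map (\<lambda>x. x + 1) ys) = 0" using Suc.hyps(1)[of "map (\<lambda>x. x + 1) ys" b] xs b by simp
    ultimately show ?case by (simp add: xs b qdiff_sum_Cons[OF q])
  next
    case 2
    then obtain b where b: "a = Suc b" "n = b" using xs by (cases a) auto
    have 1: "qdiff_sum q (Suc b) ys = 0" using Suc.hyps(1)[of ys "Suc b"] xs b by simp
    have 2: "qdiff_sum q b (map (\<lambda>x. x + 1) ys) = (- 1) ^ b * qfac q b * q powr (real b * (real b + 1) / 2 + ((\<Sum>x\<leftarrow>ys. x) + real b))"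
      using Suc.hyps(2)[of "map (\<lambda>x. x + 1) ys" b] xs b sum_list_shift[of ys] by simp
    have e: "q powr (x + 1) * q powr (real b * (real b + 1) / 2 + ((\<Sum>x\<leftarrow>ys. x) + real b)) =
       q powr (real (Suc b) * (real (Suc b) + 1) / 2 + (x + (\<Sum>x\<leftarrow>ys. x)))"
      by (simp flip: powr_add add: field_simps)
    have "qdiff_sum q (Suc b) (x # ys) = - (qnum q (real (Suc b)) * ((- 1) ^ b * qfac q b * (q powr (x + 1) * q powr (real b * (real b + 1) / 2 + ((\<Sum>x\<leftarrow>ys. x) + real b)))))"
      using qdiff_sum_Cons[OF q, of b x ys] xs b by (simp add: 1 2 add_ac)
    then show ?case unfolding e by (simp add: xs b qfac_Suc) }
qed

text \<open>The Pascal rule for the upper index \<open>Suc x\<close> splits the sum into two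
  instances of the induction hypothesis, at \<open>Suc c\<close> and at \<open>c\<close>; the same
  rule read backwards joins their values.\<close>

lemma q_vandermonde:
  assumes q: "q > 0"
  shows "(\<Sum>i\<le>b. q powr (real i * (real x + real y)) * qbin q x i * qbin q y (b - i)) = q powr (real x * real b) * qbin q (x + y) b"
proof (induction x arbitrary: b)
  case 0
  have "(\<Sum>i\<le>b. q powr (real i * (real 0 + real y)) * qbin q 0 i * qbin q y (b - i)) =
    (\<Sum>i\<le>b. if i = 0 then qbin q y b else 0)"
    by (rule sum.cong) (use q in auto)
  then show ?case using q by simp
next
  case (Suc x)
  show ?case
  proof (cases b)
    case (Suc c)
    have t: "q powr (real (Suc i) * (real (Suc x) + real y)) * qbin q (Suc x) (Suc i) =
      q powr (real (Suc i) * (real x + real y)) * qbin q x (Suc i)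
      + q powr (2 * real x + 1 + real y) * (q powr (real i * (real x + real y)) * qbin q x i)" for i
    proof -
      have e: "q powr (real (Suc i) * (real (Suc x) + real y)) * q powr (- real (Suc i)) = q powr (real (Suc i) * (real x + real y))"
        "q powr (real (Suc i) * (real (Suc x) + real y)) * q powr (real x - real i) = q powr (2 * real x + 1 + real y) * q powr (real i * (real x + real y))"
        by (simp_all flip: powr_add add: algebra_simps)
      have alg: "w * (u * B + r * C) = v * B + h * (e * C)"
        if "w * u = v" "w * r = h * e" for u B r C w v h e :: real 
      proof -
        have "w * (u * B + r * C) = (w * u) * B + (w * r) * C" by (simp add: algebra_simps)
        then show ?thesis unfolding that by (simp add: mult_ac)
      qed
      show ?thesis unfolding qbin_pascal[OF q] by (rule alg[OF e])
    qed
    have "(\<Sum>i\<le>Suc c. q powr (real i * (real (Suc x) + real y)) * qbin q (Suc x) i * qbin q y (Suc c - i))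
      = qbin q y (Suc c) + (\<Sum>i\<le>c. q powr (real (Suc i) * (real (Suc x) + real y)) * qbin q (Suc x) (Suc i) * qbin q y (c - i))"
      by (subst sum.atMost_Suc_shift) (use q in simp)
    also have "\<dots> = (qbin q y (Suc c) + (\<Sum>i\<le>c. q powr (real (Suc i) * (real x + real y)) * qbin q x (Suc i) * qbin q y (c - i)))
      + q powr (2 * real x + 1 + real y) * (\<Sum>i\<le>c. q powr (real i * (real x + real y)) * qbin q x i * qbin q y (c - i))"
      unfolding t by (simp add: distrib_right sum.distrib sum_distrib_left mult.assoc)
    also have "qbin q y (Suc c) + (\<Sum>i\<le>c. q powr (real (Suc i) * (real x + real y)) * qbin q x (Suc i) * qbin q y (c - i))
      = (\<Sum>i\<le>Suc c. q powr (real i * (real x + real y)) * qbin q x i * qbin q y (Suc c - i))"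
      by (subst sum.atMost_Suc_shift) (use q in simp)
    also have "\<dots> = q powr (real x * real (Suc c)) * qbin q (x + y) (Suc c)" by (rule Suc.IH)
    also have "(\<Sum>i\<le>c. q powr (real i * (real x + real y)) * qbin q x i * qbin q y (c - i)) = q powr (real x * real c) * qbin q (x + y) c"
      by (rule Suc.IH)
    also have "q powr (real x * real (Suc c)) * qbin q (x + y) (Suc c) + q powr (2 * real x + 1 + real y) * (q powr (real x * real c) * qbin q (x + y) c)
      = q powr (real (Suc x) * real (Suc c)) * qbin q (Suc (x + y)) (Suc c)"
    proof -
      have e: "q powr (real (Suc x) * real (Suc c)) * q powr (- real (Suc c)) = q powr (real x * real (Suc c))"
        "q powr (real (Suc x) * real (Suc c)) * q powr (real (x + y) - real c) = q powr (2 * real x + 1 + real y) * q powr (real x * real c)"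
        by (simp_all flip: powr_add add: algebra_simps)
      have alg: "v * B + h * (e * C) = w * (u * B + r * C)"
        if "w * u = v" "w * r = h * e" for u B r C w v h e :: real 
      proof -
        have "w * (u * B + r * C) = (w * u) * B + (w * r) * C" by (simp add: algebra_simps)
        then show ?thesis unfolding that by (simp add: mult_ac)
      qed
      show ?thesis unfolding qbin_pascal[OF q] by (rule alg[OF e])
    qed
    finally show ?thesis using Suc by simp
  qed (use q in simp)
qed

subsection \<open>A \<open>q\<close>-beta integral\<close>

text \<open>The shifted factorial usually written (-t; q^2)_n.\<close>

definition qpoch :: "real \<Rightarrow> nat \<Rightarrow> real \<Rightarrow> real" where
  "qpoch q n t = (\<Prod>j<n. 1 + q ^ (2 * j) * t)"

lemma qpoch_Suc: "qpoch q (Suc n) t = qpoch q n t * (1 + q ^ (2 * n) * t)"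
  by (simp add: qpoch_def)

lemma qpoch_Suc_shift: "qpoch q (Suc n) t = (1 + t) * qpoch q n (q\<^sup>2 * t)"
  unfolding qpoch_def by (subst prod.lessThan_Suc_shift) (simp add: power_add power2_eq_square mult_ac)

lemma qpoch_pos: "q > 0 \<Longrightarrow> t \<ge> 0 \<Longrightarrow> qpoch q n t > 0"
  unfolding qpoch_def by (intro prod_pos) (simp add: add_pos_nonneg)

text \<open>The slopes q^(2j) shrink or grow with j according to whether q is below or above 1.
  Comparison with a power of 1 + t, up to a constant, treats both cases at once.\<close>

lemma qpoch_lower_bound:
  assumes q: "q > 0"
  obtains c where "c > 0" "\<And>t. t \<ge> 0 \<Longrightarrow> c * (1 + t) ^ n \<le> qpoch q n t"
proof (induction n arbitrary: thesis)
  case 0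
  show ?case by (rule 0[of 1]) (auto simp: qpoch_def)
next
  case (Suc n)
  obtain c where c: "c > 0" "\<And>t. t \<ge> 0 \<Longrightarrow> c * (1 + t) ^ n \<le> qpoch q n t" using Suc.IH by blast
  define m where "m = min 1 (q ^ (2 * n))"
  have m: "m > 0" "m \<le> 1" "m \<le> q ^ (2 * n)" using q by (auto simp: m_def)
  show ?case
  proof (rule Suc.prems[of "c * m"])
    fix t :: real assume t: "t \<ge> 0"
    have "m * (1 + t) \<le> 1 + q ^ (2 * n) * t" using m t by (simp add: distrib_left add_mono mult_right_mono)
    then have "(c * (1 + t) ^ n) * (m * (1 + t)) \<le> qpoch q n t * (1 + q ^ (2 * n) * t)"
      using c m t qpoch_pos[OF q t, of n] by (intro mult_mono) auto
    then show "c * m * (1 + t) ^ Suc n \<le> qpoch q (Suc n) t" by (simp add: qpoch_Suc mult_ac)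
  qed (use c m in simp)
qed

lemma continuous_qpoch_quot:
  assumes q: "q > 0"
  shows "continuous_on {0<..} (\<lambda>t. t ^ s / qpoch q n t)"
proof -
  have "qpoch q n t \<noteq> 0" if "t > 0" for t using qpoch_pos[OF q, of t n] that by simp
  then have "\<forall>t\<in>{0<..}. qpoch q n t \<noteq> 0" by auto
  then show ?thesis unfolding qpoch_def by (intro continuous_intros) auto
qed

lemma integrable_qpoch:
  assumes q: "q > 0" and s: "s + 2 \<le> n"
  shows "set_integrable lborel {0<..} (\<lambda>t. t ^ s / qpoch q n t)"
proof -
  obtain c where c: "c > 0" "\<And>t. t \<ge> 0 \<Longrightarrow> c * (1 + t) ^ n \<le> qpoch q n t" using qpoch_lower_bound[OF q] by blast
  show ?thesis
  proof (rule set_integrable_bound)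
    show "set_integrable lborel {0<..} (\<lambda>t. (1 / c) * (1 / (1 + t\<^sup>2)))"
      by (intro set_integrable_mult_right set_integrable_Cauchy_density)
    show "set_borel_measurable lborel {0<..} (\<lambda>t. t ^ s / qpoch q n t)"
      using borel_measurable_continuous_on_indicator[OF _ continuous_qpoch_quot[OF q]] by (simp add: set_borel_measurable_def)
    have "norm (t ^ s / qpoch q n t) \<le> norm ((1 / c) * (1 / (1 + t\<^sup>2)))" if t: "t > 0" for t
    proof -
      have "t ^ s * (1 + t\<^sup>2) \<le> (1 + t) ^ s * (1 + t)\<^sup>2"
        using t by (intro mult_mono power_mono) (auto simp: power2_sum)
      also have "\<dots> = (1 + t) ^ (s + 2)" by (rule power_add[symmetric])
      also have "\<dots> \<le> (1 + t) ^ n" using t s by (intro power_increasing) auto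
      finally have "c * (t ^ s * (1 + t\<^sup>2)) \<le> qpoch q n t"
        using c(1) c(2)[of t] t by (meson less_imp_le mult_left_mono order_trans)
      moreover have "1 + t\<^sup>2 > 0" by (simp add: add_pos_nonneg)
      ultimately have "t ^ s / qpoch q n t \<le> 1 / (c * (1 + t\<^sup>2))"
        using qpoch_pos[OF q, of t n] t c(1) by (simp add: divide_simps mult_ac)
      then show ?thesis using qpoch_pos[OF q, of t n] t c(1) by (simp add: abs_mult)
    qed
    then show "AE t\<in>{0<..} in lborel. norm (t ^ s / qpoch q n t) \<le> norm ((1 / c) * (1 / (1 + t\<^sup>2)))" by auto
  qed
qed

lemma set_integral_scale_Ioi:
  fixes g :: "real \<Rightarrow> real"
  assumes c: "c > 0"
  shows "(LINT t:{0<..}|lborel. g t) = c * (LINT t:{0<..}|lborel. g (c * t))"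
proof -
  have "(LINT t:{0<..}|lborel. g t) = c * (LINT t|lborel. indicator {0<..} (0 + c * t) *\<^sub>R g (0 + c * t))"
    unfolding set_lebesgue_integral_def by (subst lborel_integral_real_affine[of c _ 0]) (use c in auto)
  also have "(LINT t|lborel. indicator {0<..} (0 + c * t) *\<^sub>R g (0 + c * t)) = (LINT t:{0<..}|lborel. g (c * t))"
    unfolding set_lebesgue_integral_def
    using c by (intro Bochner_Integration.integral_cong) (auto simp: indicator_def zero_less_mult_iff)
  finally show ?thesis .
qed

text \<open>A q-analogue of the beta integral on the half-line, taken with Lebesgue measure; at q =
  1 and s + 2 <= n it is B(s + 1, n - s - 1).\<close>

definition qbeta :: "real \<Rightarrow> nat \<Rightarrow> nat \<Rightarrow> real" where
  "qbeta q s n = (LINT t:{0<..}|lborel. t ^ s / qpoch q n t)"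

text \<open>The missing factor of \<open>qpoch q (Suc n)\<close> can be put at the end or, after a dilation, at the front.
  For \<open>q \<noteq> 1\<close> the two relations determine the integrals; for \<open>q = 1\<close> they coincide and integration by
  parts replaces one of them.\<close>

lemma qbeta_split:
  assumes q: "q > 0" and s: "s + 2 \<le> n"
  shows "qbeta q s n = qbeta q s (Suc n) + q ^ (2 * n) * qbeta q (Suc s) (Suc n)"
    and "qbeta q s n = q ^ (2 * (s + 1)) * (qbeta q s (Suc n) + qbeta q (Suc s) (Suc n))"
proof -
  note i = integrable_qpoch[OF q, of s "Suc n"] integrable_qpoch[OF q, of "Suc s" "Suc n"]
  have i1: "set_integrable lborel {0<..} (\<lambda>t. t ^ s / qpoch q (Suc n) t)"
    and i2: "set_integrable lborel {0<..} (\<lambda>t. t ^ Suc s / qpoch q (Suc n) t)" using i s by auto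
  have "qbeta q s n = (LINT t:{0<..}|lborel. t ^ s / qpoch q (Suc n) t + q ^ (2 * n) * (t ^ Suc s / qpoch q (Suc n) t))"
    unfolding qbeta_def
  proof (rule set_lebesgue_integral_cong; clarsimp)
    fix t :: real assume t: "t > 0"
    have "1 + q ^ (2 * n) * t > 0" using q t by (simp add: add_pos_nonneg)
    then show "t ^ s / qpoch q n t = t ^ s / qpoch q (Suc n) t + q ^ (2 * n) * (t * t ^ s) / qpoch q (Suc n) t"
      using qpoch_pos[OF q, of t n] t by (simp add: qpoch_Suc divide_simps) (simp add: algebra_simps)
  qed
  also have "\<dots> = qbeta q s (Suc n) + q ^ (2 * n) * qbeta q (Suc s) (Suc n)"
  proof -
    have i3: "set_integrable lborel {0<..} (\<lambda>t. q ^ (2 * n) * (t ^ Suc s / qpoch q (Suc n) t))"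
      by (rule set_integrable_mult_right) (rule i2)
    show ?thesis unfolding qbeta_def by (simp only: set_integral_add(2)[OF i1 i3] set_integral_mult_right)
  qed
  finally show "qbeta q s n = qbeta q s (Suc n) + q ^ (2 * n) * qbeta q (Suc s) (Suc n)" .
  have "qbeta q s n = q\<^sup>2 * (LINT t:{0<..}|lborel. (q\<^sup>2 * t) ^ s / qpoch q n (q\<^sup>2 * t))"
    unfolding qbeta_def by (rule set_integral_scale_Ioi) (use q in simp)
  also have "(LINT t:{0<..}|lborel. (q\<^sup>2 * t) ^ s / qpoch q n (q\<^sup>2 * t))
    = (LINT t:{0<..}|lborel. q ^ (2 * s) * (t ^ s / qpoch q (Suc n) t + t ^ Suc s / qpoch q (Suc n) t))"
  proof (rule set_lebesgue_integral_cong; clarsimp)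
    fix t :: real assume t: "t > 0"
    have "qpoch q n (q\<^sup>2 * t) > 0" using qpoch_pos[OF q, of "q\<^sup>2 * t" n] t by simp
    then show "(q\<^sup>2 * t) ^ s / qpoch q n (q\<^sup>2 * t) = q ^ (2 * s) * (t ^ s / qpoch q (Suc n) t + t * t ^ s / qpoch q (Suc n) t)"
      using t by (simp add: qpoch_Suc_shift divide_simps power_mult_distrib flip: power_mult) (simp add: algebra_simps)
  qed
  also have "\<dots> = q ^ (2 * s) * (qbeta q s (Suc n) + qbeta q (Suc s) (Suc n))"
    unfolding qbeta_def using i1 i2 by (subst set_integral_mult_right) (subst set_integral_add; auto)+
  finally show "qbeta q s n = q ^ (2 * (s + 1)) * (qbeta q s (Suc n) + qbeta q (Suc s) (Suc n))"
    by (simp add: power_add power2_eq_square mult_ac)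
qed

lemma qbeta_1_parts:
  assumes s: "s + 2 \<le> n"
  shows "real (Suc s) * qbeta 1 s (Suc n) = real (n - 1 - s) * qbeta 1 (Suc s) (Suc n)"
proof -
  have D: "qpoch 1 k t = (1 + t) ^ k" for k t by (simp add: qpoch_def)
  have i: "set_integrable lborel {0<..} (\<lambda>t::real. t ^ s / (1 + t) ^ Suc n)" "set_integrable lborel {0<..} (\<lambda>t::real. t ^ Suc s / (1 + t) ^ Suc n)"
    using integrable_qpoch[of 1 s "Suc n"] integrable_qpoch[of 1 "Suc s" "Suc n"] s unfolding D by simp_all
  have i1: "set_integrable lborel {0<..} (\<lambda>t. real (Suc s) * (t ^ s / (1 + t) ^ Suc n))"
    and i2: "set_integrable lborel {0<..} (\<lambda>t. real (n - 1 - s) * (t ^ Suc s / (1 + t) ^ Suc n))"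
    by (rule set_integrable_mult_right, rule i)+
  have "(LINT t:{0<..}|lborel. real (Suc s) * (t ^ s / (1 + t) ^ Suc n) - real (n - 1 - s) * (t ^ Suc s / (1 + t) ^ Suc n)) = 0 - 0"
  proof (rule integral_FTC_Ioi[where F = "\<lambda>t. t ^ Suc s / (1 + t) ^ n"])
    fix t :: real assume t: "t > 0"
    have nz: "1 + t \<noteq> 0" using t by simp
    have n: "n = Suc (n - 1)" using s by simp
    have r: "real (n - 1 - s) = real n - 1 - real s" using s by (simp add: of_nat_diff)
    have "((\<lambda>t. t ^ Suc s / (1 + t) ^ n) has_real_derivative
      (real (Suc s) * t ^ s * (1 + t) ^ n - t ^ Suc s * (real n * (1 + t) ^ (n - 1))) / ((1 + t) ^ n * (1 + t) ^ n)) (at t)"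
    proof (rule DERIV_divide)
      show "((\<lambda>t. t ^ Suc s) has_real_derivative real (Suc s) * t ^ s) (at t)"
        using DERIV_pow[of "Suc s" t] by simp
      show "((\<lambda>t. (1 + t) ^ n) has_real_derivative real n * (1 + t) ^ (n - 1)) (at t)"
        by (auto intro!: derivative_eq_intros)
    qed (use nz in simp)
    moreover have "(real (Suc s) * t ^ s * (1 + t) ^ n - t ^ Suc s * (real n * (1 + t) ^ (n - 1))) / ((1 + t) ^ n * (1 + t) ^ n)
      = real (Suc s) * (t ^ s / (1 + t) ^ Suc n) - real (n - 1 - s) * (t ^ Suc s / (1 + t) ^ Suc n)"
    proof -
      have p: "(1 + t) ^ n = (1 + t) * (1 + t) ^ (n - 1)" by (subst n) simp
      have pos: "(1 + t) ^ (n - 1) \<noteq> 0" using nz by simp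
      show ?thesis unfolding power_Suc p r using nz pos
        by (simp add: divide_simps) (simp add: algebra_simps)
    qed
    ultimately show "((\<lambda>t. t ^ Suc s / (1 + t) ^ n) has_vector_derivative
        real (Suc s) * (t ^ s / (1 + t) ^ Suc n) - real (n - 1 - s) * (t ^ Suc s / (1 + t) ^ Suc n)) (at t)"
      by (simp add: has_real_derivative_iff_has_vector_derivative)
  next
    show "continuous_on {0<..} (\<lambda>t. real (Suc s) * (t ^ s / (1 + t) ^ Suc n) - real (n - 1 - s) * (t ^ Suc s / (1 + t) ^ Suc n))"
      by (intro continuous_intros) auto
    show "set_integrable lborel {0<..} (\<lambda>t. real (Suc s) * (t ^ s / (1 + t) ^ Suc n) - real (n - 1 - s) * (t ^ Suc s / (1 + t) ^ Suc n))"
      by (rule set_integral_diff(1)[OF i1 i2])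
    have "((\<lambda>t::real. t ^ Suc s / (1 + t) ^ n) \<longlongrightarrow> 0 ^ Suc s / (1 + 0) ^ n) (at_right 0)"
      by (intro tendsto_intros) auto
    then show "((\<lambda>t::real. t ^ Suc s / (1 + t) ^ n) \<longlongrightarrow> 0) (at_right 0)" by simp
    have le: "norm (t ^ Suc s / (1 + t) ^ n) \<le> inverse t" if t: "t > 0" for t :: real
    proof -
      have "t ^ Suc s * t \<le> (1 + t) ^ Suc s * (1 + t)" using t by (intro mult_mono power_mono) auto
      also have "\<dots> = (1 + t) ^ (s + 2)" by simp
      also have "\<dots> \<le> (1 + t) ^ n" using s t by (intro power_increasing) auto
      finally show ?thesis using t by (simp add: divide_simps)
    qed
    have "\<forall>\<^sub>F t in at_top. norm (t ^ Suc s / (1 + t) ^ n) \<le> inverse (t::real)"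
      by (rule eventually_mono[OF eventually_gt_at_top[of 0]]) (rule le)
    from Lim_null_comparison[OF this tendsto_inverse_0_at_top[OF filterlim_ident]]
    show "((\<lambda>t::real. t ^ Suc s / (1 + t) ^ n) \<longlongrightarrow> 0) at_top" .
  qed
  then have "(LINT t:{0<..}|lborel. real (Suc s) * (t ^ s / (1 + t) ^ Suc n)) = (LINT t:{0<..}|lborel. real (n - 1 - s) * (t ^ Suc s / (1 + t) ^ Suc n))"
    using set_integral_diff(2)[OF i1 i2] by simp
  then show ?thesis unfolding qbeta_def D by (simp only: set_integral_mult_right)
qed

lemma qbeta_ratio:
  assumes q: "q > 0" and s: "s + 2 \<le> n"
  shows "qnum q (real (Suc s)) * qbeta q s (Suc n) = q ^ n * qnum q (real (n - 1 - s)) * qbeta q (Suc s) (Suc n)"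
proof (cases "q = 1")
  case True
  then show ?thesis using qbeta_1_parts[OF s] by (simp add: qnum_1)
next
  case False
  define X Y where "X = qbeta q s (Suc n)" and "Y = qbeta q (Suc s) (Suc n)"
  define d where "d = q - inverse q"
  have d: "d \<noteq> 0" unfolding d_def by (rule q_diff_inverse_ne[OF q False])
  have e: "X + q ^ (2 * n) * Y = q ^ (2 * (s + 1)) * (X + Y)"
    using qbeta_split[OF q s] by (simp add: X_def Y_def)
  define k where "k = n - 1 - s"
  have n: "n = k + Suc s" using s by (simp add: k_def)
  define A K where "A = q ^ Suc s" and "K = q ^ k"
  have AK: "A > 0" "K > 0" using q by (auto simp: A_def K_def)
  have e': "X + (A * K)\<^sup>2 * Y = A\<^sup>2 * (X + Y)"
    using e by (simp add: n A_def K_def power_add power_mult power2_eq_square mult_2 mult_ac)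
  have qs: "qnum q (real (Suc s)) = (A - inverse A) / d" "qnum q (real k) = (K - inverse K) / d"
  proof -
    have "q powr real (Suc s) = A" "q powr real k = K" by (simp_all only: A_def K_def powr_realpow[OF q])
    then show "qnum q (real (Suc s)) = (A - inverse A) / d" "qnum q (real k) = (K - inverse K) / d"
      using False by (simp_all add: qnum_def d_def powr_minus del: of_nat_Suc)
  qed
  have "(A - inverse A) * X = A * K * (K - inverse K) * Y"
  proof -
    have "A * ((A - inverse A) * X) = A\<^sup>2 * X - X" using AK by (simp add: algebra_simps power2_eq_square)
    also have "\<dots> = (A * K)\<^sup>2 * Y - A\<^sup>2 * Y" using e' by (simp add: algebra_simps)
    also have "\<dots> = A * (A * K * (K - inverse K) * Y)" using AK by (simp add: algebra_simps power2_eq_square)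
    finally show ?thesis using AK by simp
  qed
  moreover have "q ^ n = A * K" by (simp add: n A_def K_def power_add)
  ultimately show ?thesis unfolding X_def[symmetric] Y_def[symmetric] k_def[symmetric] qs by simp
qed

text \<open>The one value that has to be computed from a primitive. Its logarithm is the origin of
  the normalisation \<open>log_factor\<close> of the scalar product.\<close>

lemma qbeta_base:
  assumes q: "q > 0"
  shows "qbeta q 0 2 * q = 1 / log_factor q"
proof -
  define p where "p = q\<^sup>2"
  have p: "p > 0" using q by (simp add: p_def)
  have D: "t ^ 0 / qpoch q 2 t = 1 / ((1 + t) * (1 + p * t))" for t
    by (simp add: qpoch_def p_def numeral_2_eq_2)
  have i: "set_integrable lborel {0<..} (\<lambda>t. 1 / ((1 + t) * (1 + p * t)))"
    using integrable_qpoch[OF q, of 0 2] unfolding D by simp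
  have nz: "1 + t \<noteq> 0" "1 + p * t \<noteq> 0" "1 + p * t > 0" if "t \<ge> 0" for t using that p by (auto simp: add_nonneg_eq_0_iff add_pos_nonneg)
  have c: "continuous_on {0<..} (\<lambda>t. 1 / ((1 + t) * (1 + p * t)))"
    using nz by (intro continuous_intros) (auto simp: less_imp_le)
  show ?thesis
  proof (cases "q = 1")
    case True
    have "(LINT t:{0<..}|lborel. 1 / ((1 + t) * (1 + p * t))) = 0 - (- 1)"
    proof (rule integral_FTC_Ioi[where F = "\<lambda>t. - inverse (1 + t)", OF _ c i])
      fix t :: real assume t: "t > 0"
      then show "((\<lambda>t. - inverse (1 + t)) has_vector_derivative 1 / ((1 + t) * (1 + p * t))) (at t)"
        unfolding has_real_derivative_iff_has_vector_derivative[symmetric]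
        by (auto intro!: derivative_eq_intros simp: p_def True inverse_eq_divide)
    next
      have "((\<lambda>t::real. - inverse (1 + t)) \<longlongrightarrow> - inverse (1 + 0)) (at_right 0)" by (intro tendsto_intros) auto
      then show "((\<lambda>t::real. - inverse (1 + t)) \<longlongrightarrow> - 1) (at_right 0)" by simp
      have "((\<lambda>t::real. - inverse (1 + t)) \<longlongrightarrow> - 0) at_top"
        by (intro tendsto_minus tendsto_inverse_0_at_top filterlim_tendsto_add_at_top[OF tendsto_const] filterlim_ident)
      then show "((\<lambda>t::real. - inverse (1 + t)) \<longlongrightarrow> 0) at_top" by simp
    qed
    then show ?thesis unfolding qbeta_def D by (simp add: True log_factor_def)
  next
    case False
    have p1: "p \<noteq> 1" using q False by (auto simp: p_def power2_eq_1_iff)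
    have "(LINT t:{0<..}|lborel. 1 / ((1 + t) * (1 + p * t))) = ln p / (p - 1) - 0"
    proof (rule integral_FTC_Ioi[where F = "\<lambda>t. ln ((1 + p * t) / (1 + t)) / (p - 1)", OF _ c i])
      fix t :: real assume t: "t > 0"
      then have pos: "(1 + p * t) / (1 + t) > 0" using nz[of t] by simp
      have "((\<lambda>t. (1 + p * t) / (1 + t)) has_real_derivative (p - 1) / (1 + t)\<^sup>2) (at t)"
        using nz[of t] t by (auto intro!: derivative_eq_intros simp: power2_eq_square field_simps)
      from DERIV_cdivide[OF DERIV_chain2[OF DERIV_ln[OF pos] this], of "p - 1"]
      have "((\<lambda>t. ln ((1 + p * t) / (1 + t)) / (p - 1)) has_real_derivative inverse ((1 + p * t) / (1 + t)) * ((p - 1) / (1 + t)\<^sup>2) / (p - 1)) (at t)" .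
      moreover have "inverse ((1 + p * t) / (1 + t)) * ((p - 1) / (1 + t)\<^sup>2) / (p - 1) = 1 / ((1 + t) * (1 + p * t))"
        using nz[of t] t p1 by (simp add: power2_eq_square)
      ultimately show "((\<lambda>t. ln ((1 + p * t) / (1 + t)) / (p - 1)) has_vector_derivative 1 / ((1 + t) * (1 + p * t))) (at t)"
        unfolding has_real_derivative_iff_has_vector_derivative[symmetric] by simp
    next
      have "((\<lambda>t. ln ((1 + p * t) / (1 + t)) / (p - 1)) \<longlongrightarrow> ln ((1 + p * 0) / (1 + 0)) / (p - 1)) (at_right 0)"
        using p1 by (intro tendsto_intros) auto
      then show "((\<lambda>t. ln ((1 + p * t) / (1 + t)) / (p - 1)) \<longlongrightarrow> 0) (at_right 0)" by simp
      have "((\<lambda>t. p + (1 - p) * inverse (1 + t)) \<longlongrightarrow> p + (1 - p) * 0) at_top"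
        by (intro tendsto_intros tendsto_inverse_0_at_top filterlim_tendsto_add_at_top[OF tendsto_const] filterlim_ident)
      moreover have "\<forall>\<^sub>F t in at_top. p + (1 - p) * inverse (1 + t) = (1 + p * t) / (1 + t)"
        by (rule eventually_mono[OF eventually_gt_at_top[of 0]]) (auto simp: field_simps)
      ultimately have "((\<lambda>t. (1 + p * t) / (1 + t)) \<longlongrightarrow> p) at_top"
        using Lim_transform_eventually by fastforce
      then show "((\<lambda>t. ln ((1 + p * t) / (1 + t)) / (p - 1)) \<longlongrightarrow> ln p / (p - 1)) at_top"
        using p p1 by (intro tendsto_intros) auto
    qed
    moreover have "ln p = 2 * ln q" using q by (simp add: p_def ln_realpow)
    moreover have "p - 1 = q * (q - inverse q)" using q by (simp add: p_def power2_eq_square algebra_simps)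
    ultimately have "qbeta q 0 2 = 2 * ln q / (q * (q - inverse q))" unfolding qbeta_def D by simp
    then show ?thesis using q False by (simp add: log_factor_def)
  qed
qed

text \<open>Induction on \<open>n\<close>: the splitting relation together with the ratio of
  neighbouring exponents expresses an integral at \<open>Suc n\<close> by one at
  \<open>n\<close>.\<close>

lemma qbeta_eval:
  assumes q: "q > 0"
  shows "s + 2 \<le> n \<Longrightarrow> qbeta q s n * q ^ ((n - 1) * (s + 1)) * qfac q (n - 1) = qfac q s * qfac q (n - 2 - s) / log_factor q"
proof (induction n arbitrary: s)
  case (Suc n)
  show ?case
  proof (cases "n = 1")
    case True
    then have "s = 0" using Suc.prems by simp
    then show ?thesis using True qbeta_base[OF q] q by (simp add: numeral_2_eq_2)
  next
    case False
    then have n: "n \<ge> 2" using Suc.prems by simp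
    have main: "qbeta q s (Suc n) * q ^ (n * (s + 1)) * qfac q n = qfac q s * qfac q (n - 1 - s) / log_factor q"
      if s: "s + 2 \<le> n" for s
    proof -
      define k where "k = n - 2 - s"
      have k: "n - 1 - s = Suc k" "n = Suc k + Suc s" using s by (auto simp: k_def)
      define X Y where "X = qbeta q s (Suc n)" and "Y = qbeta q (Suc s) (Suc n)"
      have 1: "qnum q (real (Suc s)) * X = q ^ n * qnum q (real (Suc k)) * Y"
        using qbeta_ratio[OF q s] by (simp only: X_def Y_def k(1))
      have 2: "qbeta q s n = X + q ^ (2 * n) * Y" using qbeta_split(1)[OF q s] by (simp only: X_def Y_def)
      have 3: "q ^ Suc s * qnum q (real n) = qnum q (real (Suc k)) + q ^ n * qnum q (real (Suc s))"
      proof -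
        have "qnum q (real n) = q powr (- real (Suc s)) * qnum q (real (Suc k)) + q powr (real (Suc k)) * qnum q (real (Suc s))"
          using qnum_add[OF q, of "real (Suc k)" "real (Suc s)"] by (simp only: k(2) of_nat_add)
        moreover have "q ^ Suc s * q powr (- real (Suc s)) = 1"
          by (simp only: powr_minus powr_realpow[OF q]) (use q in \<open>simp del: power_Suc\<close>)
        moreover have "q ^ Suc s * q powr (real (Suc k)) = q ^ n"
          by (simp only: powr_realpow[OF q] k(2) power_add mult.commute)
        ultimately show ?thesis by (metis distrib_left mult.assoc mult_1)
      qed
      have "qbeta q s n * qnum q (real (Suc k)) = X * (q ^ Suc s * qnum q (real n))"
      proof -
        have "qbeta q s n * qnum q (real (Suc k)) = X * qnum q (real (Suc k)) + q ^ n * (q ^ n * qnum q (real (Suc k)) * Y)"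
          unfolding 2 mult_2 power_add by (simp add: algebra_simps)
        also have "\<dots> = X * (q ^ Suc s * qnum q (real n))" unfolding 1[symmetric] 3 by (simp add: algebra_simps)
        finally show ?thesis .
      qed
      then have "X * (q ^ Suc s * qnum q (real n)) * (q ^ ((n - 1) * (s + 1)) * qfac q (n - 1))
        = (qbeta q s n * q ^ ((n - 1) * (s + 1)) * qfac q (n - 1)) * qnum q (real (Suc k))" by (simp add: mult_ac)
      also have "\<dots> = qfac q s * qfac q (n - 1 - s) / log_factor q"
        unfolding Suc.IH[OF s] k(1) k_def[symmetric] by (simp add: qfac_Suc)
      also have "X * (q ^ Suc s * qnum q (real n)) * (q ^ ((n - 1) * (s + 1)) * qfac q (n - 1)) = X * q ^ (n * (s + 1)) * qfac q n"
      proof -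
        have "qfac q n = qnum q (real n) * qfac q (n - 1)" using n qfac_Suc[of q "n - 1"] by simp
        moreover have "q ^ (n * (s + 1)) = q ^ Suc s * q ^ ((n - 1) * (s + 1))"
          unfolding power_add[symmetric] using n by (cases n) (auto simp: ac_simps)
        ultimately show ?thesis by simp
      qed
      finally show ?thesis by (simp only: X_def)
    qed
    show ?thesis
    proof (cases "s + 2 \<le> n")
      case True
      then show ?thesis using main[OF True] by (simp add: numeral_2_eq_2)
    next
      \<comment> \<open>For the largest exponent the integral at \<open>n\<close> would diverge and
        the splitting is out of reach; the ratio relation obtains the value from the exponent one
        below.\<close>
      case False
      then obtain k where k: "s = Suc k" "n = Suc s" using Suc.prems n by (cases s) auto
      have kn: "k + 2 \<le> n" using k by simp
      have r: "qnum q (real s) * qbeta q k (Suc n) = q ^ n * qbeta q s (Suc n)"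
        using qbeta_ratio[OF q kn] q k by simp
      have "qbeta q s (Suc n) * q ^ (n * (s + 1)) * qfac q n = (q ^ n * qbeta q s (Suc n)) * q ^ (n * (k + 1)) * qfac q n"
        by (simp add: k power_add algebra_simps)
      also have "\<dots> = qnum q (real s) * (qbeta q k (Suc n) * q ^ (n * (k + 1)) * qfac q n)"
        unfolding r[symmetric] by simp
      also have "\<dots> = qfac q s / log_factor q"
        unfolding main[OF kn] using q k by (simp add: qfac_Suc)
      finally show ?thesis using k by simp
    qed
  qed
qed simp

subsection \<open>Orthogonality of the polynomials \<open>R\<close>\<close>

text \<open>A terminating q-hypergeometric polynomial: \<open>R_fun\<close> without its factorial
  prefactor, in parameters that will be chosen to serve both signs of \<open>M + N\<close>. In all
  uses \<open>a\<close> is at most \<open>b\<close>, so no truncated subtraction occurs.\<close>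

definition Rpoly :: "real \<Rightarrow> nat \<Rightarrow> nat \<Rightarrow> nat \<Rightarrow> real \<Rightarrow> real" where
  "Rpoly q a b m x = (\<Sum>k\<le>a. (- x) ^ k / (qfac q k * qfac q (a - k) * qfac q (b - k) * qfac q (m + k)))"

lemma set_integrable_sum_real:
  fixes f :: "'i \<Rightarrow> 'a \<Rightarrow> real"
  assumes "\<And>i. i \<in> I \<Longrightarrow> set_integrable M A (f i)"
  shows "set_integrable M A (\<lambda>x. \<Sum>i\<in>I. f i x)"
    and "(LINT x:A|M. (\<Sum>i\<in>I. f i x)) = (\<Sum>i\<in>I. LINT x:A|M. f i x)"
  using assms unfolding set_integrable_def set_lebesgue_integral_def scaleR_sum_right
  by (auto intro!: Bochner_Integration.integrable_sum Bochner_Integration.integral_sum)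

text \<open>After cancellation the factorials that depend on \<open>i\<close> leave \<open>i\<close>
  and \<open>a - d - i\<close> q-numbers linear in \<open>k\<close>. The sum is therefore a
  \<open>qdiff_sum\<close> of order \<open>a\<close> with \<open>a - d\<close> factors, critical
  exactly when \<open>d = 0\<close>.\<close>

lemma Rpoly_inner_sum:
  assumes q: "q > 0" and ab: "a \<le> b" and i: "i + d \<le> a"
  shows "(\<Sum>k\<le>a. (- 1) ^ k * q powr (real k * (1 - real d)) * (qfac q (m + k + i) * qfac q (a + b - d - k - i))
      / (qfac q k * qfac q (a - k) * qfac q (b - k) * qfac q (m + k)))
    = (if d = 0 then (- 1) ^ i * q powr (real i * (real (a + b + m) + 1) - real a * real b) else 0)"
proof -
  \<comment> \<open>The first offsets in \<open>xs\<close> come from [m+k+i]!/[m+k]!, the others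
    from [a+b-d-k-i]!/[b-k]!. There \<open>k\<close> enters with a minus sign, so the q-numbers are
    negated and give (-1)^r.\<close>
  define r where "r = a - d - i"
  define xs where "xs = map (\<lambda>l. real m + real l) [1..<Suc i] @ map (\<lambda>l. - (real b + real l)) [1..<Suc r]"
  have len: "length xs = a - d" using i by (simp add: xs_def r_def del: upt_Suc)
  have pl: "(\<Prod>x\<leftarrow>map f [1..<Suc n]. g x) = (\<Prod>l=1..n. g (f l))" for f :: "nat \<Rightarrow> real" and g :: "real \<Rightarrow> real" and n
    by (induction n) simp_all
  have sl: "(\<Sum>x\<leftarrow>map f [1..<Suc n]. x) = (\<Sum>l=1..n. f l)" for f :: "nat \<Rightarrow> real" and n
    by (induction n) simp_all
  have summand: "(- 1) ^ k * q powr (real k * (1 - real d)) * (qfac q (m + k + i) * qfac q (a + b - d - k - i))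
      / (qfac q k * qfac q (a - k) * qfac q (b - k) * qfac q (m + k))
    = ((- 1) ^ r / qfac q a) * ((- 1) ^ k * qbin q a k * q powr (real k * (1 - real a + real (length xs))) * (\<Prod>x\<leftarrow>xs. qnum q (x + real k)))"
    if k: "k \<le> a" for k
  proof -
    have 1: "qfac q (m + k + i) = qfac q (m + k) * (\<Prod>l=1..i. qnum q (real m + real l + real k))"
      unfolding qfac_add by (simp add: add_ac)
    have e: "a + b - d - k - i = (b - k) + r" using k i ab by (simp add: r_def)
    have 2: "qfac q (a + b - d - k - i) = qfac q (b - k) * (\<Prod>l=1..r. qnum q (real b + real l - real k))"
      unfolding e qfac_add using k ab by (simp add: of_nat_diff algebra_simps)
    have 3: "(\<Prod>l=1..r. qnum q (- (real b + real l) + real k)) = (- 1) ^ r * (\<Prod>l=1..r. qnum q (real b + real l - real k))"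
    proof -
      have "(\<Prod>l=1..r. qnum q (- (real b + real l) + real k)) = (\<Prod>l=1..r. (- 1) * qnum q (real b + real l - real k))"
        by (intro prod.cong refl) (simp add: qnum_minus[symmetric] algebra_simps)
      then show ?thesis by (simp only: prod.distrib prod_constant card_atLeastAtMost) simp
    qed
    have 4: "(\<Prod>x\<leftarrow>xs. qnum q (x + real k)) = (\<Prod>l=1..i. qnum q (real m + real l + real k)) * ((- 1) ^ r * (\<Prod>l=1..r. qnum q (real b + real l - real k)))"
      unfolding xs_def map_append prod_list.append pl 3 by simp
    have 5: "1 - real a + real (length xs) = 1 - real d" using i by (simp add: len of_nat_diff)
    show ?thesis unfolding 1 2 4 5 using q k by (simp add: qbin_def field_simps)
  qed
  have "(\<Sum>k\<le>a. (- 1) ^ k * q powr (real k * (1 - real d)) * (qfac q (m + k + i) * qfac q (a + b - d - k - i))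
      / (qfac q k * qfac q (a - k) * qfac q (b - k) * qfac q (m + k))) = ((- 1) ^ r / qfac q a) * qdiff_sum q a xs"
    unfolding qdiff_sum_def sum_distrib_left by (intro sum.cong refl summand) simp
  also have "\<dots> = (if d = 0 then (- 1) ^ i * q powr (real i * (real (a + b + m) + 1) - real a * real b) else 0)"
  proof (cases "d = 0")
    case False
    then show ?thesis using qdiff_sum_eval(1)[OF q, of xs a] len i by simp
  next
    case True
    have ai: "a = r + i" using i True by (simp add: r_def)
    have "(\<Sum>x\<leftarrow>xs. x) = (\<Sum>l=1..i. real m + real l) + (\<Sum>l=1..r. - (real b + real l))"
      unfolding xs_def map_append sum_list.append sl ..
    also have "\<dots> = real i * real m + real i * (real i + 1) / 2 - real r * real b - real r * (real r + 1) / 2"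
    proof -
      have g: "(\<Sum>l=1..n. real l) = real n * (real n + 1) / 2" for n by (induction n) (auto simp: field_simps)
      show ?thesis by (simp add: sum.distrib sum_negf sum_subtractf g[unfolded One_nat_def])
    qed
    finally have e: "real a * (real a + 1) / 2 + (\<Sum>x\<leftarrow>xs. x) = real i * (real (a + b + m) + 1) - real a * real b"
      by (simp add: ai field_simps)
    have "(- 1) ^ r * (- 1) ^ a = (- 1 :: real) ^ i"
      by (simp add: ai power_add flip: power_mult_distrib)
    then show ?thesis using qdiff_sum_eval(2)[OF q, of xs a] len True q unfolding e by simp
  qed
  finally show ?thesis .
qed

text \<open>Multiplied by [a]! [b+m]!, each summand is a product of two q-binomials with upper
  indices \<open>a\<close> and \<open>b + m\<close>, weighted exactly as in the Vandermonde
  identity.\<close>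

lemma Rpoly_norm_sum:
  assumes q: "q > 0" and ab: "a \<le> b"
  shows "(\<Sum>i\<le>a. q powr (real i * real (a + b + m)) / (qfac q i * qfac q (a - i) * qfac q (b - i) * qfac q (m + i)))
    = q powr (real a * real b) * qfac q (a + b + m) / (qfac q a * qfac q b * qfac q (a + m) * qfac q (b + m))"
proof -
  have "(\<Sum>i\<le>b. q powr (real i * (real a + real (b + m))) * qbin q a i * qbin q (b + m) (b - i))
    = (\<Sum>i\<le>a. q powr (real i * (real a + real (b + m))) * qbin q a i * qbin q (b + m) (b - i))"
    by (rule sum.mono_neutral_right) (use ab in auto)
  also have "\<dots> = (\<Sum>i\<le>a. qfac q a * qfac q (b + m) * (q powr (real i * real (a + b + m)) / (qfac q i * qfac q (a - i) * qfac q (b - i) * qfac q (m + i))))"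
  proof (rule sum.cong)
    fix i assume i: "i \<in> {..a}"
    have e: "b + m - (b - i) = m + i" "b - i \<le> b + m" using i ab by auto
    show "q powr (real i * (real a + real (b + m))) * qbin q a i * qbin q (b + m) (b - i) =
      qfac q a * qfac q (b + m) * (q powr (real i * real (a + b + m)) / (qfac q i * qfac q (a - i) * qfac q (b - i) * qfac q (m + i)))"
      using i by (simp add: qbin_def e add_ac mult_ac)
  qed simp
  finally have s: "q powr (real a * real b) * qbin q (a + (b + m)) b = qfac q a * qfac q (b + m) *
    (\<Sum>i\<le>a. q powr (real i * real (a + b + m)) / (qfac q i * qfac q (a - i) * qfac q (b - i) * qfac q (m + i)))"
    unfolding q_vandermonde[OF q] by (simp only: sum_distrib_left)
  define S where "S = (\<Sum>i\<le>a. q powr (real i * real (a + b + m)) / (qfac q i * qfac q (a - i) * qfac q (b - i) * qfac q (m + i)))"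
  have "S = q powr (real a * real b) * qbin q (a + (b + m)) b / (qfac q a * qfac q (b + m))"
    using s[folded S_def] q by simp
  also have "\<dots> = q powr (real a * real b) * qfac q (a + b + m) / (qfac q a * qfac q b * qfac q (a + m) * qfac q (b + m))"
    by (simp add: qbin_def add_ac)
  finally show ?thesis unfolding S_def .
qed

text \<open>Here \<open>T = 2 J\<close>, \<open>T' = 2 J'\<close> and \<open>d = J - J'\<close>.  Integrated against a monomial, the first polynomial
  becomes a \<open>q\<close>-difference of order \<open>a\<close> of a product of \<open>a - d\<close> factors.\<close>

lemma Rpoly_orthogonal:
  fixes a b m d :: nat
  assumes q: "q > 0" and ab: "a \<le> b" and d: "d \<le> a"
  defines "T \<equiv> a + b + m" and "T' \<equiv> a + b + m - 2 * d"
  shows "set_integrable lborel {0<..} (\<lambda>t. t ^ m * Rpoly q a b m (q ^ (T' + 2) * t) * Rpoly q (a - d) (b - d) m (q ^ T' * t) / qpoch q (T - d + 2) t)"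
    and "(LINT t:{0<..}|lborel. t ^ m * Rpoly q a b m (q ^ (T' + 2) * t) * Rpoly q (a - d) (b - d) m (q ^ T' * t) / qpoch q (T - d + 2) t)
      = (if d = 0 then qfac q T / (log_factor q * q ^ ((T + 1) * (m + 1)) * qfac q (T + 1) * qfac q a * qfac q b * qfac q (a + m) * qfac q (b + m)) else 0)"
proof -
  \<comment> \<open>In terms of the basis indices this is J + J' + 2.\<close>
  define n where "n = T - d + 2"
  have Td: "T' + d = T - d" "2 * d \<le> T" "d \<le> T" using d ab by (auto simp: T_def T'_def)
  define u where "u k = (- 1) ^ k * q ^ ((T' + 2) * k) / (qfac q k * qfac q (a - k) * qfac q (b - k) * qfac q (m + k))" for k
  define v where "v i = (- 1) ^ i * q ^ (T' * i) / (qfac q i * qfac q (a - d - i) * qfac q (b - d - i) * qfac q (m + i))" for i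
  have R1: "Rpoly q a b m (q ^ (T' + 2) * t) = (\<Sum>k\<le>a. u k * t ^ k)" for t
    unfolding Rpoly_def u_def power_mult power_minus[of "_ * _"] power_mult_distrib by (intro sum.cong refl) simp
  have R2: "Rpoly q (a - d) (b - d) m (q ^ T' * t) = (\<Sum>i\<le>a - d. v i * t ^ i)" for t
    unfolding Rpoly_def v_def power_mult power_minus[of "_ * _"] power_mult_distrib by (intro sum.cong refl) simp
  have eq: "t ^ m * Rpoly q a b m (q ^ (T' + 2) * t) * Rpoly q (a - d) (b - d) m (q ^ T' * t) / qpoch q n t
    = (\<Sum>i\<le>a - d. \<Sum>k\<le>a. v i * u k * (t ^ (m + k + i) / qpoch q n t))" for t
  proof -
    have alg: "t ^ m * U * V / Q = V * U * (t ^ m / Q)" for U V Q :: real by simp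
    show ?thesis unfolding R1 R2 alg unfolding sum_product unfolding sum_distrib_right
      by (intro sum.cong refl) (simp add: power_add mult_ac)
  qed
  have le: "m + k + i + 2 \<le> n" if "k \<le> a" "i \<le> a - d" for k i
    using that d ab by (simp add: n_def T_def)
  have int: "set_integrable lborel {0<..} (\<lambda>t. v i * u k * (t ^ (m + k + i) / qpoch q n t))" if "k \<le> a" "i \<le> a - d" for k i
    by (intro set_integrable_mult_right integrable_qpoch[OF q] le that)
  have int2: "set_integrable lborel {0<..} (\<lambda>t. \<Sum>k\<le>a. v i * u k * (t ^ (m + k + i) / qpoch q n t))" if "i \<le> a - d" for i
    by (rule set_integrable_sum_real(1)) (use int that in auto)
  show "set_integrable lborel {0<..} (\<lambda>t. t ^ m * Rpoly q a b m (q ^ (T' + 2) * t) * Rpoly q (a - d) (b - d) m (q ^ T' * t) / qpoch q (T - d + 2) t)"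
    unfolding n_def[symmetric] eq by (rule set_integrable_sum_real(1)) (use int2 in auto)
  have "(LINT t:{0<..}|lborel. t ^ m * Rpoly q a b m (q ^ (T' + 2) * t) * Rpoly q (a - d) (b - d) m (q ^ T' * t) / qpoch q (T - d + 2) t)
    = (\<Sum>i\<le>a - d. LINT t:{0<..}|lborel. (\<Sum>k\<le>a. v i * u k * (t ^ (m + k + i) / qpoch q n t)))"
    unfolding n_def[symmetric] eq by (rule set_integrable_sum_real(2)) (use int2 in auto)
  also have "\<dots> = (\<Sum>i\<le>a - d. \<Sum>k\<le>a. v i * u k * qbeta q (m + k + i) n)"
  proof (rule sum.cong)
    fix i assume i: "i \<in> {..a - d}"
    have "(LINT t:{0<..}|lborel. (\<Sum>k\<le>a. v i * u k * (t ^ (m + k + i) / qpoch q n t))) = (\<Sum>k\<le>a. LINT t:{0<..}|lborel. v i * u k * (t ^ (m + k + i) / qpoch q n t))"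
      by (rule set_integrable_sum_real(2)) (use int i in auto)
    then show "(LINT t:{0<..}|lborel. (\<Sum>k\<le>a. v i * u k * (t ^ (m + k + i) / qpoch q n t))) = (\<Sum>k\<le>a. v i * u k * qbeta q (m + k + i) n)"
      by (simp only: set_integral_mult_right qbeta_def)
  qed simp
  also have "\<dots> = (\<Sum>i\<le>a - d. (v i * q powr (- real (T - d + 1) * real (m + i + 1)) / (qfac q (T - d + 1) * log_factor q)) *
     (if d = 0 then (- 1) ^ i * q powr (real i * (real (a + b + m) + 1) - real a * real b) else 0))"
  proof (rule sum.cong)
    fix i assume i: "i \<in> {..a - d}"
    have beta: "qbeta q (m + k + i) n = q powr (- real (T - d + 1) * real (m + k + i + 1)) * (qfac q (m + k + i) * qfac q (a + b - d - k - i)) / (qfac q (T - d + 1) * log_factor q)"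
      if k: "k \<le> a" for k
    proof -
      have alg: "X = inverse w * R / (F * L)" if "X * w * F = R / L" "w > 0" "F \<noteq> 0" for X w F R L :: real
      proof -
        have "X = (X * w * F) / (w * F)" using that(2,3) by simp
        then show ?thesis unfolding that(1) by (simp add: divide_inverse mult_ac)
      qed
      have ik: "i \<le> a - d" using i by simp
      have n1: "n - 1 = T - d + 1" "n - 2 - (m + k + i) = a + b - d - k - i" using k i d ab by (auto simp: n_def T_def)
      have "qbeta q (m + k + i) n * q powr (real (T - d + 1) * real (m + k + i + 1)) * qfac q (T - d + 1) = qfac q (m + k + i) * qfac q (a + b - d - k - i) / log_factor q"
        using qbeta_eval[OF q le[OF k ik]] unfolding n1 powr_realpow[OF q, symmetric] of_nat_mult .
      moreover have "q powr (real (T - d + 1) * real (m + k + i + 1)) > 0" "qfac q (T - d + 1) \<noteq> 0" using q by auto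
      ultimately show ?thesis
        unfolding mult_minus_left powr_minus by (intro alg) auto
    qed
    have uk: "u k * qbeta q (m + k + i) n = (q powr (- real (T - d + 1) * real (m + i + 1)) / (qfac q (T - d + 1) * log_factor q)) *
       ((- 1) ^ k * q powr (real k * (1 - real d)) * (qfac q (m + k + i) * qfac q (a + b - d - k - i))
      / (qfac q k * qfac q (a - k) * qfac q (b - k) * qfac q (m + k)))" if k: "k \<le> a" for k
    proof -
      have T': "real T' = real (T - d) - real d" using Td by linarith
      \<comment> \<open>The dilation of the first polynomial contributes T' + 2 per unit of
        \<open>k\<close>, the beta integral takes away T - d + 1. The balance 1 - d is the exponent
        required in a \<open>qdiff_sum\<close> of order \<open>a\<close> with \<open>a - d\<close>
        factors.\<close>
      have e: "q ^ ((T' + 2) * k) * q powr (- real (T - d + 1) * real (m + k + i + 1)) = q powr (- real (T - d + 1) * real (m + i + 1)) * q powr (real k * (1 - real d))"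
        unfolding powr_realpow[OF q, symmetric] by (simp flip: powr_add add: T' algebra_simps del: of_nat_diff)
      have alg: "(s * x / y) * (w * F / z) = (h / z) * (s * e * F / y)" if "x * w = h * e" for s x y w F z h e :: real
      proof -
        have "(s * x / y) * (w * F / z) = (x * w) * (s * F / (y * z))" by (simp add: divide_inverse mult_ac)
        then show ?thesis unfolding that by (simp add: divide_inverse mult_ac)
      qed
      show ?thesis unfolding u_def beta[OF k] by (rule alg[OF e])
    qed
    have "(\<Sum>k\<le>a. v i * u k * qbeta q (m + k + i) n) = (\<Sum>k\<le>a. v i * ((q powr (- real (T - d + 1) * real (m + i + 1)) / (qfac q (T - d + 1) * log_factor q)) *
       ((- 1) ^ k * q powr (real k * (1 - real d)) * (qfac q (m + k + i) * qfac q (a + b - d - k - i))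
      / (qfac q k * qfac q (a - k) * qfac q (b - k) * qfac q (m + k)))))"
      by (intro sum.cong refl) (simp only: mult.assoc uk atMost_iff)
    also have "\<dots> = (v i * q powr (- real (T - d + 1) * real (m + i + 1)) / (qfac q (T - d + 1) * log_factor q)) *
       (\<Sum>k\<le>a. (- 1) ^ k * q powr (real k * (1 - real d)) * (qfac q (m + k + i) * qfac q (a + b - d - k - i))
      / (qfac q k * qfac q (a - k) * qfac q (b - k) * qfac q (m + k)))"
      by (simp only: sum_distrib_left mult.assoc times_divide_eq_left times_divide_eq_right)
    finally show "(\<Sum>k\<le>a. v i * u k * qbeta q (m + k + i) n) = (v i * q powr (- real (T - d + 1) * real (m + i + 1)) / (qfac q (T - d + 1) * log_factor q)) *
     (if d = 0 then (- 1) ^ i * q powr (real i * (real (a + b + m) + 1) - real a * real b) else 0)"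
      using Rpoly_inner_sum[OF q ab, of i d m] i d by simp
  qed simp
  also have "\<dots> = (if d = 0 then qfac q T / (log_factor q * q ^ ((T + 1) * (m + 1)) * qfac q (T + 1) * qfac q a * qfac q b * qfac q (a + m) * qfac q (b + m)) else 0)"
  proof (cases "d = 0")
    case True
    have t: "(v i * q powr (- real (T - d + 1) * real (m + i + 1)) / (qfac q (T - d + 1) * log_factor q)) * ((- 1) ^ i * q powr (real i * (real (a + b + m) + 1) - real a * real b))
      = (q powr (- real ((T + 1) * (m + 1)) - real a * real b) / (qfac q (T + 1) * log_factor q)) *
        (q powr (real i * real (a + b + m)) / (qfac q i * qfac q (a - i) * qfac q (b - i) * qfac q (m + i)))" for i
    proof -
      have e: "q ^ (T' * i) * q powr (- real (T + 1) * real (m + i + 1)) * q powr (real i * (real (a + b + m) + 1) - real a * real b)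
        = q powr (- real ((T + 1) * (m + 1)) - real a * real b) * q powr (real i * real (a + b + m))"
        unfolding powr_realpow[OF q, symmetric] using True by (simp flip: powr_add add: T'_def T_def algebra_simps)
      have alg: "(s * x / y * w / z) * (s * g) = (h / z) * (k / y)" if "x * w * g = h * k" "s * s = 1" for s x y w z g h k :: real
      proof -
        have "(s * x / y * w / z) * (s * g) = (s * s) * (x * w * g) * inverse (y * z)" by (simp add: divide_inverse mult_ac)
        then show ?thesis unfolding that by (simp add: divide_inverse mult_ac)
      qed
      show ?thesis unfolding v_def using True by (simp only: diff_zero) (rule alg[OF e], simp flip: power_mult_distrib)
    qed
    have "(\<Sum>i\<le>a - d. (v i * q powr (- real (T - d + 1) * real (m + i + 1)) / (qfac q (T - d + 1) * log_factor q)) * ((- 1) ^ i * q powr (real i * (real (a + b + m) + 1) - real a * real b)))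
      = (q powr (- real ((T + 1) * (m + 1)) - real a * real b) / (qfac q (T + 1) * log_factor q)) * (q powr (real a * real b) * qfac q (a + b + m) / (qfac q a * qfac q b * qfac q (a + m) * qfac q (b + m)))"
      unfolding t sum_distrib_left[symmetric] Rpoly_norm_sum[OF q ab, symmetric] using True by simp
    also have "\<dots> = (q powr (- real ((T + 1) * (m + 1)) - real a * real b) * q powr (real a * real b)) * qfac q T / (qfac q (T + 1) * log_factor q * (qfac q a * qfac q b * qfac q (a + m) * qfac q (b + m)))"
      by (simp add: T_def)
    also have "q powr (- real ((T + 1) * (m + 1)) - real a * real b) * q powr (real a * real b) = inverse (q ^ ((T + 1) * (m + 1)))"
      unfolding powr_add[symmetric] powr_realpow[OF q, symmetric] diff_add_cancel by (rule powr_minus)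
    finally show ?thesis using True by (simp add: divide_inverse mult_ac)
  qed simp
  finally show "(LINT t:{0<..}|lborel. t ^ m * Rpoly q a b m (q ^ (T' + 2) * t) * Rpoly q (a - d) (b - d) m (q ^ T' * t) / qpoch q (T - d + 2) t)
      = (if d = 0 then qfac q T / (log_factor q * q ^ ((T + 1) * (m + 1)) * qfac q (T + 1) * qfac q a * qfac q b * qfac q (a + m) * qfac q (b + m)) else 0)" .
qed

subsection \<open>The factor \<open>Q\<close>\<close>

text \<open>The infinite shifted factorial (-x; r^2), used for 0 < r < 1. Both formulas for
  \<open>Q_fun\<close> away from 1 are quotients of its values, with \<open>r\<close> equal to q or
  to 1/q.\<close>

definition qprod :: "real \<Rightarrow> real \<Rightarrow> real" where
  "qprod r x = (\<Prod>k. 1 + r ^ (2 * k) * x)"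

context
  fixes r :: real
  assumes r: "0 < r" "r < 1"
begin

lemma qprod_convergent:
  assumes x: "x > 0"
  shows "convergent_prod (\<lambda>k. 1 + r ^ (2 * k) * x)"
proof -
  have "summable (\<lambda>k. (r\<^sup>2) ^ k)" using r by (intro summable_geometric) (simp add: power_less_one_iff abs_square_less_1)
  then have "summable (\<lambda>k. r ^ (2 * k) * x)" by (intro summable_mult2) (simp add: power_mult)
  then show ?thesis using convergent_prod_iff_summable_real[of "\<lambda>k. r ^ (2 * k) * x"] r x by simp
qed

lemma qprod_nonzero: "x > 0 \<Longrightarrow> qprod r x \<noteq> 0"
  unfolding qprod_def using r by (intro prodinf_nonzero qprod_convergent) (auto simp: add_pos_pos less_imp_neq[symmetric])

lemma qprod_shift:
  assumes x: "x > 0"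
  shows "qprod r x = qpoch r n x * qprod r (r ^ (2 * n) * x)"
proof -
  have "(\<Prod>i. 1 + r ^ (2 * (i + n)) * x) = qprod r x / qpoch r n x"
    unfolding qprod_def qpoch_def using r x
    by (intro prodinf_divide_initial_segment qprod_convergent) (auto simp: add_pos_pos less_imp_neq[symmetric])
  moreover have "(\<Prod>i. 1 + r ^ (2 * (i + n)) * x) = qprod r (r ^ (2 * n) * x)"
    unfolding qprod_def by (simp add: power_add algebra_simps)
  ultimately show ?thesis using qpoch_pos[of r x n] r x by (simp add: divide_eq_eq mult.commute)
qed

lemma Q_fun_lt1:
  assumes x: "x > 0"
  shows "Q_fun J r x = qprod r x / qprod r (r powr (- 2 * J) * x)"
proof -
  have p: "r powr (2 * real k) = r ^ (2 * k)" "r powr (- 2 * J + 2 * real k) = r ^ (2 * k) * r powr (- 2 * J)" for k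
  proof -
    show 1: "r powr (2 * real k) = r ^ (2 * k)" using powr_realpow[OF r(1), of "2 * k"] by simp
    show "r powr (- 2 * J + 2 * real k) = r ^ (2 * k) * r powr (- 2 * J)" unfolding powr_add 1 by simp
  qed
  show ?thesis unfolding Q_fun_def qprod_def p mult.assoc
    using r x by (subst prodinf_divide) (auto intro!: qprod_convergent)
qed

lemma Q_fun_gt1:
  assumes x: "x > 0"
  shows "Q_fun J (inverse r) x = qprod r (r powr (2 * J + 2) * x) / qprod r (r\<^sup>2 * x)"
proof -
  have r': "inverse r > 1" "inverse r \<noteq> 1" "\<not> inverse r < 1" using one_less_inverse[OF r] by linarith+
  have p: "inverse r powr (- 2 * J - 2 * real k - 2) = r ^ (2 * k) * r powr (2 * J + 2)"
    "inverse r powr (- 2 * real k - 2) = r ^ (2 * k) * r\<^sup>2" for k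
  proof -
    have 1: "r powr (2 * real k) = r ^ (2 * k)" using powr_realpow[OF r(1), of "2 * k"] by simp
    have "inverse r powr (- 2 * J - 2 * real k - 2) = r powr (2 * real k + (2 * J + 2))"
      using r by (simp add: inverse_powr algebra_simps)
    then show "inverse r powr (- 2 * J - 2 * real k - 2) = r ^ (2 * k) * r powr (2 * J + 2)"
      unfolding powr_add[of r "2 * real k"] 1 .
    have "inverse r powr (- 2 * real k - 2) = r powr (2 * real k + 2)"
      using r by (simp add: inverse_powr algebra_simps)
    then show "inverse r powr (- 2 * real k - 2) = r ^ (2 * k) * r\<^sup>2"
      unfolding powr_add[of r "2 * real k"] 1 using r by (simp add: powr_numeral)
  qed
  show ?thesis unfolding Q_fun_def p mult.assoc qprod_def
    using r r' x by (subst prodinf_divide) (auto intro!: qprod_convergent)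
qed

end

text \<open>For p < 1, two of the four infinite products have arguments differing by p^4; their
  quotient is two factors, which cancel the weight. The arguments of the other two differ by p^(2n)
  and leave \<open>n\<close> factors. For p > 1 the base \<open>inverse p\<close> is used and the
  roles of the two \<open>Q\<close> are exchanged.\<close>

lemma Q_product:
  assumes p: "p > 0" and x: "x > 0" and n: "J + J' + 2 = real n"
  shows "Q_fun J (inverse p) x * Q_fun J' p (p powr (- 2) * x) * (1 / ((1 + x) * (1 + p powr (- 2) * x)))
    = 1 / qpoch p n (p powr (- 2 * J' - 2) * x)"
proof -
  consider "p = 1" | "p < 1" | "p > 1" by linarith
  then show ?thesis
  proof cases
    case 1
    have "(1 + x) powr (- J) * (1 + x) powr (- J') * (1 / ((1 + x) * (1 + x))) = (1 + x) powr (- J + - J' + - 2)"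
      unfolding powr_add using x by (simp add: powr_minus_two power2_eq_square inverse_eq_divide)
    also have "- J + - J' + - 2 = - real n" using n by simp
    also have "(1 + x) powr (- real n) = 1 / (1 + x) ^ n" using x by (simp add: powr_minus powr_realpow inverse_eq_divide)
    finally show ?thesis by (simp add: 1 Q_fun_def qpoch_def)
  next
    case 2
    define y where "y = p powr (- 2) * x"
    have y: "y > 0" using p x by (simp add: y_def)
    have e0: "p powr (2 * J + 2) * x = p ^ (2 * n) * (p powr (- 2 * J' - 2) * x)"
    proof -
      have "p powr (2 * J + 2) = p powr (real (2 * n) + (- 2 * J' - 2))" using n by (intro arg_cong[where f = "\<lambda>t. p powr t"]) simp
      then show ?thesis unfolding powr_add powr_realpow[OF p] by simp
    qed
    have e1: "p powr (- 2 * J') * y = p powr (- 2 * J' - 2) * x" unfolding y_def by (simp flip: powr_add mult.assoc)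
    have e2: "p\<^sup>2 * y = x" using p by (simp add: y_def powr_minus_two)
    have q1: "Q_fun J (inverse p) x = qprod p (p powr (2 * J + 2) * x) / qprod p (p\<^sup>2 * x)" by (rule Q_fun_gt1[OF p 2 x])
    have q2: "Q_fun J' p y = qprod p y / qprod p (p powr (- 2 * J' - 2) * x)" using Q_fun_lt1[OF p 2 y, of J'] unfolding e1 .
    have s1: "qprod p y = (1 + y) * qprod p x" using qprod_shift[OF p 2 y, of 1] e2 by (simp add: qpoch_def power2_eq_square)
    have s2: "qprod p x = (1 + x) * qprod p (p\<^sup>2 * x)" using qprod_shift[OF p 2 x, of 1] by (simp add: qpoch_def power2_eq_square)
    have w: "p powr (- 2 * J' - 2) * x > 0" using p x by simp
    have s3: "qprod p (p powr (- 2 * J' - 2) * x) = qpoch p n (p powr (- 2 * J' - 2) * x) * qprod p (p powr (2 * J + 2) * x)"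
      unfolding e0 by (rule qprod_shift[OF p 2 w])
    have nz: "qprod p (p\<^sup>2 * x) \<noteq> 0" "qprod p (p powr (2 * J + 2) * x) \<noteq> 0"
      by (rule qprod_nonzero[OF p 2]; use p x in simp)+
    show ?thesis unfolding y_def[symmetric] q1 q2 s3 s1 s2
      using nz x y qpoch_pos[OF p, of "p powr (- 2 * J' - 2) * x" n] w by (simp add: divide_simps)
  next
    case 3
    define r where "r = inverse p"
    have r: "0 < r" "r < 1" using p 3 by (auto simp: r_def inverse_less_1_iff)
    have pr: "p = inverse r" by (simp add: r_def)
    have e2: "p powr (- 2) = r\<^sup>2" using p by (simp add: powr_minus_two r_def power_inverse)
    define y where "y = r\<^sup>2 * x"
    have y: "y > 0" using r x by (simp add: y_def)
    define z where "z = r powr (- 2 * J) * x"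
    have z: "z > 0" using r x by (simp add: z_def)
    have q1: "Q_fun J (inverse p) x = qprod r x / qprod r z" using Q_fun_lt1[OF r x, of J] by (simp add: z_def r_def)
    have q2: "Q_fun J' p y = qprod r (r powr (2 * J' + 2) * y) / qprod r (r\<^sup>2 * y)"
      unfolding pr by (rule Q_fun_gt1[OF r y])
    have e0: "r powr (2 * J' + 2) * y = r ^ (2 * n) * z"
    proof -
      have "r powr (2 * J' + 2) * r powr 2 = r powr (real (2 * n)) * r powr (- 2 * J)"
        unfolding powr_add[symmetric] using n by (intro arg_cong[where f = "\<lambda>t. r powr t"]) simp
      then show ?thesis unfolding powr_realpow[OF r(1)] y_def z_def using r by (simp add: powr_numeral)
    qed
    have s1: "qprod r x = (1 + x) * qprod r y" using qprod_shift[OF r x, of 1] by (simp add: qpoch_def power2_eq_square y_def)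
    have s2: "qprod r y = (1 + y) * qprod r (r\<^sup>2 * y)" using qprod_shift[OF r y, of 1] by (simp add: qpoch_def power2_eq_square)
    have s3: "qprod r z = qpoch r n z * qprod r (r ^ (2 * n) * z)" by (rule qprod_shift[OF r z])
    have nz: "qprod r (r\<^sup>2 * y) \<noteq> 0" "qprod r (r ^ (2 * n) * z) \<noteq> 0"
      by (rule qprod_nonzero[OF r]; use r y z in simp)+
    \<comment> \<open>With base \<open>inverse p\<close> the same finite product appears with its
      factors in reverse order.\<close>
    have rev: "qpoch r n z = qpoch p n (p powr (- 2 * J' - 2) * x)"
    proof -
      have "r ^ (2 * (n - Suc j)) * z = p ^ (2 * j) * (p powr (- 2 * J' - 2) * x)" if j: "j < n" for j
      proof -
        have "r powr (real (2 * (n - Suc j))) * r powr (- 2 * J) = r powr (- real (2 * j)) * r powr (2 * J' + 2)"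
          unfolding powr_add[symmetric] using n j by (intro arg_cong[where f = "\<lambda>t. r powr t"]) (simp add: of_nat_diff)
        moreover have "r powr (- real (2 * j)) = p ^ (2 * j)" using r by (simp only: powr_minus powr_realpow[OF r(1)] pr power_inverse)
        moreover have "r powr (2 * J' + 2) = p powr (- 2 * J' - 2)" using p by (simp add: r_def inverse_powr)
        ultimately show ?thesis unfolding powr_realpow[OF r(1)] z_def by simp
      qed
      then show ?thesis unfolding qpoch_def by (subst prod.nat_diff_reindex[symmetric]) (auto intro!: prod.cong)
    qed
    show ?thesis unfolding e2 y_def[symmetric] q1 q2 e0 s3 s1 s2 rev[symmetric]
      using nz x y qpoch_pos[OF r(1), of z n] z by (simp add: divide_simps)
  qed
qed

subsection \<open>The basis functions\<close>

text \<open>For \<open>m < 0\<close> the lowest power of \<open>\<eta>\<close> in \<open>R\<close> turns \<open>cnj z powi m\<close> into \<open>z ^ (- m)\<close>.\<close>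

definition phase_mono :: "int \<Rightarrow> complex \<Rightarrow> complex" where
  "phase_mono m z = (if m \<ge> 0 then z ^ nat m else cnj z ^ nat (- m))"

lemma phase_mono_polar: "phase_mono m (of_real r * cis \<phi>) = of_real r ^ nat \<bar>m\<bar> * cis (of_int m * \<phi>)"
proof (cases "m \<ge> 0")
  case True
  then show ?thesis using Complex.DeMoivre[of \<phi> "nat m"] by (simp add: phase_mono_def power_mult_distrib)
next
  case False
  then show ?thesis using Complex.DeMoivre[of "- \<phi>" "nat (- m)"] by (simp add: phase_mono_def power_mult_distrib cis_cnj)
qed

lemma norm_phase_mono: "norm (phase_mono m z) = norm z ^ nat \<bar>m\<bar>"
  by (auto simp: phase_mono_def norm_power)

lemma phase_mono_scale: "phase_mono m (of_real c * z) = of_real c ^ nat \<bar>m\<bar> * phase_mono m z"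
  by (auto simp: phase_mono_def power_mult_distrib)

lemma continuous_phase_mono: "continuous_on A (phase_mono m)"
  unfolding phase_mono_def by (cases "m \<ge> 0") (auto intro!: continuous_intros)

lemma phase_mono_self: "phase_mono m z * cnj (phase_mono m z) = of_real (((norm z)\<^sup>2) ^ nat \<bar>m\<bar>)"
  unfolding complex_norm_square[symmetric] norm_phase_mono by (simp add: power_mult[symmetric] mult.commute)

abbreviation Psi1 :: "real \<Rightarrow> real \<Rightarrow> real \<Rightarrow> wavefun" where
  "Psi1 \<equiv> Psi (\<lambda>_ _ _. 1)"

text \<open>The product of \<open>N_coeff\<close> and the factorial prefactor of
  \<open>R_fun\<close>, under one root. It involves the factorials of J - N, J + N, J - M, J + M
  symmetrically, hence has the same form for both signs of \<open>M + N\<close>.\<close>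

definition psi_const :: "real \<Rightarrow> nat \<Rightarrow> nat \<Rightarrow> nat \<Rightarrow> real" where
  "psi_const q a b \<mu> = sqrt (qfac q (a + b + \<mu> + 1) * (qfac q a * qfac q b * qfac q (a + \<mu>) * qfac q (b + \<mu>)) / (2 * pi * qfac q (a + b + \<mu>)))"

text \<open>For negative \<open>m\<close> the sum starts at \<open>k = \<mu>\<close>. Shifting the
  index exchanges the roles of [k]! and [M+N+k]!, and extracts the sign (-1)^\<mu> and a power of
  the squared norm that compensates the negative power of \<open>cnj z\<close>.\<close>

lemma Rpoly_R_fun:
  assumes q: "q > 0" and n: "J - N = real jn" "J - M = real jm" and m: "M + N = of_int m"
  defines "\<mu> \<equiv> nat \<bar>m\<bar>"
  assumes ab: "a \<le> b" and c: "m \<ge> 0 \<Longrightarrow> {a, b} = {jn, jm}"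
    "m < 0 \<Longrightarrow> {a + \<mu>, b + \<mu>} = {jn, jm}" and z: "z \<noteq> 0"
  shows "of_real (R_fun J M N q ((norm z)\<^sup>2)) * cnj z powi m = of_real ((if m < 0 then (- 1) ^ \<mu> else 1) * qfac q jn * qfac q jm * Rpoly q a b \<mu> ((norm z)\<^sup>2)) * cnj (phase_mono m z)"
proof -
  define \<eta> where "\<eta> = (norm z)\<^sup>2"
  have qf: "qfact q (J - N) = qfac q jn" "qfact q (J - M) = qfac q jm"
    using n by (auto intro: qfact_eq_qfac)
  show ?thesis
  proof (cases "m \<ge> 0")
    case True
    then have m': "M + N = real \<mu>" using m by (simp add: \<mu>_def)
    have set: "{k. real k \<le> J - M \<and> real k \<le> J - N \<and> 0 \<le> M + N + real k} = {..a}"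
      using c(1)[OF True] ab unfolding n m' by (auto simp: doubleton_eq_iff)
    have "R_fun J M N q \<eta> = qfac q jn * qfac q jm * Rpoly q a b \<mu> \<eta>"
      unfolding R_fun_def qf set Rpoly_def
    proof (intro arg_cong2[where f = "(*)"] refl sum.cong)
      fix k assume k: "k \<in> {..a}"
      then have kk: "k \<le> jn" "k \<le> jm" using c(1)[OF True] ab by (auto simp: doubleton_eq_iff)
      have f: "qfact q (real k) = qfac q k" "qfact q (J - M - real k) = qfac q (jm - k)"
        "qfact q (J - N - real k) = qfac q (jn - k)" "qfact q (M + N + real k) = qfac q (\<mu> + k)"
        using kk n m' by (auto intro!: qfact_eq_qfac simp: of_nat_diff)
      show "(- \<eta>) ^ k / (qfact q (real k) * qfact q (J - M - real k) * qfact q (J - N - real k) * qfact q (M + N + real k))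
        = (- \<eta>) ^ k / (qfac q k * qfac q (a - k) * qfac q (b - k) * qfac q (\<mu> + k))"
        unfolding f using c(1)[OF True] by (auto simp: doubleton_eq_iff mult_ac)
    qed
    moreover have "cnj z powi m = cnj (phase_mono m z)" using True by (simp add: phase_mono_def power_int_def)
    ultimately show ?thesis using True by (simp add: \<eta>_def)
  next
    case False
    then have m': "M + N = - real \<mu>" using m by (simp add: \<mu>_def)
    have neg: "m < 0" using False by simp
    have set: "{k. real k \<le> J - M \<and> real k \<le> J - N \<and> 0 \<le> M + N + real k} = (\<lambda>k. k + \<mu>) ` {..a}"
    proof -
      have "{k. real k \<le> J - M \<and> real k \<le> J - N \<and> 0 \<le> M + N + real k} = {\<mu>..a + \<mu>}"
        using c(2)[OF neg] ab unfolding n m' by (auto simp: doubleton_eq_iff)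
      also have "\<dots> = (\<lambda>k. k + \<mu>) ` {..a}" by (simp add: atLeast0AtMost[symmetric])
      finally show ?thesis .
    qed
    have "R_fun J M N q \<eta> = qfac q jn * qfac q jm * (\<Sum>k\<le>a. (- \<eta>) ^ \<mu> * ((- \<eta>) ^ k / (qfac q k * qfac q (a - k) * qfac q (b - k) * qfac q (\<mu> + k))))"
      unfolding R_fun_def qf set
    proof (subst sum.reindex, simp add: inj_on_def, intro arg_cong2[where f = "(*)"] refl sum.cong)
      fix k assume k: "k \<in> {..a}"
      then have kk: "k + \<mu> \<le> jn" "k + \<mu> \<le> jm" using c(2)[OF neg] ab by (auto simp: doubleton_eq_iff)
      have f: "qfact q (real (k + \<mu>)) = qfac q (\<mu> + k)" "qfact q (J - M - real (k + \<mu>)) = qfac q (jm - (k + \<mu>))"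
        "qfact q (J - N - real (k + \<mu>)) = qfac q (jn - (k + \<mu>))" "qfact q (M + N + real (k + \<mu>)) = qfac q k"
        using kk n m' by (auto intro!: qfact_eq_qfac simp: of_nat_diff)
      have g: "qfac q (jm - (k + \<mu>)) * qfac q (jn - (k + \<mu>)) = qfac q (a - k) * qfac q (b - k)"
        using c(2)[OF neg] by (auto simp: doubleton_eq_iff mult_ac)
      have h: "A / (B * X * Y * D) = P * (Q / (D * U * V * B))" if "X * Y = U * V" "A = P * Q" for A B X Y D P Q U V :: real
      proof -
        have "A / (B * X * Y * D) = A / (B * (X * Y) * D)" by (simp add: mult_ac)
        then show ?thesis unfolding that by (simp add: mult_ac)
      qed
      show "((\<lambda>k. (- \<eta>) ^ k / (qfact q (real k) * qfact q (J - M - real k) * qfact q (J - N - real k) * qfact q (M + N + real k))) \<circ> (\<lambda>k. k + \<mu>)) k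
        = (- \<eta>) ^ \<mu> * ((- \<eta>) ^ k / (qfac q k * qfac q (a - k) * qfac q (b - k) * qfac q (\<mu> + k)))"
        unfolding o_def f by (rule h[OF g]) (simp add: power_add)
    qed
    also have "\<dots> = qfac q jn * qfac q jm * ((- \<eta>) ^ \<mu> * Rpoly q a b \<mu> \<eta>)"
      by (simp add: Rpoly_def sum_distrib_left)
    finally have R: "R_fun J M N q \<eta> = \<eta> ^ \<mu> * ((- 1) ^ \<mu> * qfac q jn * qfac q jm * Rpoly q a b \<mu> \<eta>)"
      by (simp add: power_minus[of \<eta>])
    have "of_real (\<eta> ^ \<mu>) * cnj z powi m = cnj (phase_mono m z)"
    proof -
      have "cnj z powi m = inverse (cnj z ^ \<mu>)" using neg by (simp add: power_int_def \<mu>_def power_inverse)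
      moreover have "complex_of_real (\<eta> ^ \<mu>) = z ^ \<mu> * cnj z ^ \<mu>"
        by (simp add: \<eta>_def complex_norm_square[symmetric] power_mult_distrib[symmetric] flip: of_real_power)
      ultimately show ?thesis using z neg by (simp add: phase_mono_def \<mu>_def)
    qed
    moreover have "of_real (X * Y) * P = of_real Y * Z" if "of_real X * P = Z" for X Y :: real and P Z :: complex
      unfolding that[symmetric] by simp
    ultimately show ?thesis unfolding \<eta>_def[symmetric] R using neg by simp
  qed
qed

text \<open>J - N and J + N are J - |N| increased by 0 or by the natural number 2|N|; J - M is then
  their sum minus J + M.\<close>

lemma basis_indexE:
  assumes N: "2 * N \<in> \<int>" and i: "(J, M) \<in> basis_index N"
  obtains jn jn' jm jm' :: nat and m :: int where "J - N = real jn" "J + N = real jn'" "J - M = real jm" "J + M = real jm'"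
    "M + N = of_int m" "\<lfloor>M + N\<rfloor> = m"
proof -
  obtain k where k: "J - \<bar>N\<bar> = real k" using i by (auto simp: basis_index_def elim: Nats_cases)
  obtain jm' where jm': "J + M = real jm'" using i by (auto simp: basis_index_def elim: Nats_cases)
  obtain i2 where i2: "2 * N = of_int i2" using N by (auto elim: Ints_cases)
  have "J - N = real (k + nat (\<bar>i2\<bar> - i2) div 2 * 0 + (if N \<ge> 0 then 0 else nat (- i2)))" 
    "J + N = real (k + (if N \<ge> 0 then nat i2 else 0))" using k i2 by (auto simp: abs_if split: if_splits)
  then obtain jn jn' where j: "J - N = real jn" "J + N = real jn'" by blast
  have MJ: "M \<le> J" using i by (simp add: basis_index_def)
  have "J - M = of_int (int jn + int jn' - int jm')" using j jm' by simp
  moreover from this have "int jn + int jn' - int jm' \<ge> 0" using MJ by linarith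
  ultimately have jm: "J - M = real (nat (int jn + int jn' - int jm'))" by simp
  have m: "M + N = of_int (int jm' - int jn)" using j jm' by simp
  show ?thesis by (rule that[OF j jm jm' m]) (simp only: m floor_of_int)
qed

lemma N_coeff_eq:
  assumes q: "q > 0" and j: "J - N = real jn" "J + N = real jn'" "J - M = real jm" "J + M = real jm'" "2 * J = real T"
    and F: "qfac q a * qfac q b * qfac q (a + \<mu>) * qfac q (b + \<mu>) = qfac q jn * qfac q jn' * qfac q jm * qfac q jm'"
    and T: "T = a + b + \<mu>"
  shows "N_coeff (\<lambda>_ _ _. 1) J M N q * (qfac q jn * qfac q jm) = psi_const q a b \<mu>"
proof (rule power2_eq_imp_eq)
  have f: "qfact q (J - N) = qfac q jn" "qfact q (J + N) = qfac q jn'" "qfact q (J - M) = qfac q jm"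
    "qfact q (J + M) = qfac q jm'" "qfact q (2 * J) = qfac q T" "qfact q (2 * J + 1) = qfac q (T + 1)"
    using j by (auto intro!: qfact_eq_qfac)
  have pos: "qfac q n \<ge> 0" for n using qfac_pos[OF q, of n] by simp
  show "0 \<le> N_coeff (\<lambda>_ _ _. 1) J M N q * (qfac q jn * qfac q jm)" "0 \<le> psi_const q a b \<mu>"
    unfolding N_coeff_def C_coeff_def f psi_const_def using pos by auto
  have "(N_coeff (\<lambda>_ _ _. 1) J M N q * (qfac q jn * qfac q jm))\<^sup>2 =
     (1 / (2 * pi)) * (qfac q jn' * qfac q (T + 1) / qfac q jn) * (qfac q jm' / (qfac q jm * qfac q T)) * (qfac q jn * qfac q jm)\<^sup>2"
    unfolding N_coeff_def C_coeff_def f using pos by (simp add: power_mult_distrib power_divide)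
  also have "\<dots> = qfac q (T + 1) * (qfac q jn * qfac q jn' * qfac q jm * qfac q jm') / (2 * pi * qfac q T)"
    using q by (simp add: power2_eq_square divide_simps)
  also have "\<dots> = (psi_const q a b \<mu>)\<^sup>2"
    unfolding psi_const_def F[symmetric] T using pos by simp
  finally show "(N_coeff (\<lambda>_ _ _. 1) J M N q * (qfac q jn * qfac q jm))\<^sup>2 = (psi_const q a b \<mu>)\<^sup>2" .
qed

definition psi_sign :: "int \<Rightarrow> real" where
  "psi_sign m = (if m < 0 then (- 1) ^ nat \<bar>m\<bar> else 1)"

lemma psi_sign_square: "psi_sign m * psi_sign m = 1"
  by (simp add: psi_sign_def flip: power_mult_distrib)

text \<open>One normal form for both signs of \<open>M + N\<close>. For fixed M and N the degree
  \<open>a\<close> differs from J by a constant, so differences of degrees are differences of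
  J.\<close>

lemma Psi_form:
  assumes N: "2 * N \<in> \<int>" and i: "(J, M) \<in> basis_index N"
  obtains a b :: nat and m :: int where "real a = J - max \<bar>M\<bar> \<bar>N\<bar>" "a \<le> b" "M + N = of_int m" "real (a + b + nat \<bar>m\<bar>) = 2 * J"
    "\<And>q z. q > 0 \<Longrightarrow> z \<noteq> 0 \<Longrightarrow> Psi1 J M N q z =
      of_real (psi_sign m * psi_const q a b (nat \<bar>m\<bar>) * q powr (- N * M / 2) * Q_fun J q ((norm z)\<^sup>2) * Rpoly q a b (nat \<bar>m\<bar>) ((norm z)\<^sup>2)) * cnj (phase_mono m z)"
proof -
  obtain jn jn' jm jm' :: nat and m :: int where j: "J - N = real jn" "J + N = real jn'" "J - M = real jm" "J + M = real jm'"
    and m: "M + N = of_int m" "\<lfloor>M + N\<rfloor> = m" using basis_indexE[OF N i] by blast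
  define \<mu> where "\<mu> = nat \<bar>m\<bar>"
  define a b where "a = (if m \<ge> 0 then min jn jm else min jn' jm')" and "b = (if m \<ge> 0 then max jn jm else max jn' jm')"
  have pos: "m \<ge> 0 \<Longrightarrow> jm' = jn + \<mu> \<and> jn' = jm + \<mu>"
  proof -
    assume "m \<ge> 0"
    then have "real jm' = real (jn + \<mu>) \<and> real jn' = real (jm + \<mu>)" using j m by (simp add: \<mu>_def)
    then show ?thesis by (simp only: of_nat_eq_iff)
  qed
  have neg: "m < 0 \<Longrightarrow> jn = jm' + \<mu> \<and> jm = jn' + \<mu>"
  proof -
    assume "m < 0"
    then have "real jn = real (jm' + \<mu>) \<and> real jm = real (jn' + \<mu>)" using j m by (simp add: \<mu>_def)
    then show ?thesis by (simp only: of_nat_eq_iff)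
  qed
  have ab: "a \<le> b" by (auto simp: a_def b_def min_le_iff_disj le_max_iff_disj)
  have ra: "real a = J - max \<bar>M\<bar> \<bar>N\<bar>"
  proof (cases "m \<ge> 0")
    case True
    then have "M + N \<ge> 0" using m by simp
    then have "max \<bar>M\<bar> \<bar>N\<bar> = max M N" by (auto simp: max_def abs_if)
    then show ?thesis using True j by (auto simp: a_def min_def max_def)
  next
    case False
    then have "M + N \<le> 0" using m by simp
    then have "max \<bar>M\<bar> \<bar>N\<bar> = max (- M) (- N)" by (auto simp: max_def abs_if)
    then show ?thesis using False j by (auto simp: a_def min_def max_def)
  qed
  have sum: "real (a + b + \<mu>) = 2 * J"
  proof (cases "m \<ge> 0")
    case True
    have "a + b = jn + jm" using True by (simp add: a_def b_def)
    then show ?thesis using True pos[OF True] j by simp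
  next
    case False
    have "a + b = jn' + jm'" using False by (simp add: a_def b_def)
    then show ?thesis using False neg j by simp
  qed
  have F: "qfac q a * qfac q b * qfac q (a + \<mu>) * qfac q (b + \<mu>) = qfac q jn * qfac q jn' * qfac q jm * qfac q jm'" for q
    using pos neg by (cases "m \<ge> 0") (auto simp: a_def b_def min_def max_def mult_ac)
  have c: "m \<ge> 0 \<Longrightarrow> {a, b} = {jn, jm}" "m < 0 \<Longrightarrow> {a + \<mu>, b + \<mu>} = {jn, jm}"
    using neg by (auto simp: a_def b_def min_def max_def)
  have "Psi1 J M N q z =
      of_real (psi_sign m * psi_const q a b \<mu> * q powr (- N * M / 2) * Q_fun J q ((norm z)\<^sup>2) * Rpoly q a b \<mu> ((norm z)\<^sup>2)) * cnj (phase_mono m z)"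
    if q: "q > 0" and z: "z \<noteq> 0" for q z
  proof -
    note R = Rpoly_R_fun[OF q j(1) j(3) m(1) ab c[unfolded \<mu>_def] z, folded \<mu>_def psi_sign_def]
    have K: "N_coeff (\<lambda>_ _ _. 1) J M N q * (qfac q jn * qfac q jm) = psi_const q a b \<mu>"
      by (rule N_coeff_eq[OF q j sum[symmetric] F refl])
    have alg: "of_real (n * Q * P * R) * C = of_real (s * k * P * Q * r) * e"
      if "of_real R * C = of_real (s * x * y * r) * e" "n * (x * y) = k" for n Q P R s k r x y :: real and C e :: complex
    proof -
      have "of_real (n * Q * P * R) * C = of_real (n * Q * P) * (of_real R * C)" by simp
      then show ?thesis unfolding that(1) that(2)[symmetric] by (simp add: mult_ac)
    qed
    show ?thesis unfolding Psi_def m(2) by (rule alg[OF R[unfolded psi_sign_def] K, folded psi_sign_def])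
  qed
  then show ?thesis using that[OF ra ab m(1) sum[unfolded \<mu>_def]] unfolding \<mu>_def by blast
qed

lemma Rpoly_inverse: "q > 0 \<Longrightarrow> Rpoly (inverse q) a b m = Rpoly q a b m"
  by (simp add: Rpoly_def fun_eq_iff qfac_inverse)

lemma psi_const_inverse: "q > 0 \<Longrightarrow> psi_const (inverse q) a b m = psi_const q a b m"
  by (simp add: psi_const_def qfac_inverse)

section \<open>Convergence of the scalar products of basis functions\<close>

lemma Rpoly_bound:
  assumes ab: "a \<le> b" and c: "c \<ge> 0"
  obtains C where "\<And>r. r \<ge> 0 \<Longrightarrow> \<bar>Rpoly q a b \<mu> (c * r\<^sup>2)\<bar> * r ^ \<mu> \<le> C * sqrt (1 + r\<^sup>2) ^ (a + b + \<mu>)"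
proof
  fix r :: real assume r: "r \<ge> 0"
  define s where "s = sqrt (1 + r\<^sup>2)"
  have s: "1 \<le> s" "r \<le> s" using r by (auto simp: s_def real_le_rsqrt)
  define u where "u k = c ^ k / \<bar>qfac q k * qfac q (a - k) * qfac q (b - k) * qfac q (\<mu> + k)\<bar>" for k
  have "\<bar>Rpoly q a b \<mu> (c * r\<^sup>2)\<bar> * r ^ \<mu> \<le> (\<Sum>k\<le>a. \<bar>(- (c * r\<^sup>2)) ^ k / (qfac q k * qfac q (a - k) * qfac q (b - k) * qfac q (\<mu> + k))\<bar>) * r ^ \<mu>"
    unfolding Rpoly_def using r by (intro mult_right_mono sum_abs) auto
  also have "\<dots> = (\<Sum>k\<le>a. u k * r ^ (2 * k + \<mu>))"
    unfolding sum_distrib_right u_def using c r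
    by (intro sum.cong refl) (simp add: abs_divide power_abs abs_mult power_mult_distrib power_add power_mult)
  also have "\<dots> \<le> (\<Sum>k\<le>a. u k * s ^ (a + b + \<mu>))"
  proof (intro sum_mono mult_left_mono)
    fix k assume "k \<in> {..a}"
    then have "r ^ (2 * k + \<mu>) \<le> s ^ (2 * k + \<mu>)" "2 * k + \<mu> \<le> a + b + \<mu>" using r s ab by (auto intro: power_mono)
    then show "r ^ (2 * k + \<mu>) \<le> s ^ (a + b + \<mu>)" using s(1) by (meson order_trans power_increasing)
    show "0 \<le> u k" using c by (simp add: u_def)
  qed
  finally show "\<bar>Rpoly q a b \<mu> (c * r\<^sup>2)\<bar> * r ^ \<mu> \<le> (\<Sum>k\<le>a. c ^ k / \<bar>qfac q k * qfac q (a - k) * qfac q (b - k) * qfac q (\<mu> + k)\<bar>) * sqrt (1 + r\<^sup>2) ^ (a + b + \<mu>)"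
    by (simp add: sum_distrib_right s_def u_def)
qed

lemma continuous_Rpoly: "continuous_on A f \<Longrightarrow> continuous_on A (\<lambda>x. Rpoly q a b \<mu> (f x))"
  unfolding Rpoly_def divide_inverse by (intro continuous_intros)

interpretation eta: radial_chart "{0<..}" sqrt "\<lambda>x. inverse (sqrt x) / 2"
proof
  show "continuous_on {0<..} (\<lambda>x. inverse (sqrt x) / 2)" by (intro continuous_intros) auto
  show "sqrt ` {0<..} = {0<..}"
  proof (intro equalityI subsetI)
    fix x :: real assume "x \<in> {0<..}"
    then show "x \<in> sqrt ` {0<..}" by (intro image_eqI[of _ _ "x\<^sup>2"]) auto
  qed auto
qed (auto intro!: derivative_eq_intros inj_onI)

text \<open>In the variable |z|^2 the Jacobian is the constant 1/2, and the full angle turns it into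
  pi.\<close>

lemma integral_radial:
  fixes f :: "complex \<Rightarrow> complex" and F :: "real \<Rightarrow> real"
  assumes f: "integrable lborel f" and F: "\<And>z. z \<noteq> 0 \<Longrightarrow> f z = of_real (F ((norm z)\<^sup>2))"
  shows "(LINT z|lborel. f z) = of_real (pi * (LINT t:{0<..}|lborel. F t))"
proof -
  have "(LINT \<phi>|lborel. eta.jac (t, \<phi>) *\<^sub>R f (eta.chart (t, \<phi>))) = of_real (indicator {0<..} t *\<^sub>R (pi * F t))" for t
  proof (cases "t > 0")
    case True
    have "(LINT \<phi>|lborel. eta.jac (t, \<phi>) *\<^sub>R f (eta.chart (t, \<phi>))) = (LINT \<phi>|lborel. indicator {0..<2*pi} \<phi> *\<^sub>R (of_real (F t) / 2))"
      using True F[of "of_real (sqrt t) * cis _"]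
      by (intro Bochner_Integration.integral_cong refl)
        (auto simp: eta.jac_def eta.chart_def indicator_def mem_Times_iff norm_mult abs_mult scaleR_conv_of_real)
    also have "\<dots> = of_real (pi * F t)" by (simp add: scaleR_conv_of_real)
    finally show ?thesis using True by simp
  next
    case False
    then show ?thesis by (simp add: eta.jac_def)
  qed
  then show ?thesis
    unfolding eta.integral_chart_fst[OF f] by (simp only: set_lebesgue_integral_def integral_complex_of_real) (simp add: mult.left_commute[of _ pi] del: of_real_mult)
qed

lemma sqrt_weight: "norm z * (1 + 1 * (norm z)\<^sup>2) \<le> sqrt (1 + (norm z)\<^sup>2) ^ 4" for z :: complex
proof -
  have "0 \<le> (norm z - 1)\<^sup>2" by simp
  then have "2 * norm z \<le> 1 + (norm z)\<^sup>2" by (simp add: power2_diff)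
  then have "norm z \<le> 1 + (norm z)\<^sup>2" using norm_ge_zero[of z] by linarith
  then have "norm z * (1 + (norm z)\<^sup>2) \<le> (1 + (norm z)\<^sup>2) * (1 + (norm z)\<^sup>2)" by (intro mult_right_mono) auto
  also have "\<dots> = (sqrt (1 + (norm z)\<^sup>2) ^ 2) ^ 2" by (simp add: power2_eq_square)
  also have "\<dots> = sqrt (1 + (norm z)\<^sup>2) ^ 4" by (simp only: power_mult[symmetric]) simp
  finally show ?thesis by simp
qed

text \<open>Of the exponent of \<open>inverse p\<close>, the part |m'| comes from the dilated phase
  monomial and the 1 from the explicit factor in the scalar product. The power of \<open>p\<close>
  with N M and N M' has opposite signs because the left factor is taken at \<open>inverse p\<close>;
  it disappears for M = M'.\<close>

lemma half_Psi_form: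
  assumes N: "2 * N \<in> \<int>" and p: "p > 0" and i: "(J, M) \<in> basis_index N" "(J', M') \<in> basis_index N"
  obtains a b a' b' T' n :: nat and m m' :: int where
    "real a = J - max \<bar>M\<bar> \<bar>N\<bar>" "a \<le> b" "M + N = of_int m" "real (a + b + nat \<bar>m\<bar>) = 2 * J"
    "real a' = J' - max \<bar>M'\<bar> \<bar>N\<bar>" "a' \<le> b'" "M' + N = of_int m'" "a' + b' + nat \<bar>m'\<bar> = T'" "real T' = 2 * J'"
    "J + J' + 2 = real n"
    "\<forall>z. z \<noteq> 0 \<longrightarrow> half_integrand p (Psi1 J M N) (Psi1 J' M' N) z =
      of_real ((psi_sign m * psi_sign m' * psi_const p a b (nat \<bar>m\<bar>) * psi_const p a' b' (nat \<bar>m'\<bar>) * p powr (N * M / 2 - N * M' / 2) * inverse p ^ (nat \<bar>m'\<bar> + 1))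
        * (Rpoly p a b (nat \<bar>m\<bar>) ((norm z)\<^sup>2) * Rpoly p a' b' (nat \<bar>m'\<bar>) (p powr (- 2) * (norm z)\<^sup>2) / qpoch p n (inverse p ^ (T' + 2) * (norm z)\<^sup>2)))
      * (phase_mono m z * cnj (phase_mono m' z))"
proof -
  obtain a b m where A: "real a = J - max \<bar>M\<bar> \<bar>N\<bar>" "a \<le> b" "M + N = of_int m" "real (a + b + nat \<bar>m\<bar>) = 2 * J"
    and P: "\<And>q z. q > 0 \<Longrightarrow> z \<noteq> 0 \<Longrightarrow> Psi1 J M N q z =
      of_real (psi_sign m * psi_const q a b (nat \<bar>m\<bar>) * q powr (- N * M / 2) * Q_fun J q ((norm z)\<^sup>2) * Rpoly q a b (nat \<bar>m\<bar>) ((norm z)\<^sup>2)) * cnj (phase_mono m z)"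
    using Psi_form[OF N i(1)] by blast
  obtain a' b' m' where A': "real a' = J' - max \<bar>M'\<bar> \<bar>N\<bar>" "a' \<le> b'" "M' + N = of_int m'" "real (a' + b' + nat \<bar>m'\<bar>) = 2 * J'"
    and P': "\<And>q z. q > 0 \<Longrightarrow> z \<noteq> 0 \<Longrightarrow> Psi1 J' M' N q z =
      of_real (psi_sign m' * psi_const q a' b' (nat \<bar>m'\<bar>) * q powr (- N * M' / 2) * Q_fun J' q ((norm z)\<^sup>2) * Rpoly q a' b' (nat \<bar>m'\<bar>) ((norm z)\<^sup>2)) * cnj (phase_mono m' z)"
    using Psi_form[OF N i(2)] by blast
  define T' where "T' = a' + b' + nat \<bar>m'\<bar>"
  have T': "real T' = 2 * J'" using A' by (simp add: T'_def)
  obtain jn jn' where j: "J - N = real jn" "J' + N = real jn'"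
    using basis_indexE[OF N i(1)] basis_indexE[OF N i(2)] by metis
  define n where "n = jn + jn' + 2"
  have n: "J + J' + 2 = real n" using j by (simp add: n_def)
  have "half_integrand p (Psi1 J M N) (Psi1 J' M' N) z =
      of_real ((psi_sign m * psi_sign m' * psi_const p a b (nat \<bar>m\<bar>) * psi_const p a' b' (nat \<bar>m'\<bar>) * p powr (N * M / 2 - N * M' / 2) * inverse p ^ (nat \<bar>m'\<bar> + 1))
        * (Rpoly p a b (nat \<bar>m\<bar>) ((norm z)\<^sup>2) * Rpoly p a' b' (nat \<bar>m'\<bar>) (p powr (- 2) * (norm z)\<^sup>2) / qpoch p n (inverse p ^ (T' + 2) * (norm z)\<^sup>2)))
      * (phase_mono m z * cnj (phase_mono m' z))" if z: "z \<noteq> 0" for z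
  proof -
    define x where "x = (norm z)\<^sup>2"
    have x: "x > 0" using z by (simp add: x_def)
    have ip: "inverse p > 0" using p by simp
    have z': "of_real (inverse p) * z \<noteq> 0" using z p by simp
    have nz: "(norm (of_real (inverse p) * z))\<^sup>2 = p powr (- 2) * x"
      using p by (simp add: norm_mult norm_inverse power_mult_distrib x_def powr_minus_two power_inverse)
    have "- 2 * J' - 2 = - real (T' + 2)" by (simp add: T')
    then have "p powr (- 2 * J' - 2) = p powr (- real (T' + 2))" by (simp only:)
    also have "\<dots> = inverse p ^ (T' + 2)" by (simp only: powr_minus powr_realpow[OF p] power_inverse)
    finally have e: "p powr (- 2 * J' - 2) = inverse p ^ (T' + 2)" .
    have Q: "Q_fun J (inverse p) x * Q_fun J' p (p powr (- 2) * x) * (1 / ((1 + x) * (1 + p powr (- 2) * x))) = 1 / qpoch p n (inverse p ^ (T' + 2) * x)"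
      using Q_product[OF p x n] unfolding e .
    have k: "inverse p powr (- N * M / 2) * p powr (- N * M' / 2) = p powr (N * M / 2 - N * M' / 2)"
      unfolding inverse_powr[OF p] powr_add[symmetric] by simp
    have alg: "cnj (of_real (s * K * i1 * Q1 * R1) * cnj e) * of_real W * (of_real ip * (of_real (s' * K' * i2 * Q2 * R2) * cnj (of_real ip ^ \<mu> * e')))
      = of_real ((s * s' * K * K' * ii * ip ^ (\<mu> + 1)) * (R1 * R2 / D)) * (e * cnj e')"
      if "Q1 * Q2 * W = 1 / D" "i1 * i2 = ii" for s K i1 Q1 R1 W s' K' i2 Q2 R2 ii D ip :: real and e e' :: complex and \<mu>
    proof -
      have "cnj (of_real (s * K * i1 * Q1 * R1) * cnj e) * of_real W * (of_real ip * (of_real (s' * K' * i2 * Q2 * R2) * cnj (of_real ip ^ \<mu> * e')))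
       = of_real ((s * s' * K * K' * (i1 * i2) * ip ^ (\<mu> + 1)) * (R1 * R2 * (Q1 * Q2 * W))) * (e * cnj e')"
        by (simp add: mult_ac)
      then show ?thesis unfolding that by simp
    qed
    show ?thesis
      unfolding half_integrand_def P[OF ip z] P'[OF p z'] nz x_def[symmetric] Rpoly_inverse[OF p] psi_const_inverse[OF p] phase_mono_scale
      by (rule alg[OF Q k])
  qed
  then show ?thesis by (intro that[OF A A'(1,2,3) T'_def[symmetric] T' n]) simp
qed

text \<open>Convergence is read off from degrees instead of being derived from
  \<open>admissible\<close>: the numerators grow at most like |z| to the powers 2 J and 2 J', the
  denominator like the power 2 (J + J' + 2).\<close>

lemma integrable_half_Psi:
  assumes N: "2 * N \<in> \<int>" and p: "p > 0" and i: "(J, M) \<in> basis_index N" "(J', M') \<in> basis_index N"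
  shows "integrable lborel (half_integrand p (Psi1 J M N) (Psi1 J' M' N))" (is "integrable _ ?h")
    and "continuous_on (- {0}) (half_integrand p (Psi1 J M N) (Psi1 J' M' N))"
proof -
  obtain a b a' b' T' n m m' where A0: "real a = J - max \<bar>M\<bar> \<bar>N\<bar>" "a \<le> b" "M + N = of_int m" "real (a + b + nat \<bar>m\<bar>) = 2 * J"
    "real a' = J' - max \<bar>M'\<bar> \<bar>N\<bar>" "a' \<le> b'" "M' + N = of_int m'" "a' + b' + nat \<bar>m'\<bar> = T'" "real T' = 2 * J'" "J + J' + 2 = real n"
    and H: "\<forall>z. z \<noteq> 0 \<longrightarrow> ?h z =
      of_real ((psi_sign m * psi_sign m' * psi_const p a b (nat \<bar>m\<bar>) * psi_const p a' b' (nat \<bar>m'\<bar>) * p powr (N * M / 2 - N * M' / 2) * inverse p ^ (nat \<bar>m'\<bar> + 1))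
        * (Rpoly p a b (nat \<bar>m\<bar>) ((norm z)\<^sup>2) * Rpoly p a' b' (nat \<bar>m'\<bar>) (p powr (- 2) * (norm z)\<^sup>2) / qpoch p n (inverse p ^ (T' + 2) * (norm z)\<^sup>2)))
      * (phase_mono m z * cnj (phase_mono m' z))"
    by (rule half_Psi_form[OF N p i]) (rule that)
  note A = A0(2,4,6,8,9,10)
  define \<mu> \<mu>' k where "\<mu> = nat \<bar>m\<bar>" and "\<mu>' = nat \<bar>m'\<bar>" and "k = inverse p ^ (T' + 2)"
  define c where "c = psi_sign m * psi_sign m' * psi_const p a b \<mu> * psi_const p a' b' \<mu>' * p powr (N * M / 2 - N * M' / 2) * inverse p ^ (\<mu>' + 1)"
  have k: "k > 0" using p by (simp add: k_def)
  note H' = H[rule_format, folded \<mu>_def \<mu>'_def k_def, folded c_def]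
  have pos: "qpoch p n (k * (norm z)\<^sup>2) > 0" for z :: complex using p k by (intro qpoch_pos) auto
  have cq: "continuous_on (- {0}) (\<lambda>z::complex. qpoch p n (k * (norm z)\<^sup>2))"
    unfolding qpoch_def by (intro continuous_intros)
  have "continuous_on (- {0}) (\<lambda>z. of_real (c * (Rpoly p a b \<mu> ((norm z)\<^sup>2) * Rpoly p a' b' \<mu>' (p powr (- 2) * (norm z)\<^sup>2) / qpoch p n (k * (norm z)\<^sup>2))) * (phase_mono m z * cnj (phase_mono m' z)))"
    using pos by (intro continuous_on_mult continuous_on_of_real continuous_on_divide continuous_Rpoly continuous_phase_mono continuous_on_cnj cq continuous_intros) (auto simp: less_le)
  then show cont: "continuous_on (- {0}) ?h"
    by (rule continuous_on_eq) (simp add: H')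
  obtain C1 where C1: "\<And>r. r \<ge> 0 \<Longrightarrow> \<bar>Rpoly p a b \<mu> (1 * r\<^sup>2)\<bar> * r ^ \<mu> \<le> C1 * sqrt (1 + r\<^sup>2) ^ (a + b + \<mu>)"
    using Rpoly_bound[OF A(1), of 1] by auto
  obtain C2 where C2: "\<And>r. r \<ge> 0 \<Longrightarrow> \<bar>Rpoly p a' b' \<mu>' (p powr (- 2) * r\<^sup>2)\<bar> * r ^ \<mu>' \<le> C2 * sqrt (1 + r\<^sup>2) ^ (a' + b' + \<mu>')"
    using Rpoly_bound[OF A(3), of "p powr (- 2)"] by auto
  obtain c3 where c3: "c3 > 0" "\<And>t. t \<ge> 0 \<Longrightarrow> c3 * (1 + t) ^ n \<le> qpoch p n t" using qpoch_lower_bound[OF p] by blast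
  define l where "l = min 1 k"
  have l: "l > 0" "l \<le> 1" "l \<le> k" using k by (auto simp: l_def)
  show "integrable lborel ?h"
  proof (rule integrable_punctured_bound[OF cont, of 1 "\<bar>c\<bar> * (C1 * C2) / (c3 * l ^ n)"])
    fix z :: complex assume z: "z \<noteq> 0"
    define r s where "r = norm z" and "s = sqrt (1 + r\<^sup>2)"
    have s: "s \<ge> 1" by (simp add: s_def)
    then have sp: "s ^ k > 0" for k by simp
    \<comment> \<open>The surplus 4 is what \<open>sqrt_weight\<close> consumes to bring in the
      integrable kernel.\<close>
    have exp: "a + b + \<mu> + (a' + b' + \<mu>') + 4 = 2 * n"
    proof -
      have "real (a + b + \<mu> + (a' + b' + \<mu>') + 4) = real (2 * n)" using A by (simp add: \<mu>_def \<mu>'_def)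
      then show ?thesis by (simp only: of_nat_eq_iff)
    qed
    have q: "c3 * l ^ n * s ^ (2 * n) \<le> qpoch p n (k * r\<^sup>2)"
    proof -
      have "s ^ (2 * n) = (1 + r\<^sup>2) ^ n" by (simp add: s_def power_mult)
      then have "l ^ n * s ^ (2 * n) = (l * (1 + r\<^sup>2)) ^ n" by (simp add: power_mult_distrib)
      also have "\<dots> \<le> (1 + k * r\<^sup>2) ^ n"
        using l k by (intro power_mono) (auto simp: distrib_left add_mono mult_right_mono)
      finally have "c3 * (l ^ n * s ^ (2 * n)) \<le> c3 * (1 + k * r\<^sup>2) ^ n" using c3 by simp
      also have "\<dots> \<le> qpoch p n (k * r\<^sup>2)" using c3 k by simp
      finally show ?thesis by (simp add: mult_ac)
    qed
    define P1 P2 D where "P1 = \<bar>Rpoly p a b \<mu> (r\<^sup>2)\<bar> * r ^ \<mu>" and "P2 = \<bar>Rpoly p a' b' \<mu>' (p powr (- 2) * r\<^sup>2)\<bar> * r ^ \<mu>'"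
      and "D = qpoch p n (k * r\<^sup>2)"
    have Dp: "D > 0" using pos[of z] by (simp add: D_def r_def)
    have P: "0 \<le> P1" "0 \<le> P2" "P1 \<le> C1 * s ^ (a + b + \<mu>)" "P2 \<le> C2 * s ^ (a' + b' + \<mu>')"
      using C1[of r] C2[of r] by (auto simp: P1_def P2_def s_def r_def)
    have "norm (?h z) = \<bar>c\<bar> * (P1 * P2) / D"
      unfolding H'[OF z] norm_mult norm_of_real abs_mult abs_divide complex_mod_cnj norm_phase_mono
      using Dp by (simp add: P1_def P2_def D_def r_def \<mu>_def \<mu>'_def mult_ac)
    also have "\<dots> \<le> \<bar>c\<bar> * ((C1 * s ^ (a + b + \<mu>)) * (C2 * s ^ (a' + b' + \<mu>'))) / D"
      using P Dp by (intro divide_right_mono mult_left_mono mult_mono) (auto intro: order_trans[OF P(1)])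
    finally have hb: "norm (?h z) \<le> \<bar>c\<bar> * ((C1 * s ^ (a + b + \<mu>)) * (C2 * s ^ (a' + b' + \<mu>'))) / D" .
    have "norm (?h z) * (r * (1 + 1 * r\<^sup>2)) \<le> (\<bar>c\<bar> * ((C1 * s ^ (a + b + \<mu>)) * (C2 * s ^ (a' + b' + \<mu>'))) / D) * s ^ 4"
      by (intro mult_mono hb order_trans[OF norm_ge_zero hb]) (use sqrt_weight[of z] in \<open>auto simp: r_def s_def\<close>)
    also have "\<dots> = (\<bar>c\<bar> * (C1 * C2)) * (s ^ (2 * n) / D)"
    proof -
      have sx: "s ^ (2 * n) = s ^ (a + b + \<mu>) * s ^ (a' + b' + \<mu>') * s ^ 4" by (simp only: exp[symmetric] power_add)
      show ?thesis unfolding sx by (simp add: mult_ac)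
    qed
    also have "\<dots> \<le> (\<bar>c\<bar> * (C1 * C2)) * (1 / (c3 * l ^ n))"
    proof (rule mult_left_mono)
      show "s ^ (2 * n) / D \<le> 1 / (c3 * l ^ n)" using q Dp c3(1) l(1) by (simp add: D_def divide_simps mult_ac)
      have "0 \<le> C1 * s ^ (a + b + \<mu>)" "0 \<le> C2 * s ^ (a' + b' + \<mu>')" using P by linarith+
      then have "0 \<le> C1" "0 \<le> C2" using sp[of "a + b + \<mu>"] sp[of "a' + b' + \<mu>'"] by (auto simp: zero_le_mult_iff)
      then show "0 \<le> \<bar>c\<bar> * (C1 * C2)" by simp
    qed
    finally show "norm (?h z) * (norm z * (1 + 1 * (norm z)\<^sup>2)) \<le> \<bar>c\<bar> * (C1 * C2) / (c3 * l ^ n)" by (simp add: r_def)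
  qed simp
qed

section \<open>Orthonormality\<close>

lemma integral_cis_int:
  assumes "k \<noteq> (0::int)"
  shows "integral {0..2*pi} (\<lambda>\<phi>. cis (of_int k * \<phi>)) = 0"
proof -
  have d: "((\<lambda>\<phi>. cis (of_int k * \<phi>) / (\<i> * of_int k)) has_vector_derivative cis (of_int k * \<phi>)) (at \<phi>)" for \<phi>
  proof -
    have "((\<lambda>w. exp (\<i> * (of_int k * w)) / (\<i> * of_int k)) has_field_derivative exp (\<i> * (of_int k * of_real \<phi>))) (at (of_real \<phi>))"
      using assms by (auto intro!: derivative_eq_intros simp: field_simps)
    from has_vector_derivative_real_field[OF this] show ?thesis by (simp add: cis_conv_exp)
  qed
  have "cis (of_int k * (2 * pi)) = 1" using cis_multiple_2pi[of "of_int k"] by (simp add: mult_ac)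
  then show ?thesis using circle_parts[OF d] by (simp add: integral_unique)
qed

lemma half_Psi_orthogonal_M:
  assumes N: "2 * N \<in> \<int>" and p: "p > 0" and i: "(J, M) \<in> basis_index N" "(J', M') \<in> basis_index N" and M: "M \<noteq> M'"
  shows "(LINT z|lborel. half_integrand p (Psi1 J M N) (Psi1 J' M' N) z) = 0" (is "integral\<^sup>L _ ?h = _")
proof -
  obtain a b a' b' T' n m m' where A0: "real a = J - max \<bar>M\<bar> \<bar>N\<bar>" "a \<le> b" "M + N = of_int m" "real (a + b + nat \<bar>m\<bar>) = 2 * J"
    "real a' = J' - max \<bar>M'\<bar> \<bar>N\<bar>" "a' \<le> b'" "M' + N = of_int m'" "a' + b' + nat \<bar>m'\<bar> = T'" "real T' = 2 * J'" "J + J' + 2 = real n"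
    and H0: "\<forall>z. z \<noteq> 0 \<longrightarrow> ?h z =
      of_real ((psi_sign m * psi_sign m' * psi_const p a b (nat \<bar>m\<bar>) * psi_const p a' b' (nat \<bar>m'\<bar>) * p powr (N * M / 2 - N * M' / 2) * inverse p ^ (nat \<bar>m'\<bar> + 1))
        * (Rpoly p a b (nat \<bar>m\<bar>) ((norm z)\<^sup>2) * Rpoly p a' b' (nat \<bar>m'\<bar>) (p powr (- 2) * (norm z)\<^sup>2) / qpoch p n (inverse p ^ (T' + 2) * (norm z)\<^sup>2)))
      * (phase_mono m z * cnj (phase_mono m' z))"
    by (rule half_Psi_form[OF N p i]) (rule that)
  define F where "F x = (psi_sign m * psi_sign m' * psi_const p a b (nat \<bar>m\<bar>) * psi_const p a' b' (nat \<bar>m'\<bar>) * p powr (N * M / 2 - N * M' / 2) * inverse p ^ (nat \<bar>m'\<bar> + 1))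
        * (Rpoly p a b (nat \<bar>m\<bar>) x * Rpoly p a' b' (nat \<bar>m'\<bar>) (p powr (- 2) * x) / qpoch p n (inverse p ^ (T' + 2) * x))" for x
  note H = H0[rule_format, folded F_def] and m = A0(3,7)
  have mm: "m - m' \<noteq> 0" using M m by auto
  have "(LINT z|lborel. ?h z) = integral\<^sup>L (lborel :: complex measure) (\<lambda>_. 0)"
  proof (rule integral_eq_circlewise)
    show "integrable lborel ?h" "continuous_on (- {0}) ?h" by (rule integrable_half_Psi[OF N p i])+
    fix r :: real assume r: "r > 0"
    have "?h (of_real r * cis \<phi>) = of_real (F (r\<^sup>2) * r ^ nat \<bar>m\<bar> * r ^ nat \<bar>m'\<bar>) * cis (of_int (m - m') * \<phi>)" for \<phi>
    proof -
      have nz: "of_real r * cis \<phi> \<noteq> 0" and nr: "norm (of_real r * cis \<phi>) = r" using r by (auto simp: norm_mult)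
      have cc: "cis (of_int m * \<phi>) * cnj (cis (of_int m' * \<phi>)) = cis (of_int (m - m') * \<phi>)"
        by (simp add: cis_cnj cis_mult left_diff_distrib)
      have "of_real X * ((of_real r ^ k * u) * cnj (of_real r ^ l * v)) = of_real (X * r ^ k * r ^ l) * (u * cnj v)" for X k l u v
        by (simp add: mult_ac)
      then show ?thesis unfolding H[OF nz] nr phase_mono_polar by (simp only: cc)
    qed
    then show "integral {0..2*pi} (\<lambda>\<phi>. ?h (of_real r * cis \<phi>)) = integral {0..2*pi} (\<lambda>\<phi>. 0)"
      by (simp only: integral_mult_right integral_cis_int[OF mm]) simp
  qed auto
  then show ?thesis by simp
qed

text \<open>The order of \<open>J'\<close> and \<open>J\<close> makes the polynomial with the larger
  degree the one that acts as a q-difference. Each summand contributes half of the norm, whence the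
  2 in the denominator.\<close>

lemma half_Psi_integral_le:
  assumes N: "2 * N \<in> \<int>" and p: "p > 0" and i: "(J, M) \<in> basis_index N" "(J', M) \<in> basis_index N" and le: "J' \<le> J"
  shows "(LINT z|lborel. half_integrand p (Psi1 J M N) (Psi1 J' M N) z) = of_real (if J = J' then 1 / (2 * log_factor p) else 0)" (is "integral\<^sup>L _ ?h = _")
proof -
  obtain a b a' b' T' n m m' where A: "real a = J - max \<bar>M\<bar> \<bar>N\<bar>" "a \<le> b" "M + N = of_int m" "real (a + b + nat \<bar>m\<bar>) = 2 * J"
    "real a' = J' - max \<bar>M\<bar> \<bar>N\<bar>" "a' \<le> b'" "M + N = of_int m'" "a' + b' + nat \<bar>m'\<bar> = T'" "real T' = 2 * J'" "J + J' + 2 = real n"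
    and H: "\<forall>z. z \<noteq> 0 \<longrightarrow> ?h z =
      of_real ((psi_sign m * psi_sign m' * psi_const p a b (nat \<bar>m\<bar>) * psi_const p a' b' (nat \<bar>m'\<bar>) * p powr (N * M / 2 - N * M / 2) * inverse p ^ (nat \<bar>m'\<bar> + 1))
        * (Rpoly p a b (nat \<bar>m\<bar>) ((norm z)\<^sup>2) * Rpoly p a' b' (nat \<bar>m'\<bar>) (p powr (- 2) * (norm z)\<^sup>2) / qpoch p n (inverse p ^ (T' + 2) * (norm z)\<^sup>2)))
      * (phase_mono m z * cnj (phase_mono m' z))"
    by (rule half_Psi_form[OF N p i]) (rule that)
  have mm: "m' = m" using A(3,7) by simp
  define \<mu> T d where "\<mu> = nat \<bar>m\<bar>" and "T = a + b + \<mu>" and "d = a - a'"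
  have TJ: "real T = 2 * J" using A(4) by (simp only: T_def \<mu>_def)
  have "real a' \<le> real a" using A(1,5) le by linarith
  then have aa: "a' \<le> a" by simp
  have d: "d \<le> a" "a' = a - d" using aa by (simp_all add: d_def)
  have "real d = real a - real a'" unfolding d_def using aa by (rule of_nat_diff)
  then have dJ: "real d = J - J'" using A(1,5) by linarith
  have "real T' = real T - 2 * real d" using A(9) TJ dJ by linarith
  then have T': "T' + 2 * d = T" by linarith
  have T'': "T' = a + b + \<mu> - 2 * d" using T' by (simp add: T_def)
  have b': "b' = b - d" "d \<le> b" using A(8)[unfolded mm, folded \<mu>_def] T'[unfolded T_def] d aa A(2) by linarith+
  have n: "n = T - d + 2"
  proof -
    have "d \<le> T" using d(1) by (simp add: T_def)
    then have "real (T - d + 2) = real T - real d + 2" by (simp add: of_nat_diff)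
    then have "real n = real (T - d + 2)" using A(10) dJ TJ by linarith
    then show ?thesis by (simp only: of_nat_eq_iff)
  qed
  define c where "c = psi_const p a b \<mu> * psi_const p a' b' \<mu> * inverse p ^ (\<mu> + 1)"
  define F where "F x = c * (Rpoly p a b \<mu> x * Rpoly p a' b' \<mu> (p powr (- 2) * x) / qpoch p n (inverse p ^ (T' + 2) * x)) * x ^ \<mu>" for x
  have HF: "?h z = of_real (F ((norm z)\<^sup>2))" if z: "z \<noteq> 0" for z
    unfolding H[rule_format, OF z] mm phase_mono_self psi_sign_square using p by (simp add: F_def c_def \<mu>_def mult_ac)
  have "(LINT z|lborel. ?h z) = of_real (pi * (LINT t:{0<..}|lborel. F t))"
    by (rule integral_radial[OF integrable_half_Psi(1)[OF N p i] HF])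
  \<comment> \<open>This substitution normalises the argument of \<open>qpoch\<close> and puts the
    two polynomials at the arguments required by \<open>Rpoly_orthogonal\<close>.\<close>
  also have "(LINT t:{0<..}|lborel. F t) = p ^ (T' + 2) * (LINT t:{0<..}|lborel. F (p ^ (T' + 2) * t))"
    by (rule set_integral_scale_Ioi) (use p in simp)
  also have "(LINT t:{0<..}|lborel. F (p ^ (T' + 2) * t)) =
    (LINT t:{0<..}|lborel. (c * p ^ ((T' + 2) * \<mu>)) * (t ^ \<mu> * Rpoly p a b \<mu> (p ^ (T' + 2) * t) * Rpoly p (a - d) (b - d) \<mu> (p ^ T' * t) / qpoch p (T - d + 2) t))"
  proof -
    have e: "p powr (- 2) * (p ^ (T' + 2) * t) = p ^ T' * t" "inverse p ^ (T' + 2) * (p ^ (T' + 2) * t) = t"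
      "(p ^ (T' + 2) * t) ^ \<mu> = p ^ ((T' + 2) * \<mu>) * t ^ \<mu>" for t
    proof -
      have "p powr (- 2) * p ^ (T' + 2) = p ^ T'" unfolding powr_minus_two[OF p] power_add using p by simp
      then show "p powr (- 2) * (p ^ (T' + 2) * t) = p ^ T' * t" by (simp only: mult.assoc[symmetric])
      have "inverse p ^ (T' + 2) * p ^ (T' + 2) = 1" using p by (simp only: power_mult_distrib[symmetric]) simp
      then show "inverse p ^ (T' + 2) * (p ^ (T' + 2) * t) = t" by (simp only: mult.assoc[symmetric] mult_1)
      show "(p ^ (T' + 2) * t) ^ \<mu> = p ^ ((T' + 2) * \<mu>) * t ^ \<mu>" by (simp only: power_mult_distrib power_mult)
    qed
    show ?thesis unfolding F_def e d(2) b'(1) n by (rule arg_cong[where f = "set_lebesgue_integral lborel {0<..}"]) (simp add: fun_eq_iff mult_ac)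
  qed
  also have "\<dots> = (c * p ^ ((T' + 2) * \<mu>)) * (if d = 0 then qfac p T / (log_factor p * p ^ ((T + 1) * (\<mu> + 1)) * qfac p (T + 1) * qfac p a * qfac p b * qfac p (a + \<mu>) * qfac p (b + \<mu>)) else 0)"
    unfolding set_integral_mult_right Rpoly_orthogonal(2)[OF p A(2) d(1), of \<mu>, folded T_def, folded T''[folded T_def]] ..
  finally have I: "(LINT z|lborel. ?h z) = of_real (pi * (p ^ (T' + 2) * ((c * p ^ ((T' + 2) * \<mu>)) *
     (if d = 0 then qfac p T / (log_factor p * p ^ ((T + 1) * (\<mu> + 1)) * qfac p (T + 1) * qfac p a * qfac p b * qfac p (a + \<mu>) * qfac p (b + \<mu>)) else 0))))" .
  show ?thesis
  proof (cases "d = 0")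
    case False
    then have "J \<noteq> J'" using dJ by auto
    then show ?thesis using I False by simp
  next
    case True
    then have JJ: "J = J'" and ab: "a' = a" "b' = b" "T' = T" using d(2) b'(1) T' dJ by simp_all
    define X where "X = qfac p a * qfac p b * qfac p (a + \<mu>) * qfac p (b + \<mu>)"
    have X: "X > 0" using p by (auto simp: X_def intro!: mult_pos_pos qfac_pos)
    have TT: "qfac p T > 0" "qfac p (T + 1) > 0" using p qfac_pos by auto
    have E: "0 \<le> qfac p (T + 1) * X / (2 * pi * qfac p T)"
      using X TT by (intro divide_nonneg_nonneg mult_nonneg_nonneg) auto
    have K: "psi_const p a b \<mu> * psi_const p a b \<mu> = qfac p (T + 1) * X / (2 * pi * qfac p T)"
      unfolding psi_const_def T_def[symmetric] X_def[symmetric] by (simp only: real_sqrt_mult_self abs_of_nonneg[OF E])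
    have cc: "c = qfac p (T + 1) * X / (2 * pi * qfac p T) * inverse p ^ (\<mu> + 1)"
      unfolding c_def ab(1,2) K ..
    \<comment> \<open>The powers stem from dt, from the monomial t^\<mu> and from the dilation in
      the scalar product; together they cancel the power of \<open>p\<close> in the norm of the
      polynomials.\<close>
    have pw: "p ^ (T + 2) * p ^ ((T + 2) * \<mu>) * inverse p ^ (\<mu> + 1) = p ^ ((T + 1) * (\<mu> + 1))"
    proof -
      have "p ^ (T + 2) * p ^ ((T + 2) * \<mu>) = p ^ ((T + 1) * (\<mu> + 1)) * p ^ (\<mu> + 1)"
        by (simp only: power_add[symmetric]) (simp add: algebra_simps)
      moreover have "p ^ (\<mu> + 1) * inverse p ^ (\<mu> + 1) = 1" using p by (simp only: power_mult_distrib[symmetric]) simp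
      ultimately show ?thesis by (simp only: mult.assoc mult_1_right)
    qed
    have alg: "pi * (u * ((Y * X / (2 * pi * Z) * i) * v * (Z / (L * w * Y * qa * qb * qc * qe)))) = 1 / (2 * L)"
      if "u * v * i = w" "w > 0" "X = qa * qb * qc * qe" "X > 0" "Z > 0" "Y > 0" for u Y X Z i v L w qa qb qc qe :: real
    proof -
      have D: "L * w * Y * qa * qb * qc * qe = L * w * Y * X" by (simp only: that(3) mult.assoc)
      have "pi * (u * ((Y * X / (2 * pi * Z) * i) * v * (Z / (L * w * Y * qa * qb * qc * qe)))) =
        (u * v * i) * (pi * ((Y * X / (2 * pi * Z)) * (Z / (L * w * Y * X))))" unfolding D by (simp only: mult_ac)
      also have "\<dots> = 1 / (2 * L)" unfolding that(1) using that(2,4-6) by simp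
      finally show ?thesis .
    qed
    have "pi * (p ^ (T + 2) * ((c * p ^ ((T + 2) * \<mu>)) *
       (qfac p T / (log_factor p * p ^ ((T + 1) * (\<mu> + 1)) * qfac p (T + 1) * qfac p a * qfac p b * qfac p (a + \<mu>) * qfac p (b + \<mu>))))) = 1 / (2 * log_factor p)"
      unfolding cc by (rule alg[OF pw _ X_def X TT]) (use p in simp)
    then show ?thesis using I True JJ ab by simp
  qed
qed

lemma log_factor_inverse: "q > 0 \<Longrightarrow> log_factor (inverse q) = log_factor q"
  using minus_divide_divide[of "q - inverse q" "2 * ln q"] by (simp add: log_factor_def ln_inverse)

lemma log_factor_nonzero: "q > 0 \<Longrightarrow> log_factor q \<noteq> 0"
  using q_diff_inverse_ne[of q] by (auto simp: log_factor_def)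

lemma half_Psi_integral:
  assumes N: "2 * N \<in> \<int>" and p: "p > 0" and i: "(J, M) \<in> basis_index N" "(J', M') \<in> basis_index N"
  shows "(LINT z|lborel. half_integrand p (Psi1 J M N) (Psi1 J' M' N) z)
    = of_real (if (J, M) = (J', M') then 1 / (2 * log_factor p) else 0)"
proof -
  consider "M \<noteq> M'" | "M = M'" "J' \<le> J" | "M = M'" "J < J'" by linarith
  then show ?thesis
  proof cases
    case 1
    then show ?thesis using half_Psi_orthogonal_M[OF N p i] by simp
  next
    case 2
    then show ?thesis using half_Psi_integral_le[OF N p i(1), of J'] i by simp
  next
    \<comment> \<open>The larger J stands on the right here; conjugate symmetry moves it to the left
      at the price of inverting \<open>p\<close>.\<close>
    case 3
    have ip: "inverse p > 0" using p by simp
    have "(LINT z|lborel. half_integrand p (Psi1 J M N) (Psi1 J' M' N) z) =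
      cnj (LINT z|lborel. half_integrand (inverse p) (Psi1 J' M' N) (Psi1 J M N) z)"
      using integral_half_swap[OF ip integrable_half_Psi(1)[OF N ip i(2) i(1)]] by simp
    also have "(LINT z|lborel. half_integrand (inverse p) (Psi1 J' M' N) (Psi1 J M N) z) = 0"
      using half_Psi_integral_le[OF N ip i(2), of J] i 3 by simp
    finally show ?thesis using 3 by simp
  qed
qed

lemma orthonormal_plane:
  assumes q: "q > 0" and N: "2 * N \<in> \<int>"
  shows "orthonormal_family scalar_plane plane_converges q (basis_index N) (\<lambda>(J, M). Psi1 J M N)"
  unfolding orthonormal_family_def
proof (intro ballI)
  fix i j assume ij: "i \<in> basis_index N" "j \<in> basis_index N"
  obtain J M J' M' where e: "i = (J, M)" "j = (J', M')" by (cases i, cases j)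
  have iq: "inverse q > 0" using q by simp
  note h = ij[unfolded e]
  note s = scalar_plane_halves[OF q integrable_half_Psi(1)[OF N q h] integrable_half_Psi(1)[OF N iq h]]
  show "plane_converges q (case i of (J, M) \<Rightarrow> Psi1 J M N) (case j of (J, M) \<Rightarrow> Psi1 J M N) \<and>
    scalar_plane q (case i of (J, M) \<Rightarrow> Psi1 J M N) (case j of (J, M) \<Rightarrow> Psi1 J M N) = (if i = j then 1 else 0)"
    unfolding e prod.case using s(1) unfolding s(2) half_Psi_integral[OF N q h] half_Psi_integral[OF N iq h] log_factor_inverse[OF q]
    using log_factor_nonzero[OF q] by simp
qed

lemma orthonormal_sphere:
  assumes q: "q > 0" and N: "2 * N \<in> \<int>"
  shows "orthonormal_family scalar_sphere sphere_converges q (basis_index N) (\<lambda>(J, M). Psi1 J M N)"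
  using orthonormal_plane[OF q N] sphere_eq_plane[OF q] unfolding orthonormal_family_def by metis

theorem proposition4p1:
  fixes q N :: real
  assumes "q > 0" and "2 * N \<in> \<int>"
  shows "(\<forall>\<psi>1 \<psi>2. plane_converges q \<psi>1 \<psi>2 \<longrightarrow>
            sphere_converges q \<psi>1 \<psi>2 \<and> scalar_sphere q \<psi>1 \<psi>2 = scalar_plane q \<psi>1 \<psi>2)
       \<and> unitarizes scalar_plane plane_converges q N
       \<and> unitarizes scalar_sphere sphere_converges q N
       \<and> orthonormal_family scalar_plane plane_converges q (basis_index N)
           (\<lambda>(J, M). Psi (\<lambda>_ _ _. 1) J M N)
       \<and> orthonormal_family scalar_sphere sphere_converges q (basis_index N)
           (\<lambda>(J, M). Psi (\<lambda>_ _ _. 1) J M N)"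
  using assms sphere_eq_plane unitarizes_plane unitarizes_sphere orthonormal_plane orthonormal_sphere
  by blast

end
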